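(* Let $I=[0,1]$, let $\{I_i\}_{i\in\Lambda}$ be a finite partition of $I$ by intervals and let $f\colon\bigcup_{i\in\Lambda}I_i\to I$ be a map whose restriction to each $I_i$ is continuous and bi-Lipschitz (there are constants $0<c\le C$ with $c|x-y|\le|f(x)-f(y)|\le C|x-y|$ for all $x,y\in I_i$, $i\in\Lambda$). Let $\beta,\epsilon>0$ and assume that $f'$ has finite $1/(\beta+\epsilon)$-variation and that $\inf|f'|>1$. Let $\Phi$ be the Ruelle–Perron–Frobenius operator of $f$ with potential given by the Jacobian $w=|f'|$. Let $0<s<\beta<1$ and $q\in[1,\infty]$. Then $$r_{ess}(\Phi,\mathcal{B}^s_{1,q})\le(\inf|f'|)^{-s}<1 .$$ Moreover $\Phi$ is quasi-compact on $\mathcal{B}^s_{p,q}$ provided $p$ is close enough to $1$ (with $\beta<1/p$), i.e. there is $p_0>1$ such that this holds for all $p\in[1,p_0)$.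
   Context: $I=[0,1]$ carries Lebesgue measure $m$, $|A|=m(A)$, and the dyadic grid $\mathcal{D}=(\mathcal{D}^k)_k$, $\mathcal{D}^k$ being the partition of $[0,1]$ into $2^k$ intervals of equal length. For $r>0$, a function $g$ has finite $1/r$-variation if on each $I_i$ $\sup(\sum_k|g(x_{k+1})-g(x_k)|^{1/r})^{r}<\infty$, the supremum being over finite increasing sequences $x_k<x_{k+1}$ in the interval. Besov space. For $s>0$, $p\in[1,\infty)$, $q\in[1,\infty]$ put $a_Q=|Q|^{s-1/p}1_Q$. $\mathcal{B}^s_{p,q}=\mathcal{B}^s_{p,q}([0,1],m,\mathcal{D})$ is the space of $\psi\in L^p(m)$ that can be written $\psi=\sum_k\sum_{Q\in\mathcal{D}^k}c_Qa_Q$ (the series in $k$ converging in $L^p$) with $\big(\sum_k(\sum_{Q\in\mathcal{D}^k}|c_Q|^p)^{q/p}\big)^{1/q}<\infty$ (supremum over $k$ if $q=\infty$); its norm is the infimum of this quantity over all representations. Transfer operator: with $h_i\colon f(I_i)\to I_i$ the inverse branches, $(\Phi\psi)(x)=\sum_{i:\,x\in f(I_i)}|h_i'(x)|\,\psi(h_i(x))$. $r_{ess}$ denotes the essential spectral radius. *)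

theory Defs
  imports "HOL-Analysis.Analysis"
begin

section \<open>Functions on the unit interval modulo almost everywhere equality\<close>

abbreviation unit_leb :: "real measure" where
  "unit_leb \<equiv> lebesgue_on {0..1}"

quotient_type aefun = "real \<Rightarrow> complex" / "\<lambda>\<phi> \<psi>. AE x in unit_leb. \<phi> x = \<psi> x"
proof (rule equivpI)
  show "reflp (\<lambda>\<phi> \<psi> :: real \<Rightarrow> complex. AE x in unit_leb. \<phi> x = \<psi> x)"
    by (rule reflpI) simp
  show "symp (\<lambda>\<phi> \<psi> :: real \<Rightarrow> complex. AE x in unit_leb. \<phi> x = \<psi> x)"
    by (rule sympI) (simp add: eq_commute)
  show "transp (\<lambda>\<phi> \<psi> :: real \<Rightarrow> complex. AE x in unit_leb. \<phi> x = \<psi> x)"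
    by (rule transpI) (erule (1) AE_mp[OF _ AE_mp], simp)
qed

instantiation aefun :: ab_group_add
begin

lift_definition zero_aefun :: aefun is "\<lambda>x. 0" .

lift_definition plus_aefun :: "aefun \<Rightarrow> aefun \<Rightarrow> aefun" is "\<lambda>\<phi> \<psi> x. \<phi> x + \<psi> x"
  by (elim AE_mp) auto

lift_definition minus_aefun :: "aefun \<Rightarrow> aefun \<Rightarrow> aefun" is "\<lambda>\<phi> \<psi> x. \<phi> x - \<psi> x"
  by (elim AE_mp) auto

lift_definition uminus_aefun :: "aefun \<Rightarrow> aefun" is "\<lambda>\<phi> x. - \<phi> x"
  by (elim AE_mp) auto

instance
  by standard (transfer, simp add: algebra_simps)+

end

lift_definition cscale :: "complex \<Rightarrow> aefun \<Rightarrow> aefun" is "\<lambda>c \<phi> x. c * \<phi> x"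
  by (elim AE_mp) auto

interpretation ae: vector_space cscale
  by standard (transfer, simp add: algebra_simps)+


section \<open>Spectral notions for operators on normed spaces of such functions\<close>

text \<open>A normed space is given by a linear subspace \<open>V\<close> of \<^typ>\<open>aefun\<close> and a norm \<open>N\<close> on it;
  only the values of an operator on \<open>V\<close> matter.\<close>

definition bounded_op :: "aefun set \<Rightarrow> (aefun \<Rightarrow> real) \<Rightarrow> (aefun \<Rightarrow> aefun) \<Rightarrow> bool" where
  "bounded_op V N T \<longleftrightarrow>
     T ` V \<subseteq> V \<and>
     (\<forall>x\<in>V. \<forall>y\<in>V. T (x + y) = T x + T y) \<and>
     (\<forall>c. \<forall>x\<in>V. T (cscale c x) = cscale c (T x)) \<and>
     (\<exists>C. \<forall>x\<in>V. N (T x) \<le> C * N x)"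

definition op_spectrum :: "aefun set \<Rightarrow> (aefun \<Rightarrow> real) \<Rightarrow> (aefun \<Rightarrow> aefun) \<Rightarrow> complex set" where
  "op_spectrum V N T =
     {z. \<not> (\<exists>S. bounded_op V N S \<and>
               (\<forall>x\<in>V. S (cscale z x - T x) = x \<and> cscale z (S x) - T (S x) = x))}"

text \<open>Finite-dimensional kernel and cokernel; on a Banach space the range is then automatically
  closed.\<close>

definition fredholm :: "aefun set \<Rightarrow> (aefun \<Rightarrow> real) \<Rightarrow> (aefun \<Rightarrow> aefun) \<Rightarrow> bool" where
  "fredholm V N A \<longleftrightarrow>
     bounded_op V N A \<and>
     (\<exists>B. finite B \<and> {x \<in> V. A x = 0} \<subseteq> ae.span B) \<and>
     (\<exists>B. finite B \<and> B \<subseteq> V \<and> V \<subseteq> ae.span (A ` V \<union> B))"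

definition ess_spectrum :: "aefun set \<Rightarrow> (aefun \<Rightarrow> real) \<Rightarrow> (aefun \<Rightarrow> aefun) \<Rightarrow> complex set" where
  "ess_spectrum V N T = {z. \<not> fredholm V N (\<lambda>x. cscale z x - T x)}"

text \<open>The suprema are taken in \<^typ>\<open>ennreal\<close>, so that the supremum of the empty set is \<open>0\<close>.\<close>

definition spec_radius :: "aefun set \<Rightarrow> (aefun \<Rightarrow> real) \<Rightarrow> (aefun \<Rightarrow> aefun) \<Rightarrow> ennreal" where
  "spec_radius V N T = (SUP z\<in>op_spectrum V N T. ennreal (norm z))"

definition ess_radius :: "aefun set \<Rightarrow> (aefun \<Rightarrow> real) \<Rightarrow> (aefun \<Rightarrow> aefun) \<Rightarrow> ennreal" where
  "ess_radius V N T = (SUP z\<in>ess_spectrum V N T. ennreal (norm z))"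

definition quasi_compact :: "aefun set \<Rightarrow> (aefun \<Rightarrow> real) \<Rightarrow> (aefun \<Rightarrow> aefun) \<Rightarrow> bool" where
  "quasi_compact V N T \<longleftrightarrow> bounded_op V N T \<and> ess_radius V N T < spec_radius V N T"


section \<open>Besov spaces\<close>

text \<open>The intervals are half-open except the last one of each level, which contains \<open>1\<close>.\<close>

definition dyadic_interval :: "nat \<Rightarrow> nat \<Rightarrow> real set" where
  "dyadic_interval k j =
     (if Suc j = 2 ^ k then {real j / 2 ^ k .. 1} else {real j / 2 ^ k ..< real (Suc j) / 2 ^ k})"

definition dyadic :: "nat \<Rightarrow> real set set" where
  "dyadic k = dyadic_interval k ` {..<2 ^ k}"

definition atom :: "real \<Rightarrow> real \<Rightarrow> real set \<Rightarrow> real \<Rightarrow> complex" where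
  "atom s p Q x = complex_of_real (measure lebesgue Q powr (s - 1 / p) * indicator Q x)"

definition in_Lp :: "real \<Rightarrow> (real \<Rightarrow> complex) \<Rightarrow> bool" where
  "in_Lp p \<psi> \<longleftrightarrow> \<psi> \<in> borel_measurable unit_leb \<and> integrable unit_leb (\<lambda>x. norm (\<psi> x) powr p)"

definition Lp_norm :: "real \<Rightarrow> (real \<Rightarrow> complex) \<Rightarrow> real" where
  "Lp_norm p \<psi> = (LINT x|unit_leb. norm (\<psi> x) powr p) powr (1 / p)"

lemma measurable_unit_leb_AE_cong:
  fixes \<phi> \<psi> :: "real \<Rightarrow> complex"
  assumes eq: "AE x in unit_leb. \<phi> x = \<psi> x" and "\<phi> \<in> borel_measurable unit_leb"
  shows "\<psi> \<in> borel_measurable unit_leb"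
proof -
  have S: "{0..1::real} \<in> sets lebesgue" by simp
  have "(\<lambda>x. indicat_real {0..1} x *\<^sub>R \<phi> x) \<in> borel_measurable lebesgue"
    using assms(2) S by (simp add: borel_measurable_restrict_space_iff)
  moreover have "AE x in lebesgue. indicat_real {0..1} x *\<^sub>R \<phi> x = indicat_real {0..1} x *\<^sub>R \<psi> x"
    using eq S by (auto simp: AE_restrict_space_iff indicator_def)
  ultimately have "(\<lambda>x. indicat_real {0..1} x *\<^sub>R \<psi> x) \<in> borel_measurable lebesgue"
    by (rule borel_measurable_AE)
  then show ?thesis
    using S by (simp add: borel_measurable_restrict_space_iff)
qed

lemma integral_norm_powr_AE_cong:
  fixes \<phi> \<psi> :: "real \<Rightarrow> complex"
  assumes eq: "AE x in unit_leb. \<phi> x = \<psi> x" and meas: "\<phi> \<in> borel_measurable unit_leb"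
  shows "integrable unit_leb (\<lambda>x. norm (\<phi> x) powr p) \<longleftrightarrow>
           integrable unit_leb (\<lambda>x. norm (\<psi> x) powr p)"
    and "Lp_norm p \<phi> = Lp_norm p \<psi>"
proof -
  note meas' = measurable_unit_leb_AE_cong[OF eq meas]
  have ae: "AE x in unit_leb. norm (\<phi> x) powr p = norm (\<psi> x) powr p"
    using eq by (rule AE_mp) auto
  show "integrable unit_leb (\<lambda>x. norm (\<phi> x) powr p) \<longleftrightarrow>
          integrable unit_leb (\<lambda>x. norm (\<psi> x) powr p)"
    using meas meas' ae by (intro integrable_cong_AE) simp_all
  show "Lp_norm p \<phi> = Lp_norm p \<psi>"
    unfolding Lp_norm_def using meas meas' ae by (subst integral_cong_AE) simp_all
qed

lemma dyadic_sets [measurable]: "Q \<in> dyadic k \<Longrightarrow> Q \<in> sets borel"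
  by (auto simp: dyadic_def dyadic_interval_def)

lemma atom_measurable: "Q \<in> dyadic k \<Longrightarrow> atom s p Q \<in> borel_measurable unit_leb"
proof -
  assume "Q \<in> dyadic k"
  then have "Q \<in> sets borel" by (rule dyadic_sets)
  then have "atom s p Q \<in> borel_measurable borel"
    unfolding atom_def by measurable
  then show ?thesis
    by (intro measurable_restrict_space1 measurable_completion) simp
qed

lemma besov_rep_AE_imp:
  fixes \<phi> \<psi> :: "real \<Rightarrow> complex"
  assumes eq: "AE x in unit_leb. \<phi> x = \<psi> x"
    and lp: "in_Lp p \<phi>"
    and lim: "(\<lambda>n. Lp_norm p (\<lambda>x. \<phi> x - (\<Sum>k<n. \<Sum>Q\<in>dyadic k. c Q * atom s p Q x))) \<longlonglongrightarrow> 0"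
  shows "in_Lp p \<psi> \<and>
    (\<lambda>n. Lp_norm p (\<lambda>x. \<psi> x - (\<Sum>k<n. \<Sum>Q\<in>dyadic k. c Q * atom s p Q x))) \<longlonglongrightarrow> 0"
proof
  have meas: "\<phi> \<in> borel_measurable unit_leb"
    using lp by (simp add: in_Lp_def)
  show "in_Lp p \<psi>"
    using lp measurable_unit_leb_AE_cong[OF eq meas] integral_norm_powr_AE_cong(1)[OF eq meas]
    by (simp add: in_Lp_def)
  have "Lp_norm p (\<lambda>x. \<phi> x - (\<Sum>k<n. \<Sum>Q\<in>dyadic k. c Q * atom s p Q x)) =
        Lp_norm p (\<lambda>x. \<psi> x - (\<Sum>k<n. \<Sum>Q\<in>dyadic k. c Q * atom s p Q x))" for n
  proof (rule integral_norm_powr_AE_cong(2))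
    show "(\<lambda>x. \<phi> x - (\<Sum>k<n. \<Sum>Q\<in>dyadic k. c Q * atom s p Q x)) \<in> borel_measurable unit_leb"
      by (intro borel_measurable_diff meas borel_measurable_sum borel_measurable_times
          borel_measurable_const atom_measurable)
  qed (use eq in \<open>rule AE_mp, auto\<close>)
  with lim show "(\<lambda>n. Lp_norm p (\<lambda>x. \<psi> x - (\<Sum>k<n. \<Sum>Q\<in>dyadic k. c Q * atom s p Q x))) \<longlonglongrightarrow> 0"
    by simp
qed

text \<open>The class of \<open>\<psi>\<close> lies in \<open>L\<^sup>p\<close> and is the \<open>L\<^sup>p\<close>-sum over the levels \<open>k\<close> of the series with
  coefficients \<open>c\<close>.\<close>

lift_definition besov_rep :: "real \<Rightarrow> real \<Rightarrow> aefun \<Rightarrow> (real set \<Rightarrow> complex) \<Rightarrow> bool" is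
  "\<lambda>s p \<psi> c. in_Lp p \<psi> \<and>
     (\<lambda>n. Lp_norm p (\<lambda>x. \<psi> x - (\<Sum>k<n. \<Sum>Q\<in>dyadic k. c Q * atom s p Q x))) \<longlonglongrightarrow> 0"
  by (intro ext iffI; elim conjE; rule besov_rep_AE_imp) (auto simp: eq_commute)

definition coeff_finite :: "real \<Rightarrow> ereal \<Rightarrow> (real set \<Rightarrow> complex) \<Rightarrow> bool" where
  "coeff_finite p q c \<longleftrightarrow>
     (if q = \<infinity> then bdd_above (range (\<lambda>k. (\<Sum>Q\<in>dyadic k. norm (c Q) powr p) powr (1 / p)))
      else summable (\<lambda>k. (\<Sum>Q\<in>dyadic k. norm (c Q) powr p) powr (real_of_ereal q / p)))"

definition coeff_norm :: "real \<Rightarrow> ereal \<Rightarrow> (real set \<Rightarrow> complex) \<Rightarrow> real" where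
  "coeff_norm p q c =
     (if q = \<infinity> then (SUP k. (\<Sum>Q\<in>dyadic k. norm (c Q) powr p) powr (1 / p))
      else (\<Sum>k. (\<Sum>Q\<in>dyadic k. norm (c Q) powr p) powr (real_of_ereal q / p))
             powr (1 / real_of_ereal q))"

definition besov :: "real \<Rightarrow> real \<Rightarrow> ereal \<Rightarrow> aefun set" where
  "besov s p q = {\<psi>. \<exists>c. besov_rep s p \<psi> c \<and> coeff_finite p q c}"

definition besov_norm :: "real \<Rightarrow> real \<Rightarrow> ereal \<Rightarrow> aefun \<Rightarrow> real" where
  "besov_norm s p q \<psi> = Inf {coeff_norm p q c | c. besov_rep s p \<psi> c \<and> coeff_finite p q c}"


section \<open>Piecewise maps and their transfer operators\<close>

definition finite_variation_on :: "real \<Rightarrow> (real \<Rightarrow> real) \<Rightarrow> real set \<Rightarrow> bool" where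
  "finite_variation_on r g S \<longleftrightarrow>
     bdd_above {(\<Sum>k<n. \<bar>g (x (Suc k)) - g (x k)\<bar> powr (1 / r)) powr r | x n.
                  (\<forall>k\<le>n. x k \<in> S) \<and> (\<forall>k<n. x k < x (Suc k))}"

text \<open>A bi-Lipschitz function on an interval is differentiable only almost everywhere; its
  derivative is considered on the set of the interior points where it exists.\<close>

definition diff_points :: "(real \<Rightarrow> real) \<Rightarrow> real set \<Rightarrow> real set" where
  "diff_points f J = {x \<in> interior J. f differentiable (at x)}"

definition transfer_fun ::
    "'i set \<Rightarrow> ('i \<Rightarrow> real set) \<Rightarrow> (real \<Rightarrow> real) \<Rightarrow> (real \<Rightarrow> complex) \<Rightarrow> real \<Rightarrow> complex" where
  "transfer_fun \<Lambda> I f \<psi> x =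
     (\<Sum>i\<in>{i \<in> \<Lambda>. x \<in> f ` I i}.
        complex_of_real \<bar>deriv (inv_into (I i) f) x\<bar> * \<psi> (inv_into (I i) f x))"

text \<open>For piecewise bi-Lipschitz \<open>f\<close> the class of \<^term>\<open>transfer_fun \<Lambda> I f \<psi>\<close> depends only on the
  class of \<open>\<psi>\<close>, and the points where some \<^term>\<open>deriv (inv_into (I i) f)\<close> does not exist form a
  null set.\<close>

definition transfer_op ::
    "'i set \<Rightarrow> ('i \<Rightarrow> real set) \<Rightarrow> (real \<Rightarrow> real) \<Rightarrow> aefun \<Rightarrow> aefun" where
  "transfer_op \<Lambda> I f \<psi> = abs_aefun (transfer_fun \<Lambda> I f (rep_aefun \<psi>))"

end

theory Submission
  imports Defs
begin

text \<open>
  For \<open>s > 0\<close> the Besov norm of \<open>\<psi>\<close> is equivalent to the \<open>\<ell>\<^sup>q\<close> norm of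
  \<open>2\<^sup>k\<^sup>s \<parallel>D\<^sub>k \<psi>\<parallel>\<^sub>p\<close>, where \<open>D\<^sub>k \<psi>\<close> are the dyadic martingale differences. Fix \<open>n\<close>.
  Away from a finite set, the \<open>n\<close>-th iterate of the operator maps the indicator of a short interval \<open>E\<close> to
  \<open>1\<^sub>K g\<close>, where \<open>K\<close> is an interval, \<open>g \<le> \<lambda>\<^sup>-\<^sup>n\<close> for \<open>\<lambda> = inf |f'|\<close>, and the variation of \<open>g\<close> on \<open>K\<close>
  is at most half of its infimum; a finite partition achieves this because \<open>|f'|\<close> is controlled by a
  bounded monotone function. Hence, with a universal constant,
  \<open>\<parallel>D\<^sub>k(1\<^sub>K g)\<parallel>\<^sub>1 \<le> C min(|E|, |E|\<^sup>1\<^sup>-\<^sup>\<beta> (\<lambda>\<^sup>-\<^sup>n 2\<^sup>-\<^sup>k)\<^sup>\<beta>)\<close>. Two Schur tests, one over the intervals of a level and one over the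
  levels, bound the \<open>n\<close>-th iterate on functions without coarse levels by \<open>C M\<^sup>n\<^sup>(\<^sup>1\<^sup>-\<^sup>1\<^sup>/\<^sup>p\<^sup>) \<lambda>\<^sup>-\<^sup>n\<^sup>s\<close>, with \<open>C\<close>
  independent of \<open>n\<close> and \<open>M\<close> a bound for the number of preimages of a point under \<open>f\<close>. The remaining coarse part has finite rank, so a Neumann series
  makes \<open>z - \<Phi>\<close> Fredholm as soon as that bound is below \<open>|z|\<^sup>n\<close>. Since \<open>\<Phi>\<close> preserves the integral, \<open>1\<close> lies in
  the spectrum.
\<close>

section \<open>Inequalities for sums of powers\<close>

text \<open>The factor \<lambda>^(-ns) has a simple source. After the level weights, the kernel that
  carries level j to level k is 2^((k-j)s) min(1, (G 2^(j-k))^(\<beta>/p)) with G = \<lambda>^(-n).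
  It grows at rate s until 2^(k-j) reaches G and then decays at rate \<beta>/p - s, so its sum is a
  constant times the peak value G^s. The obstacle is that this constant must not depend on n,
  although the iterate has ever more branches and its weights have no uniform lower bound. Both
  defects concern coarse levels only: a fine enough cell meets at most one exceptional point, hence
  at most two branch pieces, and the lower bound of the weight only decides how fine the cell must
  be. At p = 1 the number of preimages drops out and n-th roots remove the constant. For p > 1 the
  iterate is fixed first and p is moved towards 1 afterwards. The same kernel estimate, applied to
  the identity, shows that martingale differences and arbitrary atomic representations give
  equivalent norms.\<close>

lemma powr_convex_nonneg:
  assumes p: "(1::real) \<le> p"
  shows "convex_on {0..} (\<lambda>x. x powr p)"
proof (rule convex_onI)
  fix t x y :: real
  assume t: "0 < t" "t < 1" and xy: "x \<in> {0..}" "y \<in> {0..}"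
  \<comment> \<open>With one endpoint at 0 the claim reduces to t^p y^p <= t y^p, so this inequality
    carries convexity from the open half-line to 0.\<close>
  have le: "u powr p \<le> u" if "0 \<le> u" "u \<le> 1" for u :: real
    using powr_mono'[of 1 p u] that p by (cases "u = 0") auto
  consider "x = 0" | "y = 0" | "x > 0" "y > 0" using xy by force
  then show "((1 - t) *\<^sub>R x + t *\<^sub>R y) powr p \<le> (1 - t) * x powr p + t * y powr p"
  proof cases
    case 1
    then show ?thesis using t xy le[of t] by (simp add: powr_mult mult_right_mono)
  next
    case 2
    then show ?thesis using t xy le[of "1 - t"] by (simp add: powr_mult mult_right_mono)
  next
    case 3
    then show ?thesis using convex_onD[OF powr_convex[OF p], of t x y] t by simp
  qed
qed (simp add: convex_real_interval)

text \<open>Jensen's inequality for the weights \<open>\<kappa> i / S\<close>, cleared of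
  denominators: the factor \<open>S powr (q - 1)\<close> is S^q divided by S. Row sums of a kernel
  enter with the power q - 1 and column sums then with the power 1, which is the engine of both
  Schur tests.\<close>

lemma powr_sum_jensen:
  fixes \<kappa> b :: "'a \<Rightarrow> real"
  assumes fin: "finite A" and \<kappa>: "\<And>i. i \<in> A \<Longrightarrow> 0 \<le> \<kappa> i" and b: "\<And>i. i \<in> A \<Longrightarrow> 0 \<le> b i" and q: "1 \<le> q"
  shows "(\<Sum>i\<in>A. \<kappa> i * b i) powr q \<le> (\<Sum>i\<in>A. \<kappa> i) powr (q - 1) * (\<Sum>i\<in>A. \<kappa> i * b i powr q)"
proof (cases "(\<Sum>i\<in>A. \<kappa> i) = 0")
  case True
  then have "\<forall>i\<in>A. \<kappa> i = 0" using fin \<kappa> by (simp add: sum_nonneg_eq_0_iff)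
  then show ?thesis using q by simp
next
  case False
  define S where "S = (\<Sum>i\<in>A. \<kappa> i)"
  have S: "S > 0" using False \<kappa> by (simp add: S_def sum_nonneg less_le)
  have "A \<noteq> {}" using False by auto
  then have "(\<Sum>i\<in>A. (\<kappa> i / S) *\<^sub>R b i) powr q \<le> (\<Sum>i\<in>A. (\<kappa> i / S) * b i powr q)"
    by (intro convex_on_sum[OF fin _ powr_convex_nonneg[OF q]])
      (use S \<kappa> b in \<open>auto simp: S_def simp flip: sum_divide_distrib\<close>)
  then have "((\<Sum>i\<in>A. \<kappa> i * b i) / S) powr q \<le> (\<Sum>i\<in>A. \<kappa> i * b i powr q) / S"
    by (simp add: sum_divide_distrib)
  moreover have "((\<Sum>i\<in>A. \<kappa> i * b i) / S) powr q = (\<Sum>i\<in>A. \<kappa> i * b i) powr q / S powr q"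
    using S \<kappa> b by (simp add: powr_divide sum_nonneg)
  moreover have "S powr q = S powr (q - 1) * S"
    using S by (simp add: powr_diff)
  ultimately show ?thesis
    using S unfolding S_def[symmetric] by (simp add: field_simps)
qed

text \<open>(f + g) / (a + b) is the convex combination of f / a and g / b with weights a / (a + b)
  and b / (a + b), so convexity of the power suffices. Upper bounds a and b stand in for the norms
  because \<open>lq_le\<close> speaks of bounds.\<close>

lemma powr_sum_minkowski:
  fixes f g :: "'a \<Rightarrow> real"
  assumes fin: "finite A" and f: "\<And>i. i \<in> A \<Longrightarrow> 0 \<le> f i" and g: "\<And>i. i \<in> A \<Longrightarrow> 0 \<le> g i" and p: "1 \<le> p"
    and a: "0 \<le> a" and b: "0 \<le> b"
    and fa: "(\<Sum>i\<in>A. f i powr p) \<le> a powr p" and gb: "(\<Sum>i\<in>A. g i powr p) \<le> b powr p"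
  shows "(\<Sum>i\<in>A. (f i + g i) powr p) \<le> (a + b) powr p"
proof -
  have zero: "\<forall>i\<in>A. h i = 0" if "(\<Sum>i\<in>A. h i powr p) \<le> 0" for h :: "'a \<Rightarrow> real"
  proof -
    have "(\<Sum>i\<in>A. h i powr p) = 0" using that by (simp add: sum_nonneg antisym)
    then show ?thesis using fin by (simp add: sum_nonneg_eq_0_iff)
  qed
  consider "a = 0" | "b = 0" | "a > 0" "b > 0" using a b by linarith
  then show ?thesis
  proof cases
    case 1
    then have "\<forall>i\<in>A. f i = 0" using fa p by (intro zero) simp
    then show ?thesis using 1 gb by simp
  next
    case 2
    then have "\<forall>i\<in>A. g i = 0" using gb p by (intro zero) simp
    then show ?thesis using 2 fa by simp
  next
    case 3
    define t where "t = b / (a + b)"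
    have t: "0 < t" "t < 1" "1 - t = a / (a + b)"
      using 3 by (auto simp: t_def field_simps)
    have "(f i + g i) powr p / (a + b) powr p \<le> (1 - t) * (f i powr p / a powr p) + t * (g i powr p / b powr p)"
      if "i \<in> A" for i
    proof -
      have "((1 - t) *\<^sub>R (f i / a) + t *\<^sub>R (g i / b)) powr p
              \<le> (1 - t) * (f i / a) powr p + t * (g i / b) powr p"
        using f[OF that] g[OF that] 3 t by (intro convex_onD[OF powr_convex_nonneg[OF p]]) auto
      moreover have "(1 - t) *\<^sub>R (f i / a) + t *\<^sub>R (g i / b) = (f i + g i) / (a + b)"
        using 3 by (simp add: t(3)) (simp add: t_def add_divide_distrib)
      ultimately show ?thesis
        using f[OF that] g[OF that] 3 by (simp add: powr_divide)
    qed
    then have "(\<Sum>i\<in>A. (f i + g i) powr p / (a + b) powr p)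
        \<le> (\<Sum>i\<in>A. (1 - t) * (f i powr p / a powr p) + t * (g i powr p / b powr p))"
      by (rule sum_mono)
    then have "(\<Sum>i\<in>A. (f i + g i) powr p) / (a + b) powr p
        \<le> (1 - t) * ((\<Sum>i\<in>A. f i powr p) / a powr p) + t * ((\<Sum>i\<in>A. g i powr p) / b powr p)"
      by (simp add: sum.distrib sum_divide_distrib sum_distrib_left)
    also have "\<dots> \<le> (1 - t) * 1 + t * 1"
      using 3 t fa gb by (intro add_mono mult_left_mono) auto
    finally show ?thesis using 3 by (simp add: field_simps)
  qed
qed

lemma powr_add_le:
  fixes a b :: real
  assumes "0 \<le> a" "0 \<le> b" "0 \<le> r" "r \<le> 1"
  shows "a powr r + b powr r \<le> 2 * (a + b) powr r"
  using powr_mono2[of r a "a + b"] powr_mono2[of r b "a + b"] assms by linarith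

text \<open>Jensen with unit weights and exponent 1/r. It is applied with r = \<beta> to
  oscillations on cells: the number of cells contributes the power 1 - r, their total oscillation
  the power r.\<close>

lemma sum_powr_le_card:
  fixes x :: "'a \<Rightarrow> real"
  assumes fin: "finite A" and x: "\<And>i. i \<in> A \<Longrightarrow> 0 \<le> x i" and r: "0 < r" "r \<le> 1"
    and m: "real (card A) \<le> m" and W: "(\<Sum>i\<in>A. x i) \<le> W"
  shows "(\<Sum>i\<in>A. x i powr r) \<le> m powr (1 - r) * W powr r"
proof -
  have "(\<Sum>i\<in>A. x i powr r) powr (1 / r) \<le> real (card A) powr (1 / r - 1) * (\<Sum>i\<in>A. x i)"
    using powr_sum_jensen[OF fin, of "\<lambda>_. 1" "\<lambda>i. x i powr r" "1 / r"] r x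
    by (simp add: powr_powr)
  also have "\<dots> \<le> m powr (1 / r - 1) * W"
    using r m W x by (intro mult_mono powr_mono2) (auto intro: sum_nonneg)
  finally have *: "(\<Sum>i\<in>A. x i powr r) powr (1 / r) \<le> m powr (1 / r - 1) * W" .
  have W0: "0 \<le> W" using W x by (meson order_trans sum_nonneg)
  have "(\<Sum>i\<in>A. x i powr r) = ((\<Sum>i\<in>A. x i powr r) powr (1 / r)) powr r"
    using r by (simp add: powr_powr sum_nonneg)
  also have "\<dots> \<le> (m powr (1 / r - 1) * W) powr r"
    using r * by (intro powr_mono2) auto
  also have "\<dots> = m powr (1 - r) * W powr r"
    using r W0 by (simp add: powr_mult powr_powr algebra_simps)
  finally show ?thesis .
qed

section \<open>Sequences with bounded \<open>\<ell>\<^sup>q\<close> norm\<close>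

text \<open>Bounding all partial sums instead of forming the norm avoids summability conditions,
  treats q = \<infinity> along with the finite exponents, and makes the predicate stable under
  pointwise limits.\<close>

definition lq_le :: "ereal \<Rightarrow> (nat \<Rightarrow> real) \<Rightarrow> real \<Rightarrow> bool" where
  "lq_le q b B \<longleftrightarrow> 0 \<le> B \<and>
     (if q = \<infinity> then \<forall>k. b k \<le> B
      else \<forall>n. (\<Sum>k<n. b k powr real_of_ereal q) \<le> B powr real_of_ereal q)"

lemma real_of_ereal_ge_1: "1 \<le> q \<Longrightarrow> q \<noteq> \<infinity> \<Longrightarrow> 1 \<le> real_of_ereal q"
  by (cases q) auto

lemma lq_le_nonneg: "lq_le q b B \<Longrightarrow> 0 \<le> B"
  by (simp add: lq_le_def)

lemma lq_le_mono:
  assumes "lq_le q b B" "\<And>k. 0 \<le> b' k" "\<And>k. b' k \<le> b k" "B \<le> B'" "1 \<le> q"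
  shows "lq_le q b' B'"
proof (cases "q = \<infinity>")
  case True
  have "b' k \<le> B'" for k
  proof -
    have "b k \<le> B" using True assms(1) by (simp add: lq_le_def)
    then show ?thesis using assms(3)[of k] assms(4) by linarith
  qed
  then show ?thesis using True assms by (simp add: lq_le_def)
next
  case False
  note r = real_of_ereal_ge_1[OF assms(5) False]
  have "(\<Sum>k<n. b' k powr real_of_ereal q) \<le> B' powr real_of_ereal q" for n
  proof -
    have "(\<Sum>k<n. b' k powr real_of_ereal q) \<le> (\<Sum>k<n. b k powr real_of_ereal q)"
      using assms r by (intro sum_mono powr_mono2) auto
    also have "\<dots> \<le> B powr real_of_ereal q"
      using assms False by (simp add: lq_le_def)
    also have "\<dots> \<le> B' powr real_of_ereal q"
      using assms r by (intro powr_mono2) (auto simp: lq_le_def)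
    finally show ?thesis .
  qed
  then show ?thesis using assms False by (auto simp: lq_le_def)
qed

lemma lq_le_add:
  assumes "lq_le q b B" "lq_le q b' B'" "\<And>k. 0 \<le> b k" "\<And>k. 0 \<le> b' k" "1 \<le> q"
  shows "lq_le q (\<lambda>k. b k + b' k) (B + B')"
proof (cases "q = \<infinity>")
  case True
  then show ?thesis using assms by (auto simp: lq_le_def intro: add_mono)
next
  case False
  then show ?thesis
    using assms real_of_ereal_ge_1[OF assms(5) False]
    by (auto simp: lq_le_def intro!: powr_sum_minkowski)
qed

lemma lq_le_scale:
  assumes "lq_le q b B" "\<And>k. 0 \<le> b k" "0 \<le> r" "1 \<le> q"
  shows "lq_le q (\<lambda>k. r * b k) (r * B)"
  using assms by (auto simp: lq_le_def powr_mult mult_left_mono simp flip: sum_distrib_left)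

lemma lq_le_zero: "1 \<le> q \<Longrightarrow> 0 \<le> B \<Longrightarrow> lq_le q (\<lambda>k. 0) B"
  by (auto simp: lq_le_def)

text \<open>Fatou's lemma for sequences: each condition in \<open>lq_le\<close> involves finitely
  many terms, so it survives a termwise limit. Whatever is obtained below as a limit of truncations
  keeps its bound in this way.\<close>

lemma lq_le_limit:
  assumes lim: "\<And>k. (\<lambda>n. b n k) \<longlonglongrightarrow> c k" and le: "\<And>n. lq_le q (b n) (B n)"
    and B: "B \<longlonglongrightarrow> B'" and nn: "\<And>n k. 0 \<le> b n k" and q: "1 \<le> q"
  shows "lq_le q c B'"
proof -
  have B0: "0 \<le> B'" by (rule LIMSEQ_le_const[OF B]) (use le in \<open>auto simp: lq_le_def\<close>)
  show ?thesis
  proof (cases "q = \<infinity>")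
    case True
    have "c k \<le> B'" for k
      by (rule LIMSEQ_le[OF lim B]) (use le True in \<open>auto simp: lq_le_def\<close>)
    then show ?thesis using B0 True by (auto simp: lq_le_def)
  next
    case False
    note r = real_of_ereal_ge_1[OF q False]
    have "(\<Sum>k<m. c k powr real_of_ereal q) \<le> B' powr real_of_ereal q" for m
    proof (rule LIMSEQ_le)
      show "(\<lambda>n. \<Sum>k<m. b n k powr real_of_ereal q) \<longlonglongrightarrow> (\<Sum>k<m. c k powr real_of_ereal q)"
        using r nn by (intro tendsto_sum tendsto_powr2 lim tendsto_const) auto
      show "(\<lambda>n. B n powr real_of_ereal q) \<longlonglongrightarrow> B' powr real_of_ereal q"
        using r le by (intro tendsto_powr2 B tendsto_const) (auto simp: lq_le_def)
    qed (use le False in \<open>auto simp: lq_le_def\<close>)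
    then show ?thesis using B0 False by (auto simp: lq_le_def)
  qed
qed

lemma lq_le_nth:
  assumes "lq_le q b B" "\<And>k. 0 \<le> b k" "1 \<le> q"
  shows "b k \<le> B"
proof (cases "q = \<infinity>")
  case True
  then show ?thesis using assms by (auto simp: lq_le_def)
next
  case False
  note r = real_of_ereal_ge_1[OF assms(3) False]
  have "b k powr real_of_ereal q \<le> (\<Sum>k<Suc k. b k powr real_of_ereal q)"
    by (simp add: sum_nonneg)
  also have "\<dots> \<le> B powr real_of_ereal q"
    using assms False unfolding lq_le_def by (simp del: sum.lessThan_Suc)
  finally show ?thesis
    using r assms by (meson lq_le_nonneg not_less order_less_le_trans powr_less_mono2 zero_less_one)
qed

lemma lq_le_single:
  assumes "0 \<le> B" "1 \<le> q"
  shows "lq_le q (\<lambda>k. if k = i then B else 0) B"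
proof (cases "q = \<infinity>")
  case False
  note r = real_of_ereal_ge_1[OF assms(2) False]
  have "(\<Sum>k<n. (if k = i then B else 0) powr real_of_ereal q) \<le> B powr real_of_ereal q" for n
  proof -
    have "(\<Sum>k<n. (if k = i then B else 0) powr real_of_ereal q)
            = (\<Sum>k<n. if k = i then B powr real_of_ereal q else 0)"
      using r by (intro sum.cong) auto
    also have "\<dots> \<le> B powr real_of_ereal q" by (simp add: sum.delta)
    finally show ?thesis .
  qed
  then show ?thesis using assms False by (auto simp: lq_le_def)
qed (use assms in \<open>auto simp: lq_le_def\<close>)

text \<open>With the same bound D for rows and columns, Jensen costs D^(q-1) for the rows and
  exchanging the sums costs D for the columns. The truncation at \<open>n\<close> keeps all sums
  finite, and the bound does not depend on it.\<close>

lemma lq_le_schur: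
  fixes \<kappa> :: "nat \<Rightarrow> nat \<Rightarrow> real"
  assumes b: "lq_le q b B" "\<And>j. 0 \<le> b j" and q: "1 \<le> q" and \<kappa>: "\<And>k j. 0 \<le> \<kappa> k j"
    and row: "\<And>k n. (\<Sum>j<n. \<kappa> k j) \<le> D" and col: "\<And>j n. (\<Sum>k<n. \<kappa> k j) \<le> D"
  shows "lq_le q (\<lambda>k. \<Sum>j<n. \<kappa> k j * b j) (D * B)"
proof -
  have D: "0 \<le> D" using row[of 0 0] by simp
  have B: "0 \<le> B" using b(1) by (rule lq_le_nonneg)
  show ?thesis
  proof (cases "q = \<infinity>")
    case True
    have "(\<Sum>j<n. \<kappa> k j * b j) \<le> D * B" for k
    proof -
      have "(\<Sum>j<n. \<kappa> k j * b j) \<le> (\<Sum>j<n. \<kappa> k j * B)"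
        using True b \<kappa> by (intro sum_mono mult_left_mono) (auto simp: lq_le_def)
      also have "\<dots> \<le> D * B"
        using row[of k n] B by (simp add: mult_right_mono flip: sum_distrib_right)
      finally show ?thesis .
    qed
    then show ?thesis using True D B by (auto simp: lq_le_def)
  next
    case False
    define r where "r = real_of_ereal q"
    have r: "1 \<le> r" unfolding r_def by (rule real_of_ereal_ge_1[OF q False])
    have "(\<Sum>k<m. (\<Sum>j<n. \<kappa> k j * b j) powr r) \<le> (D * B) powr r" for m
    proof -
      have "(\<Sum>k<m. (\<Sum>j<n. \<kappa> k j * b j) powr r)
          \<le> (\<Sum>k<m. (\<Sum>j<n. \<kappa> k j) powr (r - 1) * (\<Sum>j<n. \<kappa> k j * b j powr r))"
        using \<kappa> b r by (intro sum_mono powr_sum_jensen) auto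
      also have "\<dots> \<le> (\<Sum>k<m. D powr (r - 1) * (\<Sum>j<n. \<kappa> k j * b j powr r))"
        using \<kappa> row r by (intro sum_mono mult_right_mono powr_mono2) (auto intro!: sum_nonneg)
      also have "\<dots> = D powr (r - 1) * (\<Sum>j<n. (\<Sum>k<m. \<kappa> k j) * b j powr r)"
        by (simp add: sum_distrib_left sum_distrib_right sum.swap[of _ "{..<m}"])
      also have "\<dots> \<le> D powr (r - 1) * (\<Sum>j<n. D * b j powr r)"
        using col by (intro mult_left_mono sum_mono mult_right_mono) auto
      also have "\<dots> = D powr r * (\<Sum>j<n. b j powr r)"
        using D by (cases "D = 0") (simp_all add: powr_diff flip: sum_distrib_left)
      also have "\<dots> \<le> D powr r * B powr r"
        using b False by (intro mult_left_mono) (auto simp: lq_le_def r_def)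
      finally show ?thesis using D B by (simp add: powr_mult)
    qed
    then show ?thesis using False D B by (auto simp: lq_le_def r_def)
  qed
qed

text \<open>The infimum of an empty set of bounds is junk, so \<open>lq_norm\<close> is meaningful only on sequences that
  admit a bound.\<close>

definition lq_norm :: "ereal \<Rightarrow> (nat \<Rightarrow> real) \<Rightarrow> real" where
  "lq_norm q b = Inf {B. lq_le q b B}"

lemma lq_norm_le: "lq_le q b B \<Longrightarrow> lq_norm q b \<le> B"
  unfolding lq_norm_def by (rule cInf_lower) (auto simp: bdd_below_def lq_le_def)

text \<open>The set of bounds is closed, so its infimum is a bound: a constant sequence is fed to
  \<open>lq_le_limit\<close> with bounds decreasing to the infimum.\<close>

lemma lq_norm_attained:
  assumes "lq_le q b B" "\<And>k. 0 \<le> b k" "1 \<le> q"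
  shows "lq_le q b (lq_norm q b)"
proof -
  let ?B = "\<lambda>n. lq_norm q b + inverse (real (Suc n))"
  have le: "lq_le q b (?B n)" for n
  proof -
    have ne: "{B. lq_le q b B} \<noteq> {}" using assms(1) by auto
    have "lq_norm q b < ?B n" by simp
    then have "Inf {B. lq_le q b B} < ?B n" unfolding lq_norm_def .
    from cInf_lessD[OF ne this] show ?thesis
    proof (elim bexE)
      fix C assume "C \<in> {B. lq_le q b B}" and C: "C < ?B n"
      then have "lq_le q b C" by (simp only: mem_Collect_eq)
      then show ?thesis by (rule lq_le_mono[OF _ assms(2) order_refl less_imp_le[OF C] assms(3)])
    qed
  qed
  have lim: "?B \<longlonglongrightarrow> lq_norm q b"
    using tendsto_add[OF tendsto_const LIMSEQ_inverse_real_of_nat, of "lq_norm q b"] by simp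
  show ?thesis
    by (rule lq_le_limit[OF tendsto_const le lim assms(2,3)])
qed

section \<open>Integrable classes\<close>

text \<open>Lebesgue measure is complete, so changing a function on a null set preserves
  measurability. This makes integrability and the integral well defined on classes, whatever
  representative is taken.\<close>

lemma unit_leb_AE_cong:
  fixes f g :: "real \<Rightarrow> 'a :: euclidean_space"
  assumes eq: "AE x in unit_leb. f x = g x"
  shows "f \<in> borel_measurable unit_leb \<longleftrightarrow> g \<in> borel_measurable unit_leb"
    and "integrable unit_leb f \<longleftrightarrow> integrable unit_leb g"
    and "(LINT x|unit_leb. f x) = (LINT x|unit_leb. g x)"
proof -
  have S: "{0..1::real} \<in> sets lebesgue" by simp
  have *: "v \<in> borel_measurable unit_leb"
    if "AE x in unit_leb. u x = v x" "u \<in> borel_measurable unit_leb" for u v :: "real \<Rightarrow> 'a"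
  proof -
    have "(\<lambda>x. indicat_real {0..1} x *\<^sub>R u x) \<in> borel_measurable lebesgue"
      using that(2) S by (simp add: borel_measurable_restrict_space_iff)
    moreover have "AE x in lebesgue. indicat_real {0..1} x *\<^sub>R u x = indicat_real {0..1} x *\<^sub>R v x"
      using that(1) S by (auto simp: AE_restrict_space_iff indicator_def)
    ultimately have "(\<lambda>x. indicat_real {0..1} x *\<^sub>R v x) \<in> borel_measurable lebesgue"
      by (rule borel_measurable_AE)
    then show ?thesis using S by (simp add: borel_measurable_restrict_space_iff)
  qed
  have eq': "AE x in unit_leb. g x = f x" using eq by (simp add: eq_commute)
  show m: "f \<in> borel_measurable unit_leb \<longleftrightarrow> g \<in> borel_measurable unit_leb"
    using *[OF eq] *[OF eq'] by blast
  show i: "integrable unit_leb f \<longleftrightarrow> integrable unit_leb g"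
    using integrable_cong_AE[OF _ _ eq] m by (auto dest: borel_measurable_integrable)
  show "(LINT x|unit_leb. f x) = (LINT x|unit_leb. g x)"
  proof (cases "f \<in> borel_measurable unit_leb")
    case True
    then show ?thesis using m eq by (intro integral_cong_AE) auto
  next
    \<comment> \<open>Non-measurable functions have the default integral 0 on both sides.\<close>
    case False
    then have "\<not> integrable unit_leb f" "\<not> integrable unit_leb g"
      using m by (auto dest: borel_measurable_integrable)
    then show ?thesis by (simp add: not_integrable_integral_eq)
  qed
qed

lift_definition ae_int :: "aefun \<Rightarrow> bool" is "integrable unit_leb"
  by (rule unit_leb_AE_cong)

lift_definition lint :: "aefun \<Rightarrow> complex" is "\<lambda>\<phi>. LINT x|unit_leb. \<phi> x"
  by (rule unit_leb_AE_cong)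

lift_definition norm1 :: "aefun \<Rightarrow> real" is "\<lambda>\<phi>. LINT x|unit_leb. norm (\<phi> x)"
  by (rule unit_leb_AE_cong) (erule AE_mp, simp)

lift_definition restr :: "real set \<Rightarrow> aefun \<Rightarrow> aefun" is "\<lambda>E \<phi> x. indicator E x * \<phi> x"
  by (erule AE_mp) simp

lift_definition ae_one :: aefun is "\<lambda>x. 1" .

definition ae_ind :: "real set \<Rightarrow> aefun" where "ae_ind E = restr E ae_one"

lemma ae_int_zero [simp]: "ae_int 0" by transfer simp
lemma ae_int_one [simp]: "ae_int ae_one" by transfer (simp add: finite_measure.integrable_const finite_measure_lebesgue_on)
lemma ae_int_add [simp]: "ae_int x \<Longrightarrow> ae_int y \<Longrightarrow> ae_int (x + y)" by transfer simp
lemma ae_int_diff [simp]: "ae_int x \<Longrightarrow> ae_int y \<Longrightarrow> ae_int (x - y)" by transfer simp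
lemma ae_int_cscale [simp]: "ae_int x \<Longrightarrow> ae_int (cscale c x)" by transfer simp
lemma ae_int_sum [simp]: "(\<And>i. i \<in> A \<Longrightarrow> ae_int (f i)) \<Longrightarrow> ae_int (\<Sum>i\<in>A. f i)"
  by (induction A rule: infinite_finite_induct) auto

lemma ae_int_restr [simp]: "E \<in> sets lebesgue \<Longrightarrow> ae_int x \<Longrightarrow> ae_int (restr E x)"
proof transfer
  fix E :: "real set" and \<phi> :: "real \<Rightarrow> complex"
  assume E: "E \<in> sets lebesgue" and i: "integrable unit_leb \<phi>"
  have m: "(\<lambda>x. indicator E x :: complex) \<in> borel_measurable unit_leb"
    using E by (intro measurable_restrict_space1 borel_measurable_indicator)
  show "integrable unit_leb (\<lambda>x. indicator E x * \<phi> x)"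
    by (rule Bochner_Integration.integrable_bound[OF i])
      (use m borel_measurable_integrable[OF i] in \<open>auto simp: indicator_def\<close>)
qed

lemma ae_int_ae_ind [simp]: "E \<in> sets lebesgue \<Longrightarrow> ae_int (ae_ind E)"
  by (simp add: ae_ind_def)

lemma restr_add: "restr E (x + y) = restr E x + restr E y" by transfer (simp add: algebra_simps)
lemma restr_diff: "restr E (x - y) = restr E x - restr E y" by transfer (simp add: algebra_simps)
lemma restr_cscale: "restr E (cscale c x) = cscale c (restr E x)" by transfer (simp add: algebra_simps)
lemma restr_zero [simp]: "restr E 0 = 0" by transfer simp
lemma restr_restr: "restr E (restr F x) = restr (E \<inter> F) x"
  by transfer (simp add: indicator_inter_arith mult.assoc)
lemma restr_empty [simp]: "restr {} x = 0" by transfer simp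
lemma restr_unit [simp]: "restr {0..1} x = x" by transfer (rule AE_I2, simp)
lemma restr_Un: "A \<inter> B = {} \<Longrightarrow> restr (A \<union> B) x = restr A x + restr B x"
  by transfer (rule AE_I2, auto simp: indicator_def)
lemma restr_negligible: "negligible (A - B) \<Longrightarrow> negligible (B - A) \<Longrightarrow> restr A x = restr B x"
proof transfer
  fix A B :: "real set" and \<phi> :: "real \<Rightarrow> complex"
  assume "negligible (A - B)" "negligible (B - A)"
  then have "AE x in lebesgue. x \<notin> A - B" "AE x in lebesgue. x \<notin> B - A"
    by (simp_all only: negligible_iff_null_sets AE_not_in)
  then have "AE x in lebesgue. indicator A x * \<phi> x = indicator B x * \<phi> x"
    by eventually_elim (auto simp: indicator_def)
  then show "AE x in unit_leb. indicator A x * \<phi> x = indicator B x * \<phi> x"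
    by (simp add: AE_restrict_space_iff, eventually_elim) auto
qed

lemma ae_ind_Un: "A \<inter> B = {} \<Longrightarrow> ae_ind (A \<union> B) = ae_ind A + ae_ind B"
  by (simp add: ae_ind_def restr_Un)
lemma restr_ae_ind: "restr E (ae_ind F) = ae_ind (E \<inter> F)" by (simp add: ae_ind_def restr_restr)

lemma lint_zero [simp]: "lint 0 = 0" by transfer simp
lemma lint_add: "ae_int x \<Longrightarrow> ae_int y \<Longrightarrow> lint (x + y) = lint x + lint y" by transfer simp
lemma lint_diff: "ae_int x \<Longrightarrow> ae_int y \<Longrightarrow> lint (x - y) = lint x - lint y" by transfer simp
lemma lint_cscale: "lint (cscale c x) = c * lint x" by transfer simp
lemma norm_lint_le: "norm (lint x) \<le> norm1 x" by transfer (rule integral_norm_bound)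
lemma norm1_nonneg [simp]: "0 \<le> norm1 x" by transfer simp
lemma norm1_zero [simp]: "norm1 0 = 0" by transfer simp
lemma norm1_minus: "norm1 (x - y) = norm1 (y - x)" by transfer (simp add: norm_minus_commute)
lemma norm1_cscale: "norm1 (cscale c x) = norm c * norm1 x" by transfer (simp add: norm_mult)
lemma norm1_add_le: "ae_int x \<Longrightarrow> ae_int y \<Longrightarrow> norm1 (x + y) \<le> norm1 x + norm1 y"
proof transfer
  fix \<phi> \<psi> :: "real \<Rightarrow> complex" assume i: "integrable unit_leb \<phi>" "integrable unit_leb \<psi>"
  have "(LINT x|unit_leb. norm (\<phi> x + \<psi> x)) \<le> (LINT x|unit_leb. norm (\<phi> x) + norm (\<psi> x))"
    using i by (intro integral_mono) (auto simp: norm_triangle_ineq)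
  then show "(LINT x|unit_leb. norm (\<phi> x + \<psi> x)) \<le> (LINT x|unit_leb. norm (\<phi> x)) + (LINT x|unit_leb. norm (\<psi> x))"
    using i by simp
qed
lemma norm1_eq_0:
  assumes "ae_int x" "norm1 x = 0" shows "x = 0"
  using assms
proof transfer
  fix \<phi> :: "real \<Rightarrow> complex" assume i: "integrable unit_leb \<phi>" "(LINT x|unit_leb. norm (\<phi> x)) = 0"
  then have "AE x in unit_leb. norm (\<phi> x) = 0"
    by (subst integral_nonneg_eq_0_iff_AE[symmetric]) auto
  then show "AE x in unit_leb. \<phi> x = 0" by simp
qed

lemma lint_ae_ind: "E \<in> sets lebesgue \<Longrightarrow> E \<subseteq> {0..1} \<Longrightarrow> lint (ae_ind E) = measure lebesgue E"
  unfolding ae_ind_def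
proof transfer
  fix E :: "real set" assume E: "E \<in> sets lebesgue" "E \<subseteq> {0..1}"
  have "(LINT x|unit_leb. indicator E x * (1::complex)) = (LINT x|unit_leb. complex_of_real (indicator E x))"
    by (intro Bochner_Integration.integral_cong) (auto simp: indicator_def)
  also have "\<dots> = measure unit_leb (E \<inter> space unit_leb)"
    by (subst integral_complex_of_real) simp
  also have "\<dots> = measure lebesgue E"
    using E by (simp add: measure_restrict_space Int_absorb2)
  finally show "(LINT x|unit_leb. indicator E x * (1::complex)) = measure lebesgue E" .
qed

lemma norm1_ae_ind: "E \<in> sets lebesgue \<Longrightarrow> E \<subseteq> {0..1} \<Longrightarrow> norm1 (ae_ind E) = measure lebesgue E"
  unfolding ae_ind_def
proof transfer
  fix E :: "real set" assume E: "E \<in> sets lebesgue" "E \<subseteq> {0..1}"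
  have "(LINT x|unit_leb. norm (indicator E x * (1::complex))) = (LINT x|unit_leb. indicator E x)"
    by (intro Bochner_Integration.integral_cong) (auto simp: indicator_def)
  also have "\<dots> = measure unit_leb (E \<inter> space unit_leb)"
    by (rule Bochner_Integration.integral_indicator)
  also have "\<dots> = measure lebesgue E"
    using E by (simp add: measure_restrict_space Int_absorb2)
  finally show "(LINT x|unit_leb. norm (indicator E x * (1::complex))) = measure lebesgue E" .
qed

lemma norm1_partition:
  assumes x: "ae_int x" and fin: "finite A" and E: "\<And>i. i \<in> A \<Longrightarrow> E i \<in> sets lebesgue"
    and dj: "disjoint_family_on E A"
  shows "(\<Sum>i\<in>A. norm1 (restr (E i) x)) \<le> norm1 x"
  using x
proof (transfer fixing: A E)
  fix \<phi> :: "real \<Rightarrow> complex"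
  assume i: "integrable unit_leb \<phi>"
  have m: "(\<lambda>x. indicator (E i) x :: complex) \<in> borel_measurable unit_leb" if "i \<in> A" for i
    using E[OF that] by (intro measurable_restrict_space1 borel_measurable_indicator)
  have I: "integrable unit_leb (\<lambda>x. norm (indicator (E i) x * \<phi> x))" if "i \<in> A" for i
    by (rule Bochner_Integration.integrable_bound[OF i])
      (use m[OF that] borel_measurable_integrable[OF i] in \<open>auto simp: indicator_def\<close>)
  have le: "(\<Sum>i\<in>A. norm (indicator (E i) x * \<phi> x)) \<le> norm (\<phi> x)" for x
  proof (cases "\<exists>i\<in>A. x \<in> E i")
    case True
    then obtain i where i: "i \<in> A" "x \<in> E i" by blast
    then have "indicator (E i') x = (if i' = i then 1 else 0 :: complex)" if "i' \<in> A" for i'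
      using that dj by (fastforce simp: disjoint_family_on_def indicator_def)
    then have "(\<Sum>i\<in>A. norm (indicator (E i) x * \<phi> x)) = (\<Sum>i'\<in>A. if i' = i then norm (\<phi> x) else 0)"
      by (intro sum.cong) auto
    then show ?thesis using fin i by simp
  qed (auto simp: indicator_def intro!: sum_nonpos)
  have "(\<Sum>i\<in>A. integral\<^sup>L unit_leb (\<lambda>x. norm (indicator (E i) x * \<phi> x)))
      = integral\<^sup>L unit_leb (\<lambda>x. \<Sum>i\<in>A. norm (indicator (E i) x * \<phi> x))"
    using I by (subst Bochner_Integration.integral_sum) auto
  also have "\<dots> \<le> integral\<^sup>L unit_leb (\<lambda>x. norm (\<phi> x))"
    using I i le by (intro integral_mono) auto
  finally show "(\<Sum>i\<in>A. integral\<^sup>L unit_leb (\<lambda>x. norm (indicator (E i) x * \<phi> x)))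
      \<le> integral\<^sup>L unit_leb (\<lambda>x. norm (\<phi> x))" .
qed

section \<open>Dyadic averages\<close>

text \<open>The cap puts the point 1 into the last cell, in agreement with the closed last dyadic
  interval.\<close>

definition dyadic_index :: "nat \<Rightarrow> real \<Rightarrow> nat" where
  "dyadic_index k x = min (nat \<lfloor>2 ^ k * x\<rfloor>) (2 ^ k - 1)"

lemma dyadic_index_less [simp]: "dyadic_index k x < 2 ^ k"
  unfolding dyadic_index_def by (rule le_less_trans[OF min.cobounded2]) simp

lemma mem_dyadic_interval_iff:
  assumes j: "j < 2 ^ k"
  shows "x \<in> dyadic_interval k j \<longleftrightarrow> x \<in> {0..1} \<and> dyadic_index k x = j"
proof -
  have p: "(0::real) < 2 ^ k" by simp
  have le1: "y \<le> 2 ^ k * x \<longleftrightarrow> y / 2 ^ k \<le> x" for y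
    by (simp add: field_simps)
  have le2: "2 ^ k * x < y \<longleftrightarrow> x < y / 2 ^ k" for y
    by (simp add: field_simps)
  have jk: "real (Suc j) \<le> 2 ^ k"
    using of_nat_mono[of "Suc j" "2 ^ k", where 'a = real] j by simp
  have fl: "nat \<lfloor>2 ^ k * x\<rfloor> = i \<longleftrightarrow> real i / 2 ^ k \<le> x \<and> x < real (Suc i) / 2 ^ k" if "0 \<le> x" for i
  proof -
    have "0 \<le> \<lfloor>2 ^ k * x\<rfloor>" using that by simp
    then have "nat \<lfloor>2 ^ k * x\<rfloor> = i \<longleftrightarrow> \<lfloor>2 ^ k * x\<rfloor> = int i" by (simp add: nat_eq_iff)
    also have "\<dots> \<longleftrightarrow> real i \<le> 2 ^ k * x \<and> 2 ^ k * x < real (Suc i)"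
      by (simp add: floor_eq_iff add.commute)
    finally show ?thesis unfolding le1 le2 .
  qed
  show ?thesis
  proof (cases "Suc j = 2 ^ k")
    case True
    have "dyadic_index k x = j \<longleftrightarrow> j \<le> nat \<lfloor>2 ^ k * x\<rfloor>"
      using True by (auto simp: dyadic_index_def min_def)
    moreover have "j \<le> nat \<lfloor>2 ^ k * x\<rfloor> \<longleftrightarrow> real j / 2 ^ k \<le> x" if "0 \<le> x"
      using that unfolding le1[symmetric] by (simp add: le_nat_floor le_nat_iff le_floor_iff)
    moreover have "0 \<le> x" if "real j / 2 ^ k \<le> x"
      using that by (rule order_trans[rotated]) simp
    ultimately show ?thesis
      using True by (auto simp: dyadic_interval_def)
  next
    case False
    then have *: "Suc j < 2 ^ k" using j by simp
    have "dyadic_index k x = j \<longleftrightarrow> nat \<lfloor>2 ^ k * x\<rfloor> = j"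
      using * by (auto simp: dyadic_index_def min_def)
    moreover have "0 \<le> x" if "real j / 2 ^ k \<le> x"
      using that by (rule order_trans[rotated]) simp
    moreover have "x \<le> 1" if "x < real (Suc j) / 2 ^ k"
    proof -
      have "real (Suc j) / 2 ^ k \<le> 1" using jk by simp
      with that show ?thesis by linarith
    qed
    ultimately show ?thesis
      using False fl by (auto simp: dyadic_interval_def)
  qed
qed

lemma dyadic_interval_sets [simp]: "dyadic_interval k j \<in> sets borel" "dyadic_interval k j \<in> sets lebesgue"
  by (auto simp: dyadic_interval_def)

lemma dyadic_interval_subset: "j < 2 ^ k \<Longrightarrow> dyadic_interval k j \<subseteq> {0..1}"
  by (auto simp: mem_dyadic_interval_iff)

lemma dyadic_interval_disjoint: "i < 2 ^ k \<Longrightarrow> j < 2 ^ k \<Longrightarrow> i \<noteq> j \<Longrightarrow> dyadic_interval k i \<inter> dyadic_interval k j = {}"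
  by (auto simp: mem_dyadic_interval_iff)

lemma dyadic_interval_children_disjoint:
  assumes "j < 2 ^ k"
  shows "dyadic_interval (Suc k) (2 * j) \<inter> dyadic_interval (Suc k) (Suc (2 * j)) = {}"
proof (rule dyadic_interval_disjoint)
  have "2 * Suc j \<le> 2 * 2 ^ k" using assms by (intro mult_le_mono2) simp
  then show "2 * j < 2 ^ Suc k" "Suc (2 * j) < 2 ^ Suc k" by simp_all
  show "2 * j \<noteq> Suc (2 * j)" by presburger
qed

lemma dyadic_interval_disjoint_family: "disjoint_family_on (dyadic_interval k) {..<2 ^ k}"
  by (auto simp: disjoint_family_on_def dest: dyadic_interval_disjoint)

lemma measure_dyadic_interval: "j < 2 ^ k \<Longrightarrow> measure lebesgue (dyadic_interval k j) = 1 / 2 ^ k"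
proof -
  assume j: "j < 2 ^ k"
  have *: "real (Suc j) / 2 ^ k = real j / 2 ^ k + 1 / 2 ^ k" by (simp add: add_divide_distrib)
  have pos: "(0::real) \<le> 1 / 2 ^ k" by simp
  show ?thesis
  proof (cases "Suc j = 2 ^ k")
    case True
    then have "real (Suc j) / 2 ^ k = 1"
      using arg_cong[OF True, of real] by simp
    then have "real j / 2 ^ k = 1 - 1 / 2 ^ k" using * by linarith
    then show ?thesis using True pos by (simp add: dyadic_interval_def)
  next
    case False
    then show ?thesis using * pos by (simp add: dyadic_interval_def)
  qed
qed

lemma dyadic_interval_split:
  assumes "j < 2 ^ k"
  shows "dyadic_interval k j = dyadic_interval (Suc k) (2 * j) \<union> dyadic_interval (Suc k) (Suc (2 * j))"
proof -
  define a b m where "a = real j / 2 ^ k" "b = real (Suc j) / 2 ^ k" "m = real (Suc (2 * j)) / 2 ^ Suc k"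
  have e: "real (2 * j) / 2 ^ Suc k = a" "real (Suc (Suc (2 * j))) / 2 ^ Suc k = b"
    by (simp_all add: a_b_m_def field_simps)
  have le: "a \<le> m" "m \<le> b"
    unfolding e[symmetric] a_b_m_def(3) by (intro divide_right_mono; simp)+
  have "Suc (2 * j) \<noteq> 2 ^ Suc k" by (simp, presburger)
  moreover have "Suc (Suc (2 * j)) = 2 ^ Suc k \<longleftrightarrow> Suc j = 2 ^ k" by (simp, presburger)
  moreover have "b = 1" if "Suc j = 2 ^ k"
    using arg_cong[OF that, of real] by (simp add: a_b_m_def)
  ultimately show ?thesis
    using le unfolding dyadic_interval_def e a_b_m_def(1-2)[symmetric] a_b_m_def(3)[symmetric]
    by auto
qed

text \<open>Besov coefficients are indexed by sets, so a cell must determine its level and position.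
  The length gives the level, and disjointness of nonempty cells gives the position.\<close>

lemma dyadic_interval_inj:
  assumes "dyadic_interval k j = dyadic_interval k' j'" "j < 2 ^ k" "j' < 2 ^ k'"
  shows "k = k' \<and> j = j'"
proof -
  have "(1::real) / 2 ^ k = 1 / 2 ^ k'"
    using measure_dyadic_interval[OF assms(2)] measure_dyadic_interval[OF assms(3)] assms(1) by simp
  then have k: "k = k'" by simp
  have "dyadic_interval k j \<noteq> {}"
    using measure_dyadic_interval[OF assms(2)] by auto
  then show ?thesis using k assms dyadic_interval_disjoint[of j k j'] by auto
qed

lemma sum_double: "(\<Sum>j<2 * n. f j) = (\<Sum>j<n. f (2 * j) + f (Suc (2 * j)))" for n :: nat and f :: "nat \<Rightarrow> 'a :: comm_monoid_add"
  by (induction n) (simp_all add: ac_simps)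

definition avg :: "aefun \<Rightarrow> nat \<Rightarrow> nat \<Rightarrow> complex" where
  "avg \<psi> k j = 2 ^ k * lint (restr (dyadic_interval k j) \<psi>)"

text \<open>At level 0 the difference is the mean itself, so that the partial sums telescope to
  conditional expectations. \<open>j div 2\<close> is the parent of the cell
  \<open>j\<close>.\<close>

definition mart_diff :: "aefun \<Rightarrow> nat \<Rightarrow> nat \<Rightarrow> complex" where
  "mart_diff \<psi> k j = avg \<psi> k j - (if k = 0 then 0 else avg \<psi> (k - 1) (j div 2))"

definition step :: "nat \<Rightarrow> (nat \<Rightarrow> complex) \<Rightarrow> aefun" where
  "step k \<alpha> = (\<Sum>j<2 ^ k. cscale (\<alpha> j) (ae_ind (dyadic_interval k j)))"

lemma avg_add: "ae_int x \<Longrightarrow> ae_int y \<Longrightarrow> avg (x + y) k j = avg x k j + avg y k j"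
  by (simp add: avg_def restr_add lint_add algebra_simps)
lemma avg_diff: "ae_int x \<Longrightarrow> ae_int y \<Longrightarrow> avg (x - y) k j = avg x k j - avg y k j"
  by (simp add: avg_def restr_diff lint_diff algebra_simps)
lemma avg_cscale: "avg (cscale c x) k j = c * avg x k j"
  by (simp add: avg_def restr_cscale lint_cscale)
lemma avg_zero [simp]: "avg 0 k j = 0" by (simp add: avg_def)
lemma mart_diff_add: "ae_int x \<Longrightarrow> ae_int y \<Longrightarrow> mart_diff (x + y) k j = mart_diff x k j + mart_diff y k j"
  by (simp add: mart_diff_def avg_add)
lemma mart_diff_diff: "ae_int x \<Longrightarrow> ae_int y \<Longrightarrow> mart_diff (x - y) k j = mart_diff x k j - mart_diff y k j"
  by (simp add: mart_diff_def avg_diff)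
lemma mart_diff_cscale: "mart_diff (cscale c x) k j = c * mart_diff x k j"
  by (simp add: mart_diff_def avg_cscale algebra_simps)
lemma mart_diff_zero [simp]: "mart_diff 0 k j = 0" by (simp add: mart_diff_def)
lemma mart_diff_sum: "(\<And>i. i \<in> A \<Longrightarrow> ae_int (f i)) \<Longrightarrow> mart_diff (\<Sum>i\<in>A. f i) k j = (\<Sum>i\<in>A. mart_diff (f i) k j)"
  by (induction A rule: infinite_finite_induct) (auto simp: mart_diff_add)
lemma avg_sum: "(\<And>i. i \<in> A \<Longrightarrow> ae_int (f i)) \<Longrightarrow> avg (\<Sum>i\<in>A. f i) k j = (\<Sum>i\<in>A. avg (f i) k j)"
  by (induction A rule: infinite_finite_induct) (auto simp: avg_add)

lemma sum_avg_le:
  assumes "ae_int \<psi>"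
  shows "(\<Sum>j<2 ^ k. norm (avg \<psi> k j)) / 2 ^ k \<le> norm1 \<psi>"
proof -
  have "(\<Sum>j<2 ^ k. norm (avg \<psi> k j)) / 2 ^ k = (\<Sum>j<2 ^ k. norm (lint (restr (dyadic_interval k j) \<psi>)))"
    by (simp add: avg_def norm_mult norm_power sum_divide_distrib)
  also have "\<dots> \<le> (\<Sum>j<2 ^ k. norm1 (restr (dyadic_interval k j) \<psi>))"
    by (intro sum_mono norm_lint_le)
  also have "\<dots> \<le> norm1 \<psi>"
    using assms dyadic_interval_disjoint_family by (intro norm1_partition) auto
  finally show ?thesis .
qed

lemma norm_avg_le:
  assumes "ae_int \<psi>"
  shows "norm (avg \<psi> k j) \<le> 2 ^ k * norm1 \<psi>"
proof -
  have "norm1 (restr (dyadic_interval k j) \<psi>) \<le> norm1 \<psi>"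
    using norm1_partition[OF assms, of "{()}" "\<lambda>_. dyadic_interval k j"] by (simp add: disjoint_family_on_def)
  then have "norm (lint (restr (dyadic_interval k j) \<psi>)) \<le> norm1 \<psi>"
    using norm_lint_le order_trans by blast
  then show ?thesis by (simp add: avg_def norm_mult norm_power)
qed

text \<open>Each difference consists of two conditional expectations, and both are contractions of
  L^1, hence the 2. In the parent term every coarser cell is counted twice, which the halved cell
  length compensates.\<close>

lemma sum_mart_diff_le:
  assumes "ae_int \<psi>"
  shows "(\<Sum>j<2 ^ k. norm (mart_diff \<psi> k j)) / 2 ^ k \<le> 2 * norm1 \<psi>"
proof (cases k)
  case 0
  have "(\<Sum>j<2 ^ k. norm (mart_diff \<psi> k j)) / 2 ^ k = (\<Sum>j<2 ^ 0. norm (avg \<psi> 0 j)) / 2 ^ 0"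
    using 0 by (simp add: mart_diff_def)
  then show ?thesis using sum_avg_le[OF assms, of 0] norm1_nonneg[of \<psi>] by linarith
next
  case (Suc m)
  have "(\<Sum>j<2 ^ k. norm (mart_diff \<psi> k j)) \<le> (\<Sum>j<2 ^ k. norm (avg \<psi> k j) + norm (avg \<psi> m (j div 2)))"
    by (intro sum_mono) (simp add: mart_diff_def Suc norm_triangle_ineq4)
  also have "\<dots> = (\<Sum>j<2 ^ k. norm (avg \<psi> k j)) + 2 * (\<Sum>j<2 ^ m. norm (avg \<psi> m j))"
    by (simp add: sum.distrib Suc sum_double sum_distrib_left)
  finally have "(\<Sum>j<2 ^ k. norm (mart_diff \<psi> k j)) / 2 ^ k
      \<le> (\<Sum>j<2 ^ k. norm (avg \<psi> k j)) / 2 ^ k + (\<Sum>j<2 ^ m. norm (avg \<psi> m j)) / 2 ^ m"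
    by (simp add: Suc field_simps)
  then show ?thesis using sum_avg_le[OF assms, of k] sum_avg_le[OF assms, of m] by linarith
qed

lemma ae_int_step [simp]: "ae_int (step k \<alpha>)"
  by (simp add: step_def)

lemma avg_step:
  assumes "i < 2 ^ k"
  shows "avg (step k \<alpha>) k i = \<alpha> i"
proof -
  have "avg (ae_ind (dyadic_interval k j)) k i = (if j = i then 1 else 0)" if "j < 2 ^ k" for j
  proof (cases "j = i")
    case True
    have "lint (ae_ind (dyadic_interval k i)) = complex_of_real (1 / 2 ^ k)"
      using assms by (subst lint_ae_ind) (simp_all only: dyadic_interval_subset measure_dyadic_interval dyadic_interval_sets)
    then show ?thesis
      using True by (simp add: avg_def restr_ae_ind)
  next
    case False
    then have "dyadic_interval k i \<inter> dyadic_interval k j = {}"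
      using dyadic_interval_disjoint[OF assms that] by simp
    then have "restr (dyadic_interval k i) (ae_ind (dyadic_interval k j)) = 0"
      by (simp only: restr_ae_ind) (simp add: ae_ind_def)
    then show ?thesis using False by (simp add: avg_def)
  qed
  then have "avg (cscale (\<alpha> j) (ae_ind (dyadic_interval k j))) k i = (if j = i then \<alpha> i else 0)" if "j < 2 ^ k" for j
    using that by (simp add: avg_cscale)
  then show ?thesis using assms by (simp add: step_def avg_sum)
qed

lemma step_refine: "step k \<alpha> = step (Suc k) (\<lambda>j. \<alpha> (j div 2))"
proof -
  have "cscale (\<alpha> j) (ae_ind (dyadic_interval k j)) = cscale (\<alpha> j) (ae_ind (dyadic_interval (Suc k) (2 * j)))
      + cscale (\<alpha> j) (ae_ind (dyadic_interval (Suc k) (Suc (2 * j))))" if "j < 2 ^ k" for j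
  proof -
    have "dyadic_interval (Suc k) (2 * j) \<inter> dyadic_interval (Suc k) (Suc (2 * j)) = {}"
      by (rule dyadic_interval_children_disjoint[OF that])
    then show ?thesis using that by (simp add: dyadic_interval_split[OF that] ae_ind_Un ae.scale_right_distrib)
  qed
  then show ?thesis by (simp add: step_def sum_double)
qed

lemma step_add: "step k (\<lambda>j. \<alpha> j + \<beta> j) = step k \<alpha> + step k \<beta>"
  by (simp add: step_def ae.scale_left_distrib sum.distrib)
lemma step_diff: "step k (\<lambda>j. \<alpha> j - \<beta> j) = step k \<alpha> - step k \<beta>"
  by (simp add: step_def ae.scale_left_diff_distrib sum_subtractf)
lemma step_zero [simp]: "step k (\<lambda>j. 0) = 0"
  by (simp add: step_def)
lemma step_cong: "(\<And>j. j < 2 ^ k \<Longrightarrow> \<alpha> j = \<beta> j) \<Longrightarrow> step k \<alpha> = step k \<beta>"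
  by (simp add: step_def)

lemma sum_step_mart_diff: "(\<Sum>k<Suc n. step k (mart_diff \<psi> k)) = step n (avg \<psi> n)"
proof (induction n)
  case 0
  show ?case by (simp add: mart_diff_def)
next
  case (Suc n)
  have "step (Suc n) (mart_diff \<psi> (Suc n)) = step (Suc n) (avg \<psi> (Suc n)) - step n (avg \<psi> n)"
    unfolding step_refine[of n] step_diff[symmetric] by (rule step_cong) (simp add: mart_diff_def)
  with Suc show ?case by (simp add: sum.lessThan_Suc[of _ "Suc n"] del: sum.lessThan_Suc)
qed

section \<open>Lebesgue differentiation\<close>

text \<open>The point x may lie anywhere in \<open>{a..b}\<close>, as it does in a dyadic cell. The
  interval is cut at x: the right half is one-sided differentiation for f, the left half the same
  for the reflected function, and the errors add up to the length of the whole.\<close>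

lemma lebesgue_differentiation:
  fixes f :: "real \<Rightarrow> 'b :: euclidean_space"
  assumes int: "\<And>a b. f integrable_on {a..b}"
  obtains N where "negligible N"
    "\<And>x e. x \<notin> N \<Longrightarrow> 0 < e \<Longrightarrow>
       \<exists>d>0. \<forall>a b. a \<le> x \<and> x \<le> b \<and> b - a < d \<longrightarrow> norm (integral {a..b} f - (b - a) *\<^sub>R f x) \<le> e * (b - a)"
proof -
  have right: "\<exists>N. negligible N \<and> (\<forall>x e. x \<notin> N \<longrightarrow> 0 < e \<longrightarrow>
      (\<exists>d>0. \<forall>h. 0 \<le> h \<and> h < d \<longrightarrow> norm (integral {x..x + h} g - h *\<^sub>R g x) \<le> e * h))"
    if "\<And>a b. g integrable_on {a..b}" for g :: "real \<Rightarrow> 'b"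
  proof -
    have "g integrable_on cbox a b" for a b using that by simp
    then obtain N where N: "negligible N"
      "\<And>x e. x \<notin> N \<Longrightarrow> 0 < e \<Longrightarrow> \<exists>d>0. \<forall>h. 0 < h \<and> h < d \<longrightarrow>
         norm (integral (cbox x (x + h *\<^sub>R One)) g /\<^sub>R h ^ DIM(real) - g x) < e"
      using integrable_ccontinuous_explicit[of g] by blast
    have "\<exists>d>0. \<forall>h. 0 \<le> h \<and> h < d \<longrightarrow> norm (integral {x..x + h} g - h *\<^sub>R g x) \<le> e * h"
      if x: "x \<notin> N" and e: "0 < e" for x e
    proof -
      from N(2)[OF x e] obtain d where d: "d > 0"
        "\<And>h. 0 < h \<Longrightarrow> h < d \<Longrightarrow> norm (integral {x..x + h} g /\<^sub>R h - g x) < e"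
        by auto
      have "norm (integral {x..x + h} g - h *\<^sub>R g x) \<le> e * h" if h: "0 \<le> h" "h < d" for h
      proof (cases "h = 0")
        case False
        then have h0: "h > 0" using h by simp
        have "integral {x..x + h} g - h *\<^sub>R g x = h *\<^sub>R (integral {x..x + h} g /\<^sub>R h - g x)"
          using h0 by (simp add: scaleR_diff_right)
        then have "norm (integral {x..x + h} g - h *\<^sub>R g x) = h * norm (integral {x..x + h} g /\<^sub>R h - g x)"
          using h0 by simp
        also have "\<dots> \<le> h * e" using d(2)[OF h0 h(2)] h0 by simp
        finally show ?thesis by (simp add: mult.commute)
      qed simp
      then show ?thesis using d(1) by blast
    qed
    then show ?thesis using N(1) by blast
  qed
  obtain N1 where N1: "negligible N1" "\<And>x e. x \<notin> N1 \<Longrightarrow> 0 < e \<Longrightarrow>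
      \<exists>d>0. \<forall>h. 0 \<le> h \<and> h < d \<longrightarrow> norm (integral {x..x + h} f - h *\<^sub>R f x) \<le> e * h"
    using right[OF int] by blast
  have "(\<lambda>x. f (- x)) integrable_on {a..b}" for a b
    using int[of "- b" "- a"] Henstock_Kurzweil_Integration.integrable_reflect_real[where f = f and a = "- b" and b = "- a"] by simp
  from right[OF this] obtain N2 where N2: "negligible N2" "\<And>x e. x \<notin> N2 \<Longrightarrow> 0 < e \<Longrightarrow>
      \<exists>d>0. \<forall>h. 0 \<le> h \<and> h < d \<longrightarrow> norm (integral {x..x + h} (\<lambda>x. f (- x)) - h *\<^sub>R f (- x)) \<le> e * h"
    by blast
  have "\<exists>d>0. \<forall>a b. a \<le> x \<and> x \<le> b \<and> b - a < d \<longrightarrow> norm (integral {a..b} f - (b - a) *\<^sub>R f x) \<le> e * (b - a)"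
    if x: "x \<notin> N1 \<union> uminus ` N2" and e: "0 < e" for x e
  proof -
    have x': "x \<notin> N1" "- x \<notin> N2" using x by force+
    obtain d1 where d1: "d1 > 0" "\<And>h. 0 \<le> h \<Longrightarrow> h < d1 \<Longrightarrow> norm (integral {x..x + h} f - h *\<^sub>R f x) \<le> e * h"
      using N1(2)[OF x'(1) e] by blast
    obtain d2 where d2: "d2 > 0" "\<And>h. 0 \<le> h \<Longrightarrow> h < d2 \<Longrightarrow>
        norm (integral {(- x)..(- x + h)} (\<lambda>x. f (- x)) - h *\<^sub>R f (- (- x))) \<le> e * h"
      using N2(2)[OF x'(2) e] by blast
    have "norm (integral {a..b} f - (b - a) *\<^sub>R f x) \<le> e * (b - a)"
      if ab: "a \<le> x" "x \<le> b" "b - a < min d1 d2" for a b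
    proof -
      have 1: "norm (integral {x..b} f - (b - x) *\<^sub>R f x) \<le> e * (b - x)"
        using d1(2)[of "b - x"] ab by simp
      have "integral {(- x)..(- a)} (\<lambda>x. f (- x)) = integral {a..x} f"
        by (rule Henstock_Kurzweil_Integration.integral_reflect_real)
      then have 2: "norm (integral {a..x} f - (x - a) *\<^sub>R f x) \<le> e * (x - a)"
        using d2(2)[of "x - a"] ab by simp
      have "integral {a..b} f = integral {a..x} f + integral {x..b} f"
        using ab int by (simp add: Henstock_Kurzweil_Integration.integral_combine)
      then have "integral {a..b} f - (b - a) *\<^sub>R f x
          = (integral {a..x} f - (x - a) *\<^sub>R f x) + (integral {x..b} f - (b - x) *\<^sub>R f x)"
        by (simp add: algebra_simps)
      also have "norm \<dots> \<le> e * (x - a) + e * (b - x)"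
        by (rule norm_triangle_mono[OF 2 1])
      finally show ?thesis by (simp add: algebra_simps)
    qed
    then show ?thesis using d1(1) d2(1) by (intro exI[of _ "min d1 d2"]) auto
  qed
  moreover have "negligible (N1 \<union> uminus ` N2)"
  proof (intro negligible_Un N1(1) negligible_locally_Lipschitz_image[OF order_refl N2(1)])
    show "\<exists>T B. open T \<and> x \<in> T \<and> (\<forall>y\<in>N2 \<inter> T. norm (- y - - x) \<le> B * norm (y - x))" for x
      by (intro exI[of _ UNIV] exI[of _ 1]) (auto simp: norm_minus_commute)
  qed
  ultimately show ?thesis using that by blast
qed

lemma AE_unit_lebI: "negligible N \<Longrightarrow> (\<And>x. x \<in> {0..1} \<Longrightarrow> x \<notin> N \<Longrightarrow> P x) \<Longrightarrow> AE x in unit_leb. P x"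
proof -
  assume "negligible N" and P: "\<And>x. x \<in> {0..1} \<Longrightarrow> x \<notin> N \<Longrightarrow> P x"
  then have "AE x in lebesgue. x \<notin> N"
    by (simp only: negligible_iff_null_sets AE_not_in)
  then have "AE x in lebesgue. x \<in> {0..1} \<longrightarrow> P x"
    by eventually_elim (use P in blast)
  then show ?thesis by (simp add: AE_restrict_space_iff)
qed

lemma avg_abs_aefun:
  assumes i: "integrable unit_leb \<phi>" and j: "j < 2 ^ k"
  shows "avg (abs_aefun \<phi>) k j
    = 2 ^ k * integral {real j / 2 ^ k..real (Suc j) / 2 ^ k} (\<lambda>x. if x \<in> {0..1} then \<phi> x else 0)"
proof -
  define a b where "a = real j / 2 ^ k" "b = real (Suc j) / 2 ^ k"
  have ab: "0 \<le> a" "a \<le> b" "b \<le> 1"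
    using of_nat_mono[of "Suc j" "2 ^ k", where 'a = real] j by (auto simp: a_b_def divide_right_mono)
  have b1: "b = 1" if "Suc j = 2 ^ k"
    using arg_cong[OF that, of real] by (simp add: a_b_def)
  let ?Q = "dyadic_interval k j"
  have "ae_int (restr ?Q (abs_aefun \<phi>))"
    using i by (intro ae_int_restr) (auto simp: ae_int.abs_eq)
  then have i': "integrable unit_leb (\<lambda>x. indicator ?Q x * \<phi> x)"
    by (simp add: restr.abs_eq ae_int.abs_eq)
  have "lint (restr ?Q (abs_aefun \<phi>)) = (LINT x|unit_leb. indicator ?Q x * \<phi> x)"
    by (simp add: restr.abs_eq lint.abs_eq)
  also have "\<dots> = integral {0..1} (\<lambda>x. indicator ?Q x * \<phi> x)"
    by (rule lebesgue_integral_eq_integral[OF i']) simp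
  also have "\<dots> = integral {0..1} (\<lambda>x. if x \<in> {a..b} then (if x \<in> {0..1} then \<phi> x else 0) else 0)"
  \<comment> \<open>The cell and the closed interval differ at most in the endpoint
    \<open>b\<close>.\<close>
  proof (rule integral_spike[of "{b}"])
    fix x assume x: "x \<in> {0..1} - {b}"
    have "x \<in> ?Q \<longleftrightarrow> x \<in> {a..b}"
      using x ab b1 unfolding dyadic_interval_def a_b_def[symmetric] by auto
    then show "(if x \<in> {a..b} then (if x \<in> {0..1} then \<phi> x else 0) else 0) = indicator ?Q x * \<phi> x"
      using x by (simp add: indicator_def)
  qed simp
  also have "\<dots> = integral {a..b} (\<lambda>x. if x \<in> {0..1} then \<phi> x else 0)"
    using ab by (subst Henstock_Kurzweil_Integration.integral_restrict_Int) (simp add: Int_absorb1)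
  finally show ?thesis by (simp only: avg_def a_b_def)
qed

text \<open>Martingale convergence, read off from Lebesgue differentiation along the shrinking cells
  that contain x.\<close>

lemma avg_tendsto_AE:
  assumes i: "integrable unit_leb \<phi>"
  shows "AE x in unit_leb. (\<lambda>k. avg (abs_aefun \<phi>) k (dyadic_index k x)) \<longlonglongrightarrow> \<phi> x"
proof -
  define F where "F = (\<lambda>x. if x \<in> {0..1} then \<phi> x else 0)"
  have "\<phi> integrable_on {0..1}"
    using i by (intro integrable_on_lebesgue_on) auto
  then have "F integrable_on UNIV"
    unfolding F_def by (rule integrable_restrict_UNIV[THEN iffD2])
  then have "F integrable_on {a..b}" for a b
    by (metis integrable_on_subcbox box_real(2) subset_UNIV)
  then obtain N where N: "negligible N" "\<And>x e. x \<notin> N \<Longrightarrow> 0 < e \<Longrightarrow>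
       \<exists>d>0. \<forall>a b. a \<le> x \<and> x \<le> b \<and> b - a < d \<longrightarrow> norm (integral {a..b} F - (b - a) *\<^sub>R F x) \<le> e * (b - a)"
    by (rule lebesgue_differentiation[of F]) blast
  show ?thesis
  proof (rule AE_unit_lebI[OF N(1)])
    fix x :: real assume x: "x \<in> {0..1}" "x \<notin> N"
    show "(\<lambda>k. avg (abs_aefun \<phi>) k (dyadic_index k x)) \<longlonglongrightarrow> \<phi> x"
    proof (rule LIMSEQ_I)
      fix r :: real assume "0 < r"
      then have r: "0 < r / 2" by simp
      from N(2)[OF x(2) r] obtain d where d: "d > 0"
        "\<And>a b. a \<le> x \<Longrightarrow> x \<le> b \<Longrightarrow> b - a < d \<Longrightarrow> norm (integral {a..b} F - (b - a) *\<^sub>R F x) \<le> r / 2 * (b - a)"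
        by blast
      obtain n where n: "(1 / 2) ^ n < d"
        using d(1) real_arch_pow_inv[of d "1 / 2"] by auto
      have "norm (avg (abs_aefun \<phi>) k (dyadic_index k x) - \<phi> x) < r" if k: "n \<le> k" for k
      proof -
        let ?a = "real (dyadic_index k x) / 2 ^ k" and ?b = "real (Suc (dyadic_index k x)) / 2 ^ k"
        have "x \<in> dyadic_interval k (dyadic_index k x)"
          using x by (simp add: mem_dyadic_interval_iff)
        moreover have "?b = 1" if "Suc (dyadic_index k x) = 2 ^ k"
          using arg_cong[OF that, of real] by simp
        ultimately have mem: "?a \<le> x" "x \<le> ?b"
          using x(1) unfolding dyadic_interval_def
          by (auto split: if_splits simp del: of_nat_Suc)
        have len: "?b - ?a = 1 / 2 ^ k" by (simp add: add_divide_distrib)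
        have "1 / 2 ^ k \<le> (1 / 2 :: real) ^ n"
          using k by (simp add: power_one_over power_increasing divide_left_mono)
        with n len have "?b - ?a < d" by linarith
        from d(2)[OF mem this] have *: "norm (integral {?a..?b} F - (1 / 2 ^ k) *\<^sub>R \<phi> x) \<le> r / 2 * (1 / 2 ^ k)"
          unfolding len using x(1) by (simp add: F_def)
        have "avg (abs_aefun \<phi>) k (dyadic_index k x) = 2 ^ k * integral {?a..?b} F"
          unfolding F_def by (rule avg_abs_aefun[OF i]) simp
        then have "avg (abs_aefun \<phi>) k (dyadic_index k x) - \<phi> x = 2 ^ k * (integral {?a..?b} F - (1 / 2 ^ k) *\<^sub>R \<phi> x)"
          by (simp add: algebra_simps scaleR_conv_of_real)
        then have "norm (avg (abs_aefun \<phi>) k (dyadic_index k x) - \<phi> x) = 2 ^ k * norm (integral {?a..?b} F - (1 / 2 ^ k) *\<^sub>R \<phi> x)"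
          by (simp only: norm_mult norm_power) simp
        also have "\<dots> \<le> 2 ^ k * (r / 2 * (1 / 2 ^ k))"
          by (rule mult_left_mono[OF *]) simp
        also have "\<dots> < r" using r by simp
        finally show ?thesis .
      qed
      then show "\<exists>n0. \<forall>k\<ge>n0. norm (avg (abs_aefun \<phi>) k (dyadic_index k x) - \<phi> x) < r" by blast
    qed
  qed
qed

lemma aefun_cases: obtains \<phi> where "\<psi> = abs_aefun \<phi>"
  using Quotient3_abs_rep[OF Quotient3_aefun, of \<psi>] that by metis

section \<open>Level norms\<close>

text \<open>The L^p norm of \<open>step k \<alpha>\<close>: every cell has mass 2^(-k).\<close>

definition mean_norm :: "real \<Rightarrow> nat \<Rightarrow> (nat \<Rightarrow> complex) \<Rightarrow> real" where
  "mean_norm p k \<alpha> = ((\<Sum>j<2 ^ k. norm (\<alpha> j) powr p) / 2 ^ k) powr (1 / p)"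

definition level_norm :: "real \<Rightarrow> real \<Rightarrow> (nat \<Rightarrow> nat \<Rightarrow> complex) \<Rightarrow> nat \<Rightarrow> real" where
  "level_norm s p a k = 2 powr (real k * s) * mean_norm p k (a k)"

lemma mean_norm_nonneg [simp]: "0 \<le> mean_norm p k \<alpha>" by (simp add: mean_norm_def)
lemma level_norm_nonneg [simp]: "0 \<le> level_norm s p a k" by (simp add: level_norm_def)

lemma mean_norm_cong: "(\<And>j. j < 2 ^ k \<Longrightarrow> norm (\<alpha> j) = norm (\<beta> j)) \<Longrightarrow> mean_norm p k \<alpha> = mean_norm p k \<beta>"
  by (simp add: mean_norm_def)

lemma mean_norm_powr: "0 < p \<Longrightarrow> mean_norm p k \<alpha> powr p = (\<Sum>j<2 ^ k. norm (\<alpha> j) powr p) / 2 ^ k"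
  by (simp add: mean_norm_def powr_powr sum_nonneg)

lemma mean_norm_le_iff:
  assumes "0 < p" "0 \<le> B"
  shows "mean_norm p k \<alpha> \<le> B \<longleftrightarrow> (\<Sum>j<2 ^ k. norm (\<alpha> j) powr p) / 2 ^ k \<le> B powr p"
proof -
  have "mean_norm p k \<alpha> \<le> B \<longleftrightarrow> mean_norm p k \<alpha> powr p \<le> B powr p"
    using assms powr_mono2[of p "mean_norm p k \<alpha>" B] powr_less_mono2[of p B "mean_norm p k \<alpha>"]
    by (meson less_imp_le not_le mean_norm_nonneg)
  then show ?thesis using assms by (simp add: mean_norm_powr)
qed

lemma mean_norm_zero [simp]: "0 < p \<Longrightarrow> mean_norm p k (\<lambda>j. 0) = 0" by (simp add: mean_norm_def)

lemma mean_norm_add_le: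
  assumes p: "1 \<le> p"
  shows "mean_norm p k (\<lambda>j. \<alpha> j + \<beta> j) \<le> mean_norm p k \<alpha> + mean_norm p k \<beta>"
proof -
  define r where "r = ((2::real) ^ k) powr (1 / p)"
  have r: "r > 0" "r powr p = 2 ^ k" using p by (auto simp: r_def powr_powr)
  have e: "(\<Sum>j<2 ^ k. norm (\<gamma> j) powr p) = (r * mean_norm p k \<gamma>) powr p" for \<gamma>
    using p r by (simp add: powr_mult mean_norm_powr)
  have "(\<Sum>j<2 ^ k. (norm (\<alpha> j) + norm (\<beta> j)) powr p) \<le> (r * mean_norm p k \<alpha> + r * mean_norm p k \<beta>) powr p"
    using p r by (intro powr_sum_minkowski) (auto simp: e)
  moreover have "(\<Sum>j<2 ^ k. norm (\<alpha> j + \<beta> j) powr p) \<le> (\<Sum>j<2 ^ k. (norm (\<alpha> j) + norm (\<beta> j)) powr p)"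
    using p by (intro sum_mono powr_mono2) (auto simp: norm_triangle_ineq)
  ultimately have "(\<Sum>j<2 ^ k. norm (\<alpha> j + \<beta> j) powr p) \<le> (r * (mean_norm p k \<alpha> + mean_norm p k \<beta>)) powr p"
    by (simp add: distrib_left)
  also have "\<dots> = 2 ^ k * (mean_norm p k \<alpha> + mean_norm p k \<beta>) powr p"
    using r by (simp add: powr_mult)
  finally show ?thesis
    using p by (subst mean_norm_le_iff) (auto simp: field_simps)
qed

lemma mean_norm_scale: "0 < p \<Longrightarrow> mean_norm p k (\<lambda>j. c * \<alpha> j) = norm c * mean_norm p k \<alpha>"
proof -
  assume p: "0 < p"
  have "(\<Sum>j<2 ^ k. norm (c * \<alpha> j) powr p) / 2 ^ k = norm c powr p * ((\<Sum>j<2 ^ k. norm (\<alpha> j) powr p) / 2 ^ k)"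
    by (simp add: norm_mult powr_mult sum_distrib_left)
  moreover have "(norm c powr p) powr (1 / p) = norm c" using p by (simp add: powr_powr)
  ultimately show ?thesis unfolding mean_norm_def by (simp add: powr_mult sum_nonneg del: times_divide_eq_right)
qed

lemma mean_norm_sum_le:
  assumes p: "1 \<le> p"
  shows "mean_norm p k (\<lambda>j. \<Sum>i\<in>A. \<alpha> i j) \<le> (\<Sum>i\<in>A. mean_norm p k (\<alpha> i))"
proof (induction A rule: infinite_finite_induct)
  case (insert x F)
  then show ?case using mean_norm_add_le[OF p, of k "\<alpha> x" "\<lambda>j. \<Sum>i\<in>F. \<alpha> i j"] by simp
qed (use p in auto)

lemma mean_norm_refine: "mean_norm p (Suc k) (\<lambda>j. \<alpha> (j div 2)) = mean_norm p k \<alpha>"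
  by (simp add: mean_norm_def sum_double flip: sum_distrib_left)

lemma mean_norm_refine_iter: "mean_norm p (k + i) (\<lambda>j. \<alpha> (j div 2 ^ i)) = mean_norm p k \<alpha>"
proof (induction i)
  case (Suc i)
  have "mean_norm p (k + Suc i) (\<lambda>j. \<alpha> (j div 2 ^ Suc i)) = mean_norm p (Suc (k + i)) (\<lambda>j. (\<lambda>j. \<alpha> (j div 2 ^ i)) (j div 2))"
    by (simp add: div_mult2_eq)
  also have "\<dots> = mean_norm p (k + i) (\<lambda>j. \<alpha> (j div 2 ^ i))" by (rule mean_norm_refine)
  finally show ?case using Suc by simp
qed simp

lemma mean_norm_1: "mean_norm 1 k \<alpha> = (\<Sum>j<2 ^ k. norm (\<alpha> j)) / 2 ^ k"
  by (simp add: mean_norm_def sum_nonneg)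

lemma mean_norm_1_le:
  assumes p: "1 \<le> p"
  shows "mean_norm 1 k \<alpha> \<le> mean_norm p k \<alpha>"
proof -
  have "(\<Sum>j<2 ^ k. (1 / 2 ^ k) * norm (\<alpha> j)) powr p
      \<le> (\<Sum>j<(2::nat) ^ k. (1 / 2 ^ k :: real)) powr (p - 1) * (\<Sum>j<2 ^ k. (1 / 2 ^ k) * norm (\<alpha> j) powr p)"
    using p by (intro powr_sum_jensen) auto
  then have "mean_norm 1 k \<alpha> powr p \<le> mean_norm p k \<alpha> powr p"
    using p by (simp add: mean_norm_1 mean_norm_powr sum_divide_distrib)
  then show ?thesis
    using p powr_less_mono2[of p "mean_norm p k \<alpha>" "mean_norm 1 k \<alpha>"] by (meson not_le not_less mean_norm_nonneg less_le_trans zero_less_one)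
qed

lemma mean_norm_tendsto:
  assumes "0 < p" "\<And>j. j < 2 ^ k \<Longrightarrow> (\<lambda>n. \<alpha> n j) \<longlonglongrightarrow> \<beta> j"
  shows "(\<lambda>n. mean_norm p k (\<alpha> n)) \<longlonglongrightarrow> mean_norm p k \<beta>"
  unfolding mean_norm_def using assms
  by (intro tendsto_powr2 tendsto_divide tendsto_sum tendsto_norm tendsto_const)
    (auto intro!: always_eventually sum_nonneg divide_nonneg_nonneg)

lemma norm1_step_le: "norm1 (step k \<alpha>) \<le> mean_norm 1 k \<alpha>"
proof -
  have 1: "norm1 (\<Sum>i\<in>A. f i) \<le> (\<Sum>i\<in>A. norm1 (f i))" if "\<And>i. ae_int (f i)" for A :: "nat set" and f
  proof (induction A rule: infinite_finite_induct)
    case (insert x F)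
    then show ?case using norm1_add_le[of "f x" "\<Sum>i\<in>F. f i"] that by simp
  qed auto
  have "norm1 (step k \<alpha>) \<le> (\<Sum>j<2 ^ k. norm1 (cscale (\<alpha> j) (ae_ind (dyadic_interval k j))))"
    unfolding step_def by (rule 1) simp
  also have "\<dots> = (\<Sum>j<2 ^ k. norm (\<alpha> j) * (1 / 2 ^ k))"
    by (intro sum.cong refl, simp only: norm1_cscale, subst norm1_ae_ind)
      (auto simp only: dyadic_interval_subset measure_dyadic_interval dyadic_interval_sets lessThan_iff)
  finally show ?thesis by (simp add: mean_norm_1 sum_divide_distrib)
qed

lemma level_norm_le_iff_mean_norm: "level_norm s p a k \<le> B \<longleftrightarrow> mean_norm p k (a k) \<le> 2 powr (- real k * s) * B"
  by (simp add: level_norm_def powr_minus field_simps)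

lemma geometric_tail_le:
  assumes x: "0 \<le> x" "(x::real) < 1" shows "(\<Sum>k\<in>{n..<m}. x ^ k) \<le> x ^ n / (1 - x)"
proof (cases "n \<le> m")
  case True
  then have "(1 - x) * (\<Sum>k\<in>{n..<m}. x ^ k) = x ^ n - x ^ m"
  proof (induction m rule: dec_induct)
    case (step m)
    then show ?case by (simp only: sum.atLeastLessThan_Suc distrib_left) (simp add: algebra_simps)
  qed simp
  then have "(\<Sum>k\<in>{n..<m}. x ^ k) = (x ^ n - x ^ m) / (1 - x)"
    using x by (simp add: field_simps)
  also have "\<dots> \<le> x ^ n / (1 - x)" using x by (intro divide_right_mono) auto
  finally show ?thesis .
qed (use x in auto)

lemma powr_neg_real_mult: "(2::real) powr (- real k * s) = (2 powr (- s)) ^ k"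
  by (simp add: powr_powr mult.commute flip: powr_realpow)

text \<open>Because s > 0, a mere supremum bound on the weighted levels makes their L^p norms decay
  like 2^(-ks). So the layers converge absolutely for every q.\<close>

lemma sum_mean_norm_le:
  assumes s: "0 < s" and le: "\<And>k. level_norm s p a k \<le> B"
  shows "(\<Sum>k\<in>{n..<m}. mean_norm p k (a k)) \<le> B / (1 - 2 powr (- s)) * (2 powr (- s)) ^ n"
proof -
  have x: "0 \<le> (2::real) powr (- s)" "(2::real) powr (- s) < 1"
    using s powr_less_mono[of "- s" 0 "2 :: real"] by auto
  have B: "0 \<le> B" using le[of 0] level_norm_nonneg order_trans by blast
  have "(\<Sum>k\<in>{n..<m}. mean_norm p k (a k)) \<le> (\<Sum>k\<in>{n..<m}. (2 powr (- s)) ^ k * B)"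
    using le unfolding level_norm_le_iff_mean_norm powr_neg_real_mult by (intro sum_mono) auto
  also have "\<dots> = B * (\<Sum>k\<in>{n..<m}. (2 powr (- s)) ^ k)"
    by (simp add: sum_distrib_left mult.commute)
  also have "\<dots> \<le> B * ((2 powr (- s)) ^ n / (1 - 2 powr (- s)))"
    by (rule mult_left_mono[OF geometric_tail_le[OF x] B])
  finally show ?thesis by simp
qed

section \<open>Besov representations and martingale differences\<close>

text \<open>The value on the cell \<open>j\<close> of the level-\<open>k\<close> layer of the atomic
  series.\<close>

definition amplitude :: "real \<Rightarrow> real \<Rightarrow> (real set \<Rightarrow> complex) \<Rightarrow> nat \<Rightarrow> nat \<Rightarrow> complex" where
  "amplitude s p c k j = c (dyadic_interval k j) * complex_of_real ((1 / 2 ^ k) powr (s - 1 / p))"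

lemma sum_dyadic: "(\<Sum>Q\<in>dyadic k. g Q) = (\<Sum>j<2 ^ k. g (dyadic_interval k j))"
  unfolding dyadic_def
  by (subst sum.reindex) (auto simp: inj_on_def dest: dyadic_interval_inj)

text \<open>The atoms are normalised for this identity: |Q|^((s - 1/p) p) times the mass 2^(-k) is
  2^(-ksp), and the level weight 2^(ks) cancels it. Hence coefficient norms are level norms without
  any loss.\<close>

lemma level_norm_amplitude:
  assumes p: "1 \<le> p"
  shows "level_norm s p (amplitude s p c) k = (\<Sum>Q\<in>dyadic k. norm (c Q) powr p) powr (1 / p)"
proof -
  let ?S = "\<Sum>Q\<in>dyadic k. norm (c Q) powr p"
  have S: "0 \<le> ?S" by (intro sum_nonneg) simp
  define t where "t = (1 / 2 ^ k :: real) powr (s - 1 / p)"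
  have k2: "(2::real) ^ k = 2 powr real k" by (simp add: powr_realpow)
  have t: "t = 2 powr (- real k * (s - 1 / p))"
    unfolding t_def k2 by (simp add: powr_divide powr_powr powr_minus_divide)
  have "(\<Sum>j<2 ^ k. norm (amplitude s p c k j) powr p) / 2 ^ k = ?S * (t powr p / 2 ^ k)"
    by (simp add: amplitude_def t_def[symmetric] norm_mult powr_mult sum_dyadic sum_distrib_right t)
  also have "t powr p / 2 ^ k = 2 powr (- real k * s * p)"
    unfolding t k2 using p by (simp add: powr_powr field_simps flip: powr_diff)
  finally have "mean_norm p k (amplitude s p c k) = ?S powr (1 / p) * 2 powr (- real k * s)"
    using p S by (simp add: mean_norm_def powr_mult powr_powr)
  then show ?thesis by (simp add: level_norm_def powr_minus)
qed

lemma coeff_norm_le: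
  assumes p: "1 \<le> p" and q: "1 \<le> q" and le: "lq_le q (level_norm s p (amplitude s p c)) B"
  shows "coeff_finite p q c \<and> coeff_norm p q c \<le> B"
proof -
  let ?L = "\<lambda>k. (\<Sum>Q\<in>dyadic k. norm (c Q) powr p) powr (1 / p)"
  have L: "level_norm s p (amplitude s p c) = ?L" using level_norm_amplitude[OF p] by (rule ext)
  have B: "0 \<le> B" using le by (rule lq_le_nonneg)
  show ?thesis
  proof (cases "q = \<infinity>")
    case True
    then have "\<And>k. ?L k \<le> B" using le by (simp add: lq_le_def L)
    then show ?thesis using True by (auto simp: coeff_finite_def coeff_norm_def intro!: cSUP_least bdd_aboveI)
  next
    case False
    define r where "r = real_of_ereal q"
    have r: "1 \<le> r" unfolding r_def by (rule real_of_ereal_ge_1[OF q False])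
    have e: "(\<Sum>Q\<in>dyadic k. norm (c Q) powr p) powr (r / p) = ?L k powr r" for k
      by (simp add: powr_powr)
    have le': "(\<Sum>k<n. ?L k powr r) \<le> B powr r" for n
      using le False by (simp add: lq_le_def L r_def)
    then have sm: "summable (\<lambda>k. ?L k powr r)"
      by (intro summableI_nonneg_bounded) auto
    have "(\<Sum>k. ?L k powr r) \<le> B powr r"
      by (rule suminf_le_const[OF sm le'])
    then have "(\<Sum>k. ?L k powr r) powr (1 / r) \<le> (B powr r) powr (1 / r)"
      using r sm by (intro powr_mono2) (auto intro!: suminf_nonneg)
    then show ?thesis
      using False sm r B unfolding coeff_finite_def coeff_norm_def r_def[symmetric] e by (simp add: powr_powr)
  qed
qed

lemma lq_le_coeff_norm:
  assumes p: "1 \<le> p" and q: "1 \<le> q" and fin: "coeff_finite p q c"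
  shows "lq_le q (level_norm s p (amplitude s p c)) (coeff_norm p q c)"
proof -
  let ?L = "\<lambda>k. (\<Sum>Q\<in>dyadic k. norm (c Q) powr p) powr (1 / p)"
  have L: "level_norm s p (amplitude s p c) = ?L" using level_norm_amplitude[OF p] by (rule ext)
  show ?thesis
  proof (cases "q = \<infinity>")
    case True
    then have bdd: "bdd_above (range ?L)" using fin by (simp add: coeff_finite_def)
    have "?L k \<le> (SUP k. ?L k)" for k by (rule cSUP_upper[OF _ bdd]) simp
    moreover from this[of 0] have "0 \<le> (SUP k. ?L k)" by (rule order_trans[rotated]) simp
    ultimately show ?thesis using True by (simp add: lq_le_def coeff_norm_def L)
  next
    case False
    define r where "r = real_of_ereal q"
    have r: "1 \<le> r" unfolding r_def by (rule real_of_ereal_ge_1[OF q False])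
    have e: "(\<Sum>Q\<in>dyadic k. norm (c Q) powr p) powr (r / p) = ?L k powr r" for k
      by (simp add: powr_powr)
    have sm: "summable (\<lambda>k. ?L k powr r)"
      using fin False unfolding coeff_finite_def r_def[symmetric] e by simp
    have "(\<Sum>k<n. ?L k powr r) \<le> (\<Sum>k. ?L k powr r)" for n
      by (rule sum_le_suminf[OF sm]) auto
    moreover have "((\<Sum>k. ?L k powr r) powr (1 / r)) powr r = (\<Sum>k. ?L k powr r)"
      using r sm by (simp add: powr_powr suminf_nonneg)
    ultimately show ?thesis
      using False unfolding lq_le_def coeff_norm_def r_def[symmetric] e L by simp
  qed
qed

lemma abs_aefun_sum: "abs_aefun (\<lambda>x. \<Sum>i\<in>A. f i x) = (\<Sum>i\<in>A. abs_aefun (f i))"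
  by (induction A rule: infinite_finite_induct) (simp_all add: zero_aefun_def plus_aefun.abs_eq[symmetric])

lemma abs_aefun_atom_sum: "abs_aefun (\<lambda>x. \<Sum>Q\<in>dyadic k. c Q * atom s p Q x) = step k (amplitude s p c k)"
proof -
  have "abs_aefun (\<lambda>x. c Q * atom s p Q x) = cscale (amplitude s p c k j) (ae_ind Q)"
    if "j < 2 ^ k" "Q = dyadic_interval k j" for Q j
  proof -
    show ?thesis unfolding ae_ind_def ae_one_def restr.abs_eq cscale.abs_eq
      by (rule arg_cong[where f = abs_aefun], rule ext)
        (simp only: atom_def amplitude_def that(2) measure_dyadic_interval[OF that(1)], simp add: indicator_def)
  qed
  then show ?thesis
    by (simp add: abs_aefun_sum sum_dyadic step_def)
qed

text \<open>For each t > 0 one has |u| <= t + |u|^p t^(1-p). On a probability space, integrating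
  this with t equal to the L^p norm makes both terms equal to t, whence the 2.\<close>

lemma L1_le_Lp:
  assumes u: "in_Lp p u" and p: "1 \<le> p"
  shows "integrable unit_leb u" "(LINT x|unit_leb. norm (u x)) \<le> 2 * Lp_norm p u"
proof -
  have m: "u \<in> borel_measurable unit_leb" and i: "integrable unit_leb (\<lambda>x. norm (u x) powr p)"
    using u by (auto simp: in_Lp_def)
  let ?J = "LINT x|unit_leb. norm (u x) powr p"
  have J: "0 \<le> ?J" by simp
  have fm: "finite_measure unit_leb" by (rule finite_measure_lebesgue_on) simp
  have one: "(LINT x|unit_leb. t) = t" for t :: real by (simp add: measure_restrict_space)
  have pt: "norm (u x) \<le> t + norm (u x) powr p * t powr (1 - p)" if t: "0 < t" for t x
  proof (cases "norm (u x) \<le> t")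
    case False
    then have "1 \<le> norm (u x) / t" using t by simp
    then have "(norm (u x) / t) powr 1 \<le> (norm (u x) / t) powr p"
      using p by (intro powr_mono) auto
    then have "norm (u x) \<le> t * (norm (u x) / t) powr p"
      using t False by (simp add: field_simps)
    also have "\<dots> = norm (u x) powr p * t powr (1 - p)"
      using t by (simp add: powr_divide powr_diff)
    finally show ?thesis using t by linarith
  qed (simp add: add_increasing2)
  have int1: "integrable unit_leb (\<lambda>x. t)" for t :: real
    using fm by (rule finite_measure.integrable_const)
  have int2: "integrable unit_leb (\<lambda>x. t + norm (u x) powr p * t powr (1 - p))" for t
    using i int1 by simp
  show iu: "integrable unit_leb u"
    by (rule Bochner_Integration.integrable_bound[OF int2[of 1] m]) (use pt[of 1] in auto)
  have le: "(LINT x|unit_leb. norm (u x)) \<le> t + ?J * t powr (1 - p)" if t: "0 < t" for t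
  proof -
    have "(LINT x|unit_leb. norm (u x)) \<le> (LINT x|unit_leb. t + norm (u x) powr p * t powr (1 - p))"
      using iu int2 pt[OF t] by (intro integral_mono) auto
    also have "\<dots> = t + ?J * t powr (1 - p)"
      using i int1 one by (simp del: lebesgue_integral_const)
    finally show ?thesis .
  qed
  show "(LINT x|unit_leb. norm (u x)) \<le> 2 * Lp_norm p u"
  proof (cases "?J = 0")
    case True
    have "(LINT x|unit_leb. norm (u x)) \<le> e" if "0 < e" for e using le[OF that] True by simp
    then show ?thesis using True by (simp add: Lp_norm_def field_le_epsilon)
  next
    case False
    define t where "t = Lp_norm p u"
    have t: "0 < t" "t powr p = ?J"
      using False J p by (auto simp: t_def Lp_norm_def powr_powr)
    then have "?J * t powr (1 - p) = t" by (simp add: powr_diff flip: t(2))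
    then show ?thesis using le[OF t(1)] by (simp add: t_def)
  qed
qed

lemma dyadic_index_div_2:
  assumes x: "x \<in> {0..1}"
  shows "dyadic_index (Suc k) x div 2 = dyadic_index k x"
proof -
  define j where "j = dyadic_index (Suc k) x"
  have j: "j < 2 ^ Suc k" by (simp only: j_def dyadic_index_less)
  then have j2: "j div 2 < 2 ^ k" by simp
  have mem: "x \<in> dyadic_interval (Suc k) j"
    using x j by (subst mem_dyadic_interval_iff) (simp_all add: j_def)
  have "j = 2 * (j div 2) \<or> j = Suc (2 * (j div 2))" by presburger
  with mem have "x \<in> dyadic_interval (Suc k) (2 * (j div 2)) \<union> dyadic_interval (Suc k) (Suc (2 * (j div 2)))"
    by (metis UnCI)
  then have "x \<in> dyadic_interval k (j div 2)" by (simp only: dyadic_interval_split[OF j2])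
  then show ?thesis using mem_dyadic_interval_iff[OF j2] by (simp add: j_def)
qed

lemma dyadic_index_div:
  assumes x: "x \<in> {0..1}"
  shows "dyadic_index (k + i) x div 2 ^ i = dyadic_index k x"
proof (induction i)
  case (Suc i)
  have "dyadic_index (k + Suc i) x div 2 ^ Suc i = dyadic_index (Suc (k + i)) x div 2 div 2 ^ i"
    by (simp add: div_mult2_eq)
  then show ?case using Suc dyadic_index_div_2[OF x, of "k + i"] by simp
qed simp

lemma atom_sum_eq:
  assumes x: "x \<in> {0..1}"
  shows "(\<Sum>Q\<in>dyadic k. c Q * atom s p Q x) = amplitude s p c k (dyadic_index k x)"
proof -
  have "(\<Sum>Q\<in>dyadic k. c Q * atom s p Q x)
      = (\<Sum>j<2 ^ k. if j = dyadic_index k x then amplitude s p c k (dyadic_index k x) else 0)"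
    unfolding sum_dyadic
  proof (rule sum.cong)
    fix j assume "j \<in> {..<(2::nat) ^ k}"
    then have j: "j < 2 ^ k" by simp
    then show "c (dyadic_interval k j) * atom s p (dyadic_interval k j) x
        = (if j = dyadic_index k x then amplitude s p c k (dyadic_index k x) else 0)"
      using x unfolding atom_def amplitude_def measure_dyadic_interval[OF j]
      by (auto simp: indicator_def mem_dyadic_interval_iff)
  qed simp
  then show ?thesis by simp
qed

lemma dyadic_index_fun_measurable: "(\<lambda>x. \<beta> (dyadic_index m x)) \<in> borel_measurable unit_leb"
proof -
  have "dyadic_index m \<in> borel \<rightarrow>\<^sub>M count_space UNIV" unfolding dyadic_index_def by measurable
  then have "(\<lambda>x. \<beta> (dyadic_index m x)) \<in> borel_measurable borel"
    by (rule measurable_compose) simp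
  then show ?thesis
    by (intro measurable_restrict_space1 measurable_completion) simp
qed

lemma integral_dyadic_index_fun:
  fixes g :: "nat \<Rightarrow> real"
  shows "integrable unit_leb (\<lambda>x. g (dyadic_index m x))"
    and "(LINT x|unit_leb. g (dyadic_index m x)) = (\<Sum>j<2 ^ m. g j) / 2 ^ m"
proof -
  let ?h = "\<lambda>x. \<Sum>j<2 ^ m. g j * indicator (dyadic_interval m j) x"
  have eq: "g (dyadic_index m x) = ?h x" if x: "x \<in> space unit_leb" for x
  proof -
    have "?h x = (\<Sum>j<2 ^ m. if j = dyadic_index m x then g (dyadic_index m x) else 0)"
      using x by (intro sum.cong) (auto simp: indicator_def mem_dyadic_interval_iff)
    then show ?thesis by simp
  qed
  have fm: "finite_measure unit_leb" by (rule finite_measure_lebesgue_on) simp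
  have S: "dyadic_interval m j \<in> sets unit_leb" if "j < 2 ^ m" for j
    using dyadic_interval_subset[OF that] by (simp add: sets_restrict_space_iff)
  have int: "integrable unit_leb (\<lambda>x. g j * indicator (dyadic_interval m j) x)" if "j < 2 ^ m" for j
    using S[OF that] finite_measure.emeasure_finite[OF fm]
    by (intro integrable_mult_right integrable_real_indicator) (auto simp: less_top)
  have mu: "measure unit_leb (dyadic_interval m j) = 1 / 2 ^ m" if "j < 2 ^ m" for j
    using measure_dyadic_interval[OF that] dyadic_interval_subset[OF that]
    by (subst measure_restrict_space) auto
  have "integrable unit_leb ?h" by (intro Bochner_Integration.integrable_sum int) simp
  then show "integrable unit_leb (\<lambda>x. g (dyadic_index m x))"
    using eq by (subst Bochner_Integration.integrable_cong[OF refl eq]) auto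
  have "(LINT x|unit_leb. g (dyadic_index m x)) = (LINT x|unit_leb. ?h x)"
    by (rule Bochner_Integration.integral_cong[OF refl eq])
  also have "\<dots> = (\<Sum>j<2 ^ m. (LINT x|unit_leb. g j * indicator (dyadic_interval m j) x))"
    using int by (intro Bochner_Integration.integral_sum) auto
  also have "\<dots> = (\<Sum>j<2 ^ m. g j * (1 / 2 ^ m))"
  proof (intro sum.cong refl)
    fix j assume "j \<in> {..<(2::nat) ^ m}"
    then have j: "j < 2 ^ m" by simp
    have "(LINT x|unit_leb. g j * indicator (dyadic_interval m j) x) = g j * measure unit_leb (dyadic_interval m j \<inter> space unit_leb)"
      by simp
    also have "dyadic_interval m j \<inter> space unit_leb = dyadic_interval m j"
      using dyadic_interval_subset[OF j] by auto
    finally show "(LINT x|unit_leb. g j * indicator (dyadic_interval m j) x) = g j * (1 / 2 ^ m)"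
      by (simp only: mu[OF j])
  qed
  finally show "(LINT x|unit_leb. g (dyadic_index m x)) = (\<Sum>j<2 ^ m. g j) / 2 ^ m"
    by (simp add: sum_divide_distrib)
qed

lemma in_Lp_dyadic_index_fun: "in_Lp p (\<lambda>x. \<beta> (dyadic_index m x))"
  using dyadic_index_fun_measurable integral_dyadic_index_fun(1)[of "\<lambda>j. norm (\<beta> j) powr p"]
  by (simp add: in_Lp_def)

lemma in_Lp_cong: "(\<And>x. x \<in> {0..1} \<Longrightarrow> u x = v x) \<Longrightarrow> in_Lp p u \<longleftrightarrow> in_Lp p v"
  unfolding in_Lp_def
  by (intro conj_cong measurable_cong Bochner_Integration.integrable_cong refl) auto

lemma Lp_norm_cong: "(\<And>x. x \<in> {0..1} \<Longrightarrow> u x = v x) \<Longrightarrow> Lp_norm p u = Lp_norm p v"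
  unfolding Lp_norm_def
  by (intro arg_cong[where f = "\<lambda>t. t powr (1 / p)"] Bochner_Integration.integral_cong refl) auto

lemma in_Lp_diff:
  assumes u: "in_Lp p u" and v: "in_Lp p v" and p: "1 \<le> p"
  shows "in_Lp p (\<lambda>x. u x - v x)"
proof -
  have m: "(\<lambda>x. u x - v x) \<in> borel_measurable unit_leb"
    using u v by (auto simp: in_Lp_def)
  have i: "integrable unit_leb (\<lambda>x. 2 powr p * (norm (u x) powr p + norm (v x) powr p))"
    using u v by (auto simp: in_Lp_def)
  have le: "norm (u x - v x) powr p \<le> 2 powr p * (norm (u x) powr p + norm (v x) powr p)" for x
  proof -
    have "norm (u x - v x) \<le> 2 * max (norm (u x)) (norm (v x))"
      using norm_triangle_ineq4[of "u x" "v x"] by linarith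
    then have "norm (u x - v x) powr p \<le> (2 * max (norm (u x)) (norm (v x))) powr p"
      using p by (intro powr_mono2) auto
    also have "\<dots> = 2 powr p * max (norm (u x)) (norm (v x)) powr p"
      by (subst powr_mult) (auto simp: max_def)
    also have "\<dots> \<le> 2 powr p * (norm (u x) powr p + norm (v x) powr p)"
      by (intro mult_left_mono) (auto simp: max_def)
    finally show ?thesis .
  qed
  have "integrable unit_leb (\<lambda>x. norm (u x - v x) powr p)"
    by (rule Bochner_Integration.integrable_bound[OF i]) (use m le in auto)
  with m show ?thesis by (simp add: in_Lp_def)
qed

text \<open>Rewrites a sum over levels below m as a function of the level-m index alone, so that
  integrals become finite averages over cells.\<close>

lemma level_sum_eq:
  assumes x: "x \<in> {0..1}"
  shows "(\<Sum>k\<in>{n..<m}. a k (dyadic_index k x)) = (\<Sum>k\<in>{n..<m}. a k (dyadic_index m x div 2 ^ (m - k)))"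
  using dyadic_index_div[OF x, of _ "m - _"] by (intro sum.cong) (auto, metis le_add_diff_inverse less_imp_le)

text \<open>Lowers L^p convergence to L^1 convergence, the one that suits the operators below: they
  are only assumed to contract L^1.\<close>

lemma besov_rep_norm1:
  assumes rep: "besov_rep s p \<psi> c" and p: "1 \<le> p"
  shows "ae_int \<psi>" and "(\<lambda>n. norm1 (\<psi> - (\<Sum>k<n. step k (amplitude s p c k)))) \<longlonglongrightarrow> 0"
proof -
  obtain \<phi> where \<phi>: "\<psi> = abs_aefun \<phi>" by (rule aefun_cases)
  define S where "S n x = (\<Sum>k<n. \<Sum>Q\<in>dyadic k. c Q * atom s p Q x)" for n x
  have lp: "in_Lp p \<phi>" and lim: "(\<lambda>n. Lp_norm p (\<lambda>x. \<phi> x - S n x)) \<longlonglongrightarrow> 0"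
    using rep by (auto simp: \<phi> besov_rep.abs_eq S_def)
  show "ae_int \<psi>" using L1_le_Lp(1)[OF lp p] by (simp add: \<phi> ae_int.abs_eq)
  have S: "in_Lp p (S n)" for n
  proof -
    have "S n x = (\<Sum>k\<in>{0..<n}. amplitude s p c k (dyadic_index n x div 2 ^ (n - k)))" if "x \<in> {0..1}" for x
      unfolding level_sum_eq[OF that, symmetric] S_def using atom_sum_eq[OF that] by (simp add: lessThan_atLeast0)
    then have "in_Lp p (S n) \<longleftrightarrow> in_Lp p (\<lambda>x. (\<lambda>j. \<Sum>k\<in>{0..<n}. amplitude s p c k (j div 2 ^ (n - k))) (dyadic_index n x))"
      by (rule in_Lp_cong)
    then show ?thesis
      using in_Lp_dyadic_index_fun[of p "\<lambda>j. \<Sum>k\<in>{0..<n}. amplitude s p c k (j div 2 ^ (n - k))" n] by blast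
  qed
  have le: "norm1 (\<psi> - (\<Sum>k<n. step k (amplitude s p c k))) \<le> 2 * Lp_norm p (\<lambda>x. \<phi> x - S n x)" for n
  proof -
    have "(\<Sum>k<n. step k (amplitude s p c k)) = abs_aefun (S n)"
      by (simp add: S_def[abs_def] abs_aefun_sum abs_aefun_atom_sum[symmetric])
    then have "norm1 (\<psi> - (\<Sum>k<n. step k (amplitude s p c k))) = (LINT x|unit_leb. norm (\<phi> x - S n x))"
      by (simp add: \<phi> minus_aefun.abs_eq norm1.abs_eq)
    then show ?thesis using L1_le_Lp(2)[OF in_Lp_diff[OF lp S p] p] by simp
  qed
  show "(\<lambda>n. norm1 (\<psi> - (\<Sum>k<n. step k (amplitude s p c k)))) \<longlonglongrightarrow> 0"
    by (rule tendsto_sandwich[OF _ _ tendsto_const tendsto_mult_right_zero[OF lim, of 2]])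
      (use le in auto)
qed

text \<open>A class known only to be integrable has to be put into L^p. The partial sums equal the
  averages, which converge almost everywhere; a block between two levels has L^p norm at most
  \<open>\<tau> n\<close>, and Fatou's lemma passes this tail bound on to \<phi> - S n. The case n =
  0 gives membership in L^p, and the decay of \<tau> gives convergence.\<close>

lemma besov_rep_mart_diff:
  assumes i: "ae_int \<psi>" and le: "\<And>k. level_norm s p (mart_diff \<psi>) k \<le> B" and s: "0 < s" and p: "1 \<le> p"
  shows "\<exists>c. besov_rep s p \<psi> c \<and> (\<forall>k. \<forall>j<2 ^ k. amplitude s p c k j = mart_diff \<psi> k j)"
proof -
  obtain \<phi> where \<phi>: "\<psi> = abs_aefun \<phi>" by (rule aefun_cases)
  have i': "integrable unit_leb \<phi>" using i by (simp add: \<phi> ae_int.abs_eq)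
  then have m\<phi>: "\<phi> \<in> borel_measurable unit_leb" by auto
  define S where "S n x = (\<Sum>k<n. mart_diff \<psi> k (dyadic_index k x))" for n x
  define \<tau> where "\<tau> n = B / (1 - 2 powr (- s)) * (2 powr (- s)) ^ n" for n
  have x2: "0 \<le> (2::real) powr (- s)" "(2::real) powr (- s) < 1"
    using s powr_less_mono[of "- s" 0 "2 :: real"] by auto
  have B: "0 \<le> B" using le[of 0] level_norm_nonneg order_trans by blast
  have \<tau>0: "0 \<le> \<tau> n" for n using B x2 by (simp add: \<tau>_def)
  have mS: "S n \<in> borel_measurable unit_leb" for n
    unfolding S_def by (intro borel_measurable_sum dyadic_index_fun_measurable)
  have S_avg: "S (Suc m) x = avg \<psi> m (dyadic_index m x)" if x: "x \<in> {0..1}" for m x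
  proof (induction m)
    case 0
    show ?case by (simp add: S_def mart_diff_def)
  next
    case (Suc m)
    have "S (Suc (Suc m)) x = S (Suc m) x + mart_diff \<psi> (Suc m) (dyadic_index (Suc m) x)" by (simp add: S_def)
    then show ?case using Suc dyadic_index_div_2[OF x, of m] by (simp add: mart_diff_def)
  qed
  have "AE x in unit_leb. x \<in> {0..1}" by (rule AE_I2) simp
  with avg_tendsto_AE[OF i'] have lim: "AE x in unit_leb. (\<lambda>m. S m x) \<longlonglongrightarrow> \<phi> x"
  proof eventually_elim
    case (elim x)
    have "(\<lambda>m. S (Suc m) x) \<longlonglongrightarrow> \<phi> x" using elim by (simp only: S_avg \<phi>)
    then show ?case by (rule LIMSEQ_imp_Suc)
  qed
  have key: "integrable unit_leb (\<lambda>x. norm (\<phi> x - S n x) powr p) \<and> Lp_norm p (\<lambda>x. \<phi> x - S n x) \<le> \<tau> n" for n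
  proof -
    have fin: "(\<integral>\<^sup>+x. ennreal (norm (S m x - S n x) powr p) \<partial>unit_leb) \<le> ennreal (\<tau> n powr p)" if m: "n \<le> m" for m
    proof -
      \<comment> \<open>S m - S n depends only on the cell of level m; \<beta> lists its values
        there.\<close>
      define \<beta> where "\<beta> j = (\<Sum>k\<in>{n..<m}. mart_diff \<psi> k (j div 2 ^ (m - k)))" for j
      have eq: "S m x - S n x = \<beta> (dyadic_index m x)" if x: "x \<in> {0..1}" for x
      proof -
        have "S m x = S n x + (\<Sum>k\<in>{n..<m}. mart_diff \<psi> k (dyadic_index k x))"
          unfolding S_def lessThan_atLeast0 using m by (simp add: sum.atLeastLessThan_concat)
        then show ?thesis unfolding level_sum_eq[OF x] by (simp add: \<beta>_def)
      qed
      have "mean_norm p m \<beta> \<le> (\<Sum>k\<in>{n..<m}. mean_norm p m (\<lambda>j. mart_diff \<psi> k (j div 2 ^ (m - k))))"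
        unfolding \<beta>_def by (rule mean_norm_sum_le[OF p])
      also have "\<dots> = (\<Sum>k\<in>{n..<m}. mean_norm p k (mart_diff \<psi> k))"
      proof (rule sum.cong)
        fix k assume "k \<in> {n..<m}"
        then show "mean_norm p m (\<lambda>j. mart_diff \<psi> k (j div 2 ^ (m - k))) = mean_norm p k (mart_diff \<psi> k)"
          using mean_norm_refine_iter[of p k "m - k" "mart_diff \<psi> k"] by simp
      qed simp
      also have "\<dots> \<le> \<tau> n"
        unfolding \<tau>_def by (rule sum_mean_norm_le[OF s le])
      finally have "mean_norm p m \<beta> powr p \<le> \<tau> n powr p"
        using p by (intro powr_mono2) auto
      then have *: "(\<Sum>j<2 ^ m. norm (\<beta> j) powr p) / 2 ^ m \<le> \<tau> n powr p"
        using p by (simp add: mean_norm_powr)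
      have "(\<integral>\<^sup>+x. ennreal (norm (S m x - S n x) powr p) \<partial>unit_leb)
          = (\<integral>\<^sup>+x. ennreal (norm (\<beta> (dyadic_index m x)) powr p) \<partial>unit_leb)"
        by (rule nn_integral_cong) (simp add: eq)
      also have "\<dots> = ennreal (LINT x|unit_leb. norm (\<beta> (dyadic_index m x)) powr p)"
        by (rule nn_integral_eq_integral) (auto intro: integral_dyadic_index_fun(1)[of "\<lambda>j. norm (\<beta> j) powr p"])
      also have "\<dots> \<le> ennreal (\<tau> n powr p)"
        unfolding integral_dyadic_index_fun(2)[of "\<lambda>j. norm (\<beta> j) powr p"] by (rule ennreal_leI[OF *])
      finally show ?thesis .
    qed
    have m: "(\<lambda>x. \<phi> x - S n x) \<in> borel_measurable unit_leb" using m\<phi> mS by auto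
    have "(\<integral>\<^sup>+x. ennreal (norm (\<phi> x - S n x) powr p) \<partial>unit_leb)
        = (\<integral>\<^sup>+x. liminf (\<lambda>m. ennreal (norm (S m x - S n x) powr p)) \<partial>unit_leb)"
    proof (rule nn_integral_cong_AE, use lim in eventually_elim)
      case (elim x)
      have "(\<lambda>m. ennreal (norm (S m x - S n x) powr p)) \<longlonglongrightarrow> ennreal (norm (\<phi> x - S n x) powr p)"
        using elim p by (intro tendsto_ennrealI tendsto_powr2 tendsto_norm tendsto_diff tendsto_const) auto
      then show ?case by (rule lim_imp_Liminf[OF sequentially_bot, THEN sym])
    qed
    also have "\<dots> \<le> liminf (\<lambda>m. \<integral>\<^sup>+x. ennreal (norm (S m x - S n x) powr p) \<partial>unit_leb)"
      using mS by (intro nn_integral_liminf) auto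
    also have "\<dots> \<le> limsup (\<lambda>m. \<integral>\<^sup>+x. ennreal (norm (S m x - S n x) powr p) \<partial>unit_leb)"
      by (rule Liminf_le_Limsup) simp
    also have "\<dots> \<le> ennreal (\<tau> n powr p)"
      using fin by (intro Limsup_bounded) (auto intro: eventually_sequentiallyI[of n])
    finally have bd: "(\<integral>\<^sup>+x. ennreal (norm (\<phi> x - S n x) powr p) \<partial>unit_leb) \<le> ennreal (\<tau> n powr p)" .
    have int: "integrable unit_leb (\<lambda>x. norm (\<phi> x - S n x) powr p)"
    proof (rule integrableI_bounded)
      show "(\<integral>\<^sup>+x. ennreal (norm (norm (\<phi> x - S n x) powr p)) \<partial>unit_leb) < \<infinity>"
        using bd by (simp add: le_less_trans[OF _ ennreal_less_top])
    qed (use m in auto)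
    have "ennreal (LINT x|unit_leb. norm (\<phi> x - S n x) powr p) \<le> ennreal (\<tau> n powr p)"
      using bd nn_integral_eq_integral[OF int] by simp
    then have "(LINT x|unit_leb. norm (\<phi> x - S n x) powr p) \<le> \<tau> n powr p"
      by (simp add: ennreal_le_iff)
    then have "Lp_norm p (\<lambda>x. \<phi> x - S n x) \<le> (\<tau> n powr p) powr (1 / p)"
      unfolding Lp_norm_def using p by (intro powr_mono2) auto
    then show ?thesis using int p \<tau>0 by (simp add: powr_powr)
  qed
  \<comment> \<open>Coefficients are attached to sets, so level and position are recovered from the
    cell. The quotient undoes the normalisation of the atom.\<close>
  define c where "c Q = (case inv_into {(k, j). j < 2 ^ k} (\<lambda>(k, j). dyadic_interval k j) Q of
      (k, j) \<Rightarrow> mart_diff \<psi> k j / complex_of_real ((1 / 2 ^ k) powr (s - 1 / p)))" for Q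
  have amplitude: "amplitude s p c k j = mart_diff \<psi> k j" if "j < 2 ^ k" for k j
  proof -
    have "inj_on (\<lambda>(k, j). dyadic_interval k j) {(k, j). j < 2 ^ k}"
      by (auto simp: inj_on_def dest: dyadic_interval_inj)
    from inv_into_f_f[OF this, of "(k, j)"] that
    have "inv_into {(k, j). j < 2 ^ k} (\<lambda>(k, j). dyadic_interval k j) (dyadic_interval k j) = (k, j)" by simp
    then show ?thesis by (simp add: amplitude_def c_def)
  qed
  have Seq: "(\<Sum>k<n. \<Sum>Q\<in>dyadic k. c Q * atom s p Q x) = S n x" if "x \<in> {0..1}" for n x
    unfolding S_def using atom_sum_eq[OF that] amplitude by simp
  have Lp_eq: "Lp_norm p (\<lambda>x. \<phi> x - (\<Sum>k<n. \<Sum>Q\<in>dyadic k. c Q * atom s p Q x)) = Lp_norm p (\<lambda>x. \<phi> x - S n x)" for n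
    by (rule Lp_norm_cong) (simp add: Seq)
  have "in_Lp p \<phi>"
    using key[of 0] m\<phi> by (simp add: in_Lp_def S_def)
  moreover have "(\<lambda>n. Lp_norm p (\<lambda>x. \<phi> x - S n x)) \<longlonglongrightarrow> 0"
  proof (rule tendsto_sandwich[OF _ _ tendsto_const])
    show "\<tau> \<longlonglongrightarrow> 0"
      unfolding \<tau>_def using x2 by (intro tendsto_mult_right_zero LIMSEQ_realpow_zero) auto
  qed (use key in \<open>auto simp: Lp_norm_def\<close>)
  ultimately have "besov_rep s p \<psi> c" by (simp add: \<phi> besov_rep.abs_eq Lp_eq)
  then show ?thesis using amplitude by blast
qed

section \<open>Positive contractions of \<open>L\<^sup>1\<close>\<close>

definition L1op :: "(aefun \<Rightarrow> aefun) \<Rightarrow> bool" where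
  "L1op T \<longleftrightarrow> (\<forall>x y. T (x + y) = T x + T y) \<and> (\<forall>c x. T (cscale c x) = cscale c (T x)) \<and>
     (\<forall>x. ae_int x \<longrightarrow> ae_int (T x) \<and> norm1 (T x) \<le> norm1 x)"

lemma L1opD:
  assumes "L1op T"
  shows "T (x + y) = T x + T y" "T (cscale c x) = cscale c (T x)"
    "ae_int x \<Longrightarrow> ae_int (T x)" "ae_int x \<Longrightarrow> norm1 (T x) \<le> norm1 x"
  using assms by (auto simp: L1op_def)

lemma L1op_zero: "L1op T \<Longrightarrow> T 0 = 0"
  using L1opD(2)[of T 0 0] by simp

lemma L1op_diff: "L1op T \<Longrightarrow> T (x - y) = T x - T y"
  using L1opD(1)[of T x "cscale (-1) y"] L1opD(2)[of T "-1" y] by simp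

lemma L1op_sum: "L1op T \<Longrightarrow> T (\<Sum>i\<in>A. f i) = (\<Sum>i\<in>A. T (f i))"
  by (induction A rule: infinite_finite_induct) (auto simp: L1op_zero L1opD(1))

lemma L1op_funpow: "L1op T \<Longrightarrow> L1op (T ^^ n)"
proof (induction n)
  case (Suc n)
  then have "norm1 (T ((T ^^ n) x)) \<le> norm1 x" if "ae_int x" for x
    using that L1opD(3,4)[OF Suc.IH, of x] L1opD(4)[OF Suc.prems] by (meson order_trans)
  then show ?case using Suc L1opD[OF Suc.IH] L1opD[OF Suc.prems] by (simp add: L1op_def)
qed (simp add: L1op_def)

lift_definition ae_bd :: "real \<Rightarrow> aefun \<Rightarrow> bool" is
  "\<lambda>R \<phi>. AE x in unit_leb. Im (\<phi> x) = 0 \<and> 0 \<le> Re (\<phi> x) \<and> Re (\<phi> x) \<le> R"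
proof -
  fix R :: real and f g :: "real \<Rightarrow> complex"
  assume "AE x in unit_leb. f x = g x"
  then have "AE x in unit_leb. (Im (f x) = 0 \<and> 0 \<le> Re (f x) \<and> Re (f x) \<le> R) =
      (Im (g x) = 0 \<and> 0 \<le> Re (g x) \<and> Re (g x) \<le> R)"
    by eventually_elim simp
  then show "(AE x in unit_leb. Im (f x) = 0 \<and> 0 \<le> Re (f x) \<and> Re (f x) \<le> R) =
      (AE x in unit_leb. Im (g x) = 0 \<and> 0 \<le> Re (g x) \<and> Re (g x) \<le> R)"
    by (rule eventually_subst)
qed

lemma ae_bd_ae_ind: "ae_bd 1 (ae_ind E)" unfolding ae_ind_def
  by transfer (rule AE_I2, simp add: indicator_def)

lemma ae_bd_one: "ae_bd 1 ae_one"
  by transfer simp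

lemma avg_ae_bd:
  assumes "ae_int \<psi>" "ae_bd R \<psi>" "j < 2 ^ k"
  shows "Im (avg \<psi> k j) = 0" "0 \<le> Re (avg \<psi> k j)" "Re (avg \<psi> k j) \<le> R"
proof -
  obtain \<phi> where \<phi>: "\<psi> = abs_aefun \<phi>" by (rule aefun_cases)
  let ?Q = "dyadic_interval k j"
  have bd: "AE x in unit_leb. Im (\<phi> x) = 0 \<and> 0 \<le> Re (\<phi> x) \<and> Re (\<phi> x) \<le> R"
    using assms(2) by (simp add: \<phi> ae_bd.abs_eq)
  have "ae_int (restr ?Q \<psi>)" using assms by simp
  then have i: "integrable unit_leb (\<lambda>x. indicator ?Q x * \<phi> x)"
    by (simp add: \<phi> restr.abs_eq ae_int.abs_eq)
  have l: "lint (restr ?Q \<psi>) = (LINT x|unit_leb. indicator ?Q x * \<phi> x)"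
    by (simp add: \<phi> restr.abs_eq lint.abs_eq)
  have "ae_int (ae_ind ?Q)" by simp
  then have "integrable unit_leb (\<lambda>x. indicator ?Q x * (1::complex))"
    by (simp add: ae_ind_def ae_one_def restr.abs_eq ae_int.abs_eq)
  then have iQ: "integrable unit_leb (\<lambda>x. Re (indicator ?Q x * (1::complex)))"
    by (rule integrable_Re)
  have lQ: "(LINT x|unit_leb. Re (indicator ?Q x * (1::complex))) = 1 / 2 ^ k"
  proof -
    have "(LINT x|unit_leb. Re (indicator ?Q x * (1::complex))) = Re (LINT x|unit_leb. indicator ?Q x * (1::complex))"
      by (rule integral_Re) fact
    also have "(LINT x|unit_leb. indicator ?Q x * (1::complex)) = lint (ae_ind ?Q)"
      by (simp add: ae_ind_def ae_one_def restr.abs_eq lint.abs_eq)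
    also have "Re (lint (ae_ind ?Q)) = 1 / 2 ^ k"
      using assms(3) by (subst lint_ae_ind) (simp_all only: dyadic_interval_subset measure_dyadic_interval dyadic_interval_sets Re_complex_of_real)
    finally show ?thesis .
  qed
  have AE: "AE x in unit_leb. Im (indicator ?Q x * \<phi> x) = 0"
    "AE x in unit_leb. 0 \<le> Re (indicator ?Q x * \<phi> x)"
    "AE x in unit_leb. Re (indicator ?Q x * \<phi> x) \<le> R * Re (indicator ?Q x * (1::complex))"
    using bd by (eventually_elim, simp add: indicator_def)+
  have "Im (lint (restr ?Q \<psi>)) = (LINT x|unit_leb. Im (indicator ?Q x * \<phi> x))"
    unfolding l by (rule integral_Im[OF i, symmetric])
  also have "\<dots> = 0"
    by (rule integral_eq_zero_AE[OF AE(1)])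
  finally have 1: "Im (lint (restr ?Q \<psi>)) = 0" .
  have re: "Re (lint (restr ?Q \<psi>)) = (LINT x|unit_leb. Re (indicator ?Q x * \<phi> x))"
    unfolding l by (rule integral_Re[OF i, symmetric])
  have 2: "0 \<le> Re (lint (restr ?Q \<psi>))"
    unfolding re by (rule integral_nonneg_AE[OF AE(2)])
  have "Re (lint (restr ?Q \<psi>)) \<le> (LINT x|unit_leb. R * Re (indicator ?Q x * (1::complex)))"
    unfolding re by (rule integral_mono_AE[OF integrable_Re[OF i] integrable_mult_right[OF iQ] AE(3)])
  also have "\<dots> = R * (1 / 2 ^ k)"
    by (simp only: integral_mult_right_zero lQ)
  finally have 3: "Re (lint (restr ?Q \<psi>)) \<le> R * (1 / 2 ^ k)" .
  have c: "(2::complex) ^ k = complex_of_real (2 ^ k)" by simp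
  show "Im (avg \<psi> k j) = 0" "0 \<le> Re (avg \<psi> k j)" "Re (avg \<psi> k j) \<le> R"
    unfolding avg_def c using 1 2 3 by (simp_all add: field_simps del: of_real_power)
qed

text \<open>Positivity and boundedness on L^\<infinity> in one condition. \<open>M\<close> bounds
  the image of the constant 1 and hence the row sums of the kernel below.\<close>

definition posop :: "real \<Rightarrow> (aefun \<Rightarrow> aefun) \<Rightarrow> bool" where
  "posop M T \<longleftrightarrow> 0 < M \<and> (\<forall>R x. 0 \<le> R \<longrightarrow> ae_bd R x \<longrightarrow> ae_bd (M * R) (T x))"

lemma posop_funpow: "posop M T \<Longrightarrow> posop (M ^ n) (T ^^ n)"
  by (induction n) (auto simp: posop_def mult.assoc)

lemma step_one: "step j (\<lambda>_. 1) = ae_one"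
proof (induction j)
  case 0
  have "dyadic_interval 0 0 = {0..1}" by (simp add: dyadic_interval_def)
  then show ?case by (simp add: step_def ae_ind_def)
next
  case (Suc j)
  then show ?case using step_refine[of j "\<lambda>_. 1"] by simp
qed

text \<open>By positivity the averages of the images of the cells are nonnegative, so their moduli
  add up without cancellation to an average of \<open>T ae_one\<close>, which is at most M. A
  martingale difference involves two averages, hence the 2.\<close>

lemma sum_mart_diff_pos_le:
  assumes T: "L1op T" and pos: "posop M T" and l: "l < 2 ^ k"
  shows "(\<Sum>i<2 ^ j. norm (mart_diff (T (ae_ind (dyadic_interval j i))) k l)) \<le> 2 * M"
proof -
  have M: "0 < M" and bd: "\<And>x. ae_bd 1 x \<Longrightarrow> ae_bd M (T x)"
    using pos by (auto simp: posop_def dest: spec[of _ 1])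
  let ?x = "\<lambda>i. T (ae_ind (dyadic_interval j i))"
  have i: "ae_int (?x i)" for i using L1opD(3)[OF T] by simp
  have one: "(\<Sum>i<2 ^ j. ?x i) = T ae_one"
    unfolding step_one[of j, symmetric] step_def by (simp only: L1op_sum[OF T] ae.scale_one)
  have avg: "(\<Sum>i<2 ^ j. norm (avg (?x i) k' l')) \<le> M" if l': "l' < 2 ^ k'" for k' l'
  proof -
    have "norm (avg (?x i) k' l') = Re (avg (?x i) k' l')" for i
      using avg_ae_bd[OF i bd[OF ae_bd_ae_ind] l', of i] by (simp add: cmod_eq_Re)
    then have "(\<Sum>i<2 ^ j. norm (avg (?x i) k' l')) = Re (avg (\<Sum>i<2 ^ j. ?x i) k' l')"
      using i by (simp add: avg_sum)
    also have "\<dots> \<le> M"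
      unfolding one using L1opD(3)[OF T] bd[OF ae_bd_one] l' by (intro avg_ae_bd) auto
    finally show ?thesis .
  qed
  show ?thesis
  proof (cases k)
    case 0
    then show ?thesis using avg[OF l] M by (simp add: mart_diff_def)
  next
    case (Suc m)
    have "(\<Sum>i<2 ^ j. norm (mart_diff (?x i) k l)) \<le> (\<Sum>i<2 ^ j. norm (avg (?x i) k l) + norm (avg (?x i) m (l div 2)))"
      by (intro sum_mono) (simp add: mart_diff_def Suc norm_triangle_ineq4)
    also have "\<dots> \<le> M + M"
      unfolding sum.distrib using l by (intro add_mono avg) (auto simp: Suc)
    finally show ?thesis by simp
  qed
qed

section \<open>The kernel estimate\<close>

text \<open>Two geometric series of ratio 2^(-\<eta>), one on each side of the peak of the kernel,
  times 2^\<eta> for rounding the position of the peak to an integer.\<close>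

definition kernel_const :: "real \<Rightarrow> real" where "kernel_const \<eta> = 2 * 2 powr \<eta> / (1 - 2 powr (- \<eta>))"

text \<open>With m = k - j, the transfer from level j to level k once both level weights are taken
  into account. For 0 < s < \<theta> it peaks where 2^m = G, with value G^s.\<close>

definition level_kernel :: "real \<Rightarrow> real \<Rightarrow> real \<Rightarrow> real \<Rightarrow> real" where
  "level_kernel s \<theta> G m = 2 powr (m * s) * min 1 ((G * 2 powr (- m)) powr \<theta>)"

lemma level_kernel_nonneg: "0 \<le> level_kernel s \<theta> G m" by (simp add: level_kernel_def)

lemma sum_power_finite_le:
  fixes x :: real
  assumes "finite A" "0 \<le> x" "x < 1"
  shows "(\<Sum>i\<in>A. x ^ i) \<le> 1 / (1 - x)"
proof -
  have "(\<Sum>i\<in>A. x ^ i) \<le> (\<Sum>i\<in>{0..<Suc (Max A)}. x ^ i)"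
    using assms by (intro sum_mono2) (auto simp: less_Suc_eq_le)
  also have "\<dots> \<le> x ^ 0 / (1 - x)" using assms by (intro geometric_tail_le)
  finally show ?thesis by simp
qed

text \<open>In the variable u = m - log 2 G the kernel is G^s times 2^(us) for negative u and
  2^(-u(\<theta> - s)) for positive u. Both rates are at least \<eta>, and replacing log 2 G by its
  floor costs the factor 2^\<eta>.\<close>

lemma level_kernel_le:
  assumes G: "0 < G" and \<eta>: "0 < \<eta>" "\<eta> \<le> s" "\<eta> \<le> \<theta> - s"
  shows "level_kernel s \<theta> G (real_of_int m) \<le> G powr s * 2 powr \<eta> * (2 powr (- \<eta>)) ^ nat \<bar>m - \<lfloor>log 2 G\<rfloor>\<bar>"
proof -
  define n where "n = \<lfloor>log 2 G\<rfloor>"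
  define u where "u = real_of_int m - log 2 G"
  have Gu: "G = 2 powr log 2 G" using G by simp
  have n: "real_of_int n \<le> log 2 G" "log 2 G < real_of_int n + 1" by (simp_all add: n_def)
  have x: "(2 powr (- \<eta>)) ^ nat \<bar>m - n\<bar> = 2 powr (- \<eta> * \<bar>real_of_int (m - n)\<bar>)"
    by (simp add: powr_powr flip: powr_realpow)
  have e: "level_kernel s \<theta> G m = G powr s * (2 powr (u * s) * min 1 (2 powr (- u * \<theta>)))"
  proof -
    have "2 powr (m * s) = G powr s * 2 powr (u * s)"
      by (subst Gu) (simp add: powr_powr u_def algebra_simps flip: powr_add)
    moreover have "G * 2 powr (- m) = 2 powr (- u)"
      by (subst Gu) (simp add: u_def flip: powr_add)
    ultimately show ?thesis by (simp add: level_kernel_def powr_powr)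
  qed
  have le: "2 powr (u * s) * min 1 (2 powr (- u * \<theta>)) \<le> 2 powr (\<eta> - \<eta> * \<bar>real_of_int (m - n)\<bar>)"
  proof (cases "m \<le> n")
    case True
    have "2 powr (u * s) * min 1 (2 powr (- u * \<theta>)) \<le> 2 powr (u * s) * 1"
      by (intro mult_left_mono) auto
    also have "u * s \<le> \<eta> - \<eta> * \<bar>real_of_int (m - n)\<bar>"
    proof -
      have "u \<le> real_of_int (m - n)" using n by (simp add: u_def)
      then have "u * s \<le> real_of_int (m - n) * s" using \<eta> by (intro mult_right_mono) auto
      also have "\<dots> \<le> real_of_int (m - n) * \<eta>" using True \<eta> by (intro mult_left_mono_neg) auto
      finally show ?thesis using True \<eta> by (simp add: algebra_simps)
    qed
    then have "2 powr (u * s) * 1 \<le> 2 powr (\<eta> - \<eta> * \<bar>real_of_int (m - n)\<bar>)" by simp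
    finally show ?thesis .
  next
    case False
    then have mn: "real_of_int m - real_of_int n \<ge> 1" by linarith
    have "2 powr (u * s) * min 1 (2 powr (- u * \<theta>)) \<le> 2 powr (u * s) * 2 powr (- u * \<theta>)"
      by (intro mult_left_mono) auto
    also have "\<dots> = 2 powr (- (u * (\<theta> - s)))"
      by (simp add: algebra_simps flip: powr_add)
    also have "\<dots> \<le> 2 powr (\<eta> - \<eta> * \<bar>real_of_int (m - n)\<bar>)"
    proof (rule powr_mono)
      have u: "real_of_int m - real_of_int n - 1 \<le> u" using n by (simp add: u_def)
      have "(real_of_int m - real_of_int n - 1) * \<eta> \<le> u * (\<theta> - s)"
        using u mn \<eta> by (intro mult_mono) auto
      then show "- (u * (\<theta> - s)) \<le> \<eta> - \<eta> * \<bar>real_of_int (m - n)\<bar>"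
        using False by (simp add: algebra_simps)
    qed simp
    finally show ?thesis .
  qed
  have "level_kernel s \<theta> G m \<le> G powr s * 2 powr (\<eta> - \<eta> * \<bar>real_of_int (m - n)\<bar>)"
    unfolding e by (rule mult_left_mono[OF le]) simp
  also have "\<dots> = G powr s * 2 powr \<eta> * (2 powr (- \<eta>)) ^ nat \<bar>m - n\<bar>"
    unfolding x by (simp add: mult.assoc flip: powr_add)
  finally show ?thesis by (simp add: n_def)
qed

lemma sum_level_kernel_le:
  assumes G: "0 < G" and \<eta>: "0 < \<eta>" "\<eta> \<le> s" "\<eta> \<le> \<theta> - s" and fin: "finite A"
  shows "(\<Sum>m\<in>A. level_kernel s \<theta> G (real_of_int m)) \<le> G powr s * kernel_const \<eta>"
proof -
  define n where "n = \<lfloor>log 2 G\<rfloor>"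
  define x where "x = (2::real) powr (- \<eta>)"
  have x: "0 \<le> x" "x < 1"
    using \<eta> powr_less_mono[of "- \<eta>" 0 "2 :: real"] by (auto simp: x_def)
  have half: "(\<Sum>m\<in>A'. x ^ nat \<bar>m - n\<bar>) \<le> 1 / (1 - x)"
    if "finite A'" "inj_on (\<lambda>m. nat \<bar>m - n\<bar>) A'" for A'
    using sum_power_finite_le[of "(\<lambda>m. nat \<bar>m - n\<bar>) ` A'" x] that x by (simp add: sum.reindex)
  have "(\<Sum>m\<in>A. x ^ nat \<bar>m - n\<bar>) = (\<Sum>m\<in>{m\<in>A. m \<ge> n} \<union> {m\<in>A. m < n}. x ^ nat \<bar>m - n\<bar>)"
    by (intro sum.cong) auto
  also have "\<dots> = (\<Sum>m\<in>{m\<in>A. m \<ge> n}. x ^ nat \<bar>m - n\<bar>) + (\<Sum>m\<in>{m\<in>A. m < n}. x ^ nat \<bar>m - n\<bar>)"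
    using fin by (intro sum.union_disjoint) auto
  also have "\<dots> \<le> 1 / (1 - x) + 1 / (1 - x)"
    using fin by (intro add_mono half) (auto simp: inj_on_def)
  finally have *: "(\<Sum>m\<in>A. x ^ nat \<bar>m - n\<bar>) \<le> 2 / (1 - x)" by simp
  have "(\<Sum>m\<in>A. level_kernel s \<theta> G (real_of_int m)) \<le> (\<Sum>m\<in>A. G powr s * 2 powr \<eta> * x ^ nat \<bar>m - n\<bar>)"
    unfolding x_def n_def by (intro sum_mono level_kernel_le[OF G \<eta>])
  also have "\<dots> = G powr s * 2 powr \<eta> * (\<Sum>m\<in>A. x ^ nat \<bar>m - n\<bar>)"
    by (simp add: sum_distrib_left)
  also have "\<dots> \<le> G powr s * 2 powr \<eta> * (2 / (1 - x))"
    by (rule mult_left_mono[OF *]) simp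
  finally show ?thesis by (simp add: kernel_const_def x_def mult_ac)
qed

text \<open>Schur test between two fixed levels. The row sums are at most 2M by positivity and enter
  with the power 1 - 1/p; the column sums are the L^1 bounds governed by \<open>E\<close> and enter
  with the power 1/p. At p = 1 only the L^1 information is left.\<close>

lemma schur_level:
  assumes T: "L1op T" and pos: "posop M T" and p: "1 \<le> p" and E: "0 \<le> E"
    and small: "\<And>i. i < 2 ^ j \<Longrightarrow> mean_norm 1 k (mart_diff (T (ae_ind (dyadic_interval j i))) k) \<le> E / 2 ^ j"
  shows "mean_norm p k (mart_diff (T (step j \<alpha>)) k) \<le> (2 * M) powr (1 - 1 / p) * E powr (1 / p) * mean_norm p j \<alpha>"
proof -
  have M: "0 < M" using pos by (simp add: posop_def)
  define \<kappa> where "\<kappa> i l = mart_diff (T (ae_ind (dyadic_interval j i))) k l" for i l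
  have i: "ae_int (T (ae_ind (dyadic_interval j i)))" for i using L1opD(3)[OF T] by simp
  have eq: "mart_diff (T (step j \<alpha>)) k l = (\<Sum>i<2 ^ j. \<alpha> i * \<kappa> i l)" for l
    unfolding step_def using i by (simp add: L1op_sum[OF T] L1opD(2)[OF T] mart_diff_sum mart_diff_cscale \<kappa>_def)
  have pt: "norm (mart_diff (T (step j \<alpha>)) k l) powr p
      \<le> (2 * M) powr (p - 1) * (\<Sum>i<2 ^ j. norm (\<kappa> i l) * norm (\<alpha> i) powr p)" if l: "l < 2 ^ k" for l
  proof -
    have "norm (mart_diff (T (step j \<alpha>)) k l) \<le> (\<Sum>i<2 ^ j. norm (\<kappa> i l) * norm (\<alpha> i))"
      unfolding eq by (rule sum_norm_le) (simp add: norm_mult mult.commute)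
    then have "norm (mart_diff (T (step j \<alpha>)) k l) powr p \<le> (\<Sum>i<2 ^ j. norm (\<kappa> i l) * norm (\<alpha> i)) powr p"
      using p by (intro powr_mono2) auto
    also have "\<dots> \<le> (\<Sum>i<2 ^ j. norm (\<kappa> i l)) powr (p - 1) * (\<Sum>i<2 ^ j. norm (\<kappa> i l) * norm (\<alpha> i) powr p)"
      using p by (intro powr_sum_jensen) auto
    also have "\<dots> \<le> (2 * M) powr (p - 1) * (\<Sum>i<2 ^ j. norm (\<kappa> i l) * norm (\<alpha> i) powr p)"
      using p sum_mart_diff_pos_le[OF T pos l, of j] unfolding \<kappa>_def
      by (intro mult_right_mono powr_mono2) (auto intro!: sum_nonneg)
    finally show ?thesis .
  qed
  define Z where "Z = (2 * M) powr (1 - 1 / p) * E powr (1 / p)"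
  have Zp: "Z powr p = (2 * M) powr (p - 1) * E"
    using p M E by (simp add: Z_def powr_mult powr_powr algebra_simps)
  have "(\<Sum>l<2 ^ k. norm (mart_diff (T (step j \<alpha>)) k l) powr p) / 2 ^ k
      \<le> (\<Sum>l<2 ^ k. (2 * M) powr (p - 1) * (\<Sum>i<2 ^ j. norm (\<kappa> i l) * norm (\<alpha> i) powr p)) / 2 ^ k"
    using pt by (intro divide_right_mono sum_mono) auto
  also have "\<dots> = (2 * M) powr (p - 1) * (\<Sum>i<2 ^ j. norm (\<alpha> i) powr p * mean_norm 1 k (\<kappa> i))"
    by (simp add: mean_norm_1 sum_distrib_left sum_divide_distrib sum.swap[of _ "{..<2 ^ j}"] mult_ac)
  also have "\<dots> \<le> (2 * M) powr (p - 1) * (\<Sum>i<2 ^ j. norm (\<alpha> i) powr p * (E / 2 ^ j))"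
    using small unfolding \<kappa>_def by (intro mult_left_mono sum_mono) auto
  also have "\<dots> = Z powr p * mean_norm p j \<alpha> powr p"
    using p by (simp add: Zp mean_norm_powr sum_distrib_right sum_divide_distrib sum_distrib_left mult_ac)
  also have "\<dots> = (Z * mean_norm p j \<alpha>) powr p"
    by (simp add: powr_mult Z_def)
  finally show ?thesis
    using p unfolding Z_def[symmetric] by (subst mean_norm_le_iff) (auto simp: Z_def)
qed

text \<open>\<open>schur_level\<close> bounds each pair of levels, and the resulting kernel in k - j
  is summed by \<open>lq_le_schur\<close>. The series is truncated first; the limit is harmless
  because an L^1 contraction makes every single martingale coefficient converge. The layers
  \<open>a\<close> may come from any representation, so that the estimate is useful even for the
  identity.\<close>

lemma kernel_estimate:
  assumes T: "L1op T" and pos: "posop M T" and p: "1 \<le> p" and q: "1 \<le> q"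
    and C: "0 \<le> C" and G: "0 < G" and \<eta>: "0 < \<eta>" "\<eta> \<le> s" "\<eta> \<le> \<beta> / p - s"
    and small: "\<And>j i k. N \<le> j \<Longrightarrow> i < 2 ^ j \<Longrightarrow>
      mean_norm 1 k (mart_diff (T (ae_ind (dyadic_interval j i))) k) \<le> C * min 1 ((G * 2 powr (real j - real k)) powr \<beta>) / 2 ^ j"
    and \<psi>: "ae_int \<psi>" and lim: "(\<lambda>n. norm1 (\<psi> - (\<Sum>j<n. step j (a j)))) \<longlonglongrightarrow> 0"
    and a0: "\<And>j i. j < N \<Longrightarrow> a j i = 0" and B: "lq_le q (level_norm s p a) B"
  shows "ae_int (T \<psi>)"
    and "lq_le q (level_norm s p (mart_diff (T \<psi>))) ((2 * M) powr (1 - 1 / p) * C powr (1 / p) * (G powr s * kernel_const \<eta>) * B)"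
proof -
  show "ae_int (T \<psi>)" using L1opD(3)[OF T] \<psi> by simp
  define A where "A = (2 * M) powr (1 - 1 / p) * C powr (1 / p)"
  have A: "0 \<le> A" by (simp add: A_def)
  define \<theta> where "\<theta> = \<beta> / p"
  define \<kappa> where "\<kappa> k j = A * level_kernel s \<theta> G (real_of_int (int k - int j))" for k j
  define S where "S n = (\<Sum>j<n. step j (a j))" for n
  define X where "X n k = level_norm s p (mart_diff (T (S n))) k" for n k
  have iS: "ae_int (S n)" for n by (simp add: S_def)
  have limX: "(\<lambda>n. X n k) \<longlonglongrightarrow> level_norm s p (mart_diff (T \<psi>)) k" for k
  proof -
    have "(\<lambda>n. mart_diff (T (S n)) k l) \<longlonglongrightarrow> mart_diff (T \<psi>) k l" if l: "l < 2 ^ k" for l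
    proof (rule Lim_transform_bound[OF always_eventually, THEN LIM_zero_cancel])
      show "\<forall>n. norm (mart_diff (T (S n)) k l - mart_diff (T \<psi>) k l) \<le> norm (2 ^ k * (2 * norm1 (\<psi> - S n)))"
      proof
        fix n
        have "mart_diff (T (S n)) k l - mart_diff (T \<psi>) k l = mart_diff (T (S n - \<psi>)) k l"
          using iS \<psi> L1opD(3)[OF T] by (simp add: L1op_diff[OF T] mart_diff_diff)
        also have "norm \<dots> \<le> (\<Sum>l<2 ^ k. norm (mart_diff (T (S n - \<psi>)) k l))"
          using l by (intro member_le_sum[of l]) auto
        also have "\<dots> \<le> 2 ^ k * (2 * norm1 (T (S n - \<psi>)))"
          using sum_mart_diff_le[of "T (S n - \<psi>)" k] iS \<psi> L1opD(3)[OF T] by (simp add: field_simps)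
        also have "\<dots> \<le> 2 ^ k * (2 * norm1 (\<psi> - S n))"
          using L1opD(4)[OF T, of "S n - \<psi>"] iS \<psi> by (simp add: norm1_minus)
        finally show "norm (mart_diff (T (S n)) k l - mart_diff (T \<psi>) k l) \<le> norm (2 ^ k * (2 * norm1 (\<psi> - S n)))"
          by simp
      qed
      show "(\<lambda>n. 2 ^ k * (2 * norm1 (\<psi> - S n))) \<longlonglongrightarrow> 0"
        using lim unfolding S_def[symmetric] by (intro tendsto_mult_right_zero)
    qed
    then show ?thesis
      unfolding X_def level_norm_def using p by (intro tendsto_mult tendsto_const mean_norm_tendsto) auto
  qed
  have term_le: "2 powr (real k * s) * mean_norm p k (mart_diff (T (step j (a j))) k) \<le> \<kappa> k j * level_norm s p a j" for k j
  proof (cases "N \<le> j")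
    case False
    then have "step j (a j) = step j (\<lambda>_. 0)" using a0 by (intro step_cong) simp
    then have "T (step j (a j)) = 0" using L1op_zero[OF T] by simp
    then have "mart_diff (T (step j (a j))) k = (\<lambda>l. 0)" by (simp add: fun_eq_iff)
    then show ?thesis using p A by (simp add: \<kappa>_def level_kernel_nonneg)
  next
    case True
    define m where "m = min 1 ((G * 2 powr (real j - real k)) powr \<beta>)"
    have "mean_norm p k (mart_diff (T (step j (a j))) k) \<le> (2 * M) powr (1 - 1 / p) * (C * m) powr (1 / p) * mean_norm p j (a j)"
      using small[OF True] C by (intro schur_level[OF T pos p]) (auto simp: m_def)
    also have "(C * m) powr (1 / p) = C powr (1 / p) * m powr (1 / p)"
      by (simp add: powr_mult m_def)
    \<comment> \<open>The root 1/p turns \<beta> into \<theta> = \<beta>/p. The gap between \<theta>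
      and s is what makes the kernel summable.\<close>
    also have "m powr (1 / p) = min 1 ((G * 2 powr (real j - real k)) powr \<theta>)"
    proof -
      have "((G * 2 powr (real j - real k)) powr \<beta>) powr (1 / p) = (G * 2 powr (real j - real k)) powr \<theta>"
        by (simp add: powr_powr \<theta>_def)
      moreover have "min 1 y powr (1 / p) = min 1 (y powr (1 / p))" if "0 \<le> y" for y :: real
      proof (cases "y \<le> 1")
        case True
        then have "y powr (1 / p) \<le> 1" using that p powr_mono2[of "1 / p" y 1] by simp
        then show ?thesis using True by (simp add: min_absorb2)
      next
        case False
        then have "1 powr (1 / p) < y powr (1 / p)" using p by (intro powr_less_mono2) auto
        then show ?thesis using False by simp
      qed
      ultimately show ?thesis by (simp add: m_def)
    qed
    finally have "mean_norm p k (mart_diff (T (step j (a j))) k) \<le> A * min 1 ((G * 2 powr (real j - real k)) powr \<theta>) * mean_norm p j (a j)"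
      by (simp add: A_def mult_ac)
    then have "2 powr (real k * s) * mean_norm p k (mart_diff (T (step j (a j))) k)
        \<le> 2 powr (real k * s) * (A * min 1 ((G * 2 powr (real j - real k)) powr \<theta>) * mean_norm p j (a j))"
      by (rule mult_left_mono) simp
    also have "\<dots> = \<kappa> k j * level_norm s p a j"
      by (simp add: \<kappa>_def level_kernel_def level_norm_def left_diff_distrib powr_diff)
    finally show ?thesis .
  qed
  have X_le: "X n k \<le> (\<Sum>j<n. \<kappa> k j * level_norm s p a j)" for n k
  proof -
    have "mart_diff (T (S n)) k = (\<lambda>l. \<Sum>j<n. mart_diff (T (step j (a j))) k l)"
      using L1opD(3)[OF T] by (simp add: fun_eq_iff S_def L1op_sum[OF T] mart_diff_sum)
    then have "X n k \<le> 2 powr (real k * s) * (\<Sum>j<n. mean_norm p k (mart_diff (T (step j (a j))) k))"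
      unfolding X_def level_norm_def by (intro mult_left_mono) (simp_all add: mean_norm_sum_le[OF p])
    also have "\<dots> = (\<Sum>j<n. 2 powr (real k * s) * mean_norm p k (mart_diff (T (step j (a j))) k))"
      by (simp add: sum_distrib_left)
    also have "\<dots> \<le> (\<Sum>j<n. \<kappa> k j * level_norm s p a j)"
      by (intro sum_mono term_le)
    finally show ?thesis .
  qed
  have \<eta>': "\<eta> \<le> \<theta> - s" using \<eta> by (simp add: \<theta>_def)
  have row: "(\<Sum>j<n. \<kappa> k j) \<le> A * (G powr s * kernel_const \<eta>)" for k n
  proof -
    have "(\<Sum>j<n. \<kappa> k j) = A * (\<Sum>m\<in>(\<lambda>j. int k - int j) ` {..<n}. level_kernel s \<theta> G (real_of_int m))"
      by (subst sum.reindex) (auto simp: inj_on_def \<kappa>_def sum_distrib_left)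
    also have "\<dots> \<le> A * (G powr s * kernel_const \<eta>)"
      by (intro mult_left_mono sum_level_kernel_le[OF G \<eta>(1,2) \<eta>'] A) simp
    finally show ?thesis .
  qed
  have col: "(\<Sum>k<n. \<kappa> k j) \<le> A * (G powr s * kernel_const \<eta>)" for j n
  proof -
    have "(\<Sum>k<n. \<kappa> k j) = A * (\<Sum>m\<in>(\<lambda>k. int k - int j) ` {..<n}. level_kernel s \<theta> G (real_of_int m))"
      by (subst sum.reindex) (auto simp: inj_on_def \<kappa>_def sum_distrib_left)
    also have "\<dots> \<le> A * (G powr s * kernel_const \<eta>)"
      by (intro mult_left_mono sum_level_kernel_le[OF G \<eta>(1,2) \<eta>'] A) simp
    finally show ?thesis .
  qed
  have "lq_le q (X n) (A * (G powr s * kernel_const \<eta>) * B)" for n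
  proof (rule lq_le_mono)
    show "lq_le q (\<lambda>k. \<Sum>j<n. \<kappa> k j * level_norm s p a j) (A * (G powr s * kernel_const \<eta>) * B)"
      using A by (intro lq_le_schur[OF B _ q _ row col]) (auto simp: \<kappa>_def level_kernel_nonneg)
  qed (use X_le q in \<open>auto simp: X_def\<close>)
  note Xle = this
  show "lq_le q (level_norm s p (mart_diff (T \<psi>))) ((2 * M) powr (1 - 1 / p) * C powr (1 / p) * (G powr s * kernel_const \<eta>) * B)"
    unfolding A_def[symmetric]
    by (rule lq_le_limit[OF limX Xle tendsto_const _ q]) (simp add: X_def)
qed

section \<open>The Besov space as a complete normed space\<close>

text \<open>The martingale description has one canonical coefficient sequence per class, hence no
  infimum over representations. Its agreement with the atomic space is \<open>besov_eq\<close>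
  below.\<close>

definition besov_set :: "real \<Rightarrow> real \<Rightarrow> ereal \<Rightarrow> aefun set" where
  "besov_set s p q = {\<psi>. ae_int \<psi> \<and> (\<exists>B. lq_le q (level_norm s p (mart_diff \<psi>)) B)}"

definition bnorm :: "real \<Rightarrow> real \<Rightarrow> ereal \<Rightarrow> aefun \<Rightarrow> real" where
  "bnorm s p q \<psi> = lq_norm q (level_norm s p (mart_diff \<psi>))"

locale besov_params =
  fixes s p :: real and q :: ereal
  assumes s: "0 < s" and p: "1 \<le> p" and q: "1 \<le> q"
begin

abbreviation "V \<equiv> besov_set s p q"
abbreviation "N \<equiv> bnorm s p q"

lemma V_int: "x \<in> V \<Longrightarrow> ae_int x" by (simp add: besov_set_def)

lemma N_bound: "x \<in> V \<Longrightarrow> lq_le q (level_norm s p (mart_diff x)) (N x)"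
  unfolding besov_set_def bnorm_def using q by (auto intro: lq_norm_attained)

lemma N_le: "ae_int x \<Longrightarrow> lq_le q (level_norm s p (mart_diff x)) B \<Longrightarrow> x \<in> V \<and> N x \<le> B"
  unfolding besov_set_def bnorm_def by (auto intro: lq_norm_le)

lemma N_nonneg: "x \<in> V \<Longrightarrow> 0 \<le> N x"
  using N_bound lq_le_nonneg by blast

lemma V_add: assumes "x \<in> V" "y \<in> V" shows "x + y \<in> V \<and> N (x + y) \<le> N x + N y"
proof (rule N_le)
  show "ae_int (x + y)" using assms V_int by simp
  have le: "level_norm s p (mart_diff (x + y)) k \<le> level_norm s p (mart_diff x) k + level_norm s p (mart_diff y) k" for k
  proof -
    have "mart_diff (x + y) k = (\<lambda>j. mart_diff x k j + mart_diff y k j)"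
      using assms V_int by (simp add: fun_eq_iff mart_diff_add)
    then show ?thesis
      using mean_norm_add_le[OF p, of k "mart_diff x k" "mart_diff y k"] by (simp add: level_norm_def flip: distrib_left)
  qed
  show "lq_le q (level_norm s p (mart_diff (x + y))) (N x + N y)"
    by (rule lq_le_mono[OF lq_le_add[OF N_bound[OF assms(1)] N_bound[OF assms(2)]] _ le order_refl q])
      (simp_all add: q)
qed

lemma V_cscale: assumes "x \<in> V" shows "cscale c x \<in> V \<and> N (cscale c x) \<le> norm c * N x"
proof (rule N_le)
  show "ae_int (cscale c x)" using assms V_int by simp
  have "level_norm s p (mart_diff (cscale c x)) k = norm c * level_norm s p (mart_diff x) k" for k
  proof -
    have "mart_diff (cscale c x) k = (\<lambda>j. c * mart_diff x k j)" by (simp add: fun_eq_iff mart_diff_cscale)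
    then show ?thesis using p by (simp add: level_norm_def mean_norm_scale)
  qed
  then have "level_norm s p (mart_diff (cscale c x)) = (\<lambda>k. norm c * level_norm s p (mart_diff x) k)" by (rule ext)
  then show "lq_le q (level_norm s p (mart_diff (cscale c x))) (norm c * N x)"
    using lq_le_scale[OF N_bound[OF assms]] q by simp
qed

lemma V_zero: "0 \<in> V \<and> N 0 \<le> 0"
proof (rule N_le)
  have "level_norm s p (mart_diff 0) = (\<lambda>k. 0)"
    using p by (simp add: fun_eq_iff level_norm_def) (simp add: mean_norm_def)
  then show "lq_le q (level_norm s p (mart_diff 0)) 0" using lq_le_zero[OF q] by simp
qed simp

lemma V_diff: assumes "x \<in> V" "y \<in> V" shows "x - y \<in> V \<and> N (x - y) \<le> N x + N y"
  using V_add[OF assms(1), of "cscale (-1) y"] V_cscale[OF assms(2), of "-1"] by force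

lemma V_sum: "(\<And>i. i \<in> A \<Longrightarrow> f i \<in> V) \<Longrightarrow> (\<Sum>i\<in>A. f i) \<in> V \<and> N (\<Sum>i\<in>A. f i) \<le> (\<Sum>i\<in>A. N (f i))"
proof (induction A rule: infinite_finite_induct)
  case (insert x F)
  then show ?case using V_add[of "f x" "\<Sum>i\<in>F. f i"] by fastforce
qed (use V_zero in auto)

lemma V_rep:
  assumes "x \<in> V"
  shows "\<exists>c. besov_rep s p x c \<and> level_norm s p (amplitude s p c) = level_norm s p (mart_diff x)"
    and "(\<lambda>n. norm1 (x - (\<Sum>j<n. step j (mart_diff x j)))) \<longlonglongrightarrow> 0"
proof -
  have le: "level_norm s p (mart_diff x) k \<le> N x" for k
    by (rule lq_le_nth[OF N_bound[OF assms] _ q]) simp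
  obtain c where c: "besov_rep s p x c" "\<And>k j. j < 2 ^ k \<Longrightarrow> amplitude s p c k j = mart_diff x k j"
    using besov_rep_mart_diff[OF V_int[OF assms] le s p] by blast
  have "level_norm s p (amplitude s p c) k = level_norm s p (mart_diff x) k" for k
    unfolding level_norm_def using c(2) by (simp cong: mean_norm_cong)
  then show "\<exists>c. besov_rep s p x c \<and> level_norm s p (amplitude s p c) = level_norm s p (mart_diff x)" using c(1) by blast
  have "step j (amplitude s p c j) = step j (mart_diff x j)" for j by (rule step_cong) (rule c(2))
  then show "(\<lambda>n. norm1 (x - (\<Sum>j<n. step j (mart_diff x j)))) \<longlonglongrightarrow> 0"
    using besov_rep_norm1(2)[OF c(1) p] by simp
qed

text \<open>The embedding into L^1. It makes the norm definite and allows limits to be constructed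
  in L^1.\<close>

lemma norm1_le_N: assumes "x \<in> V" shows "norm1 x \<le> N x / (1 - 2 powr (- s))"
proof (rule LIMSEQ_le_const)
  let ?S = "\<lambda>n. \<Sum>j<n. step j (mart_diff x j)" and ?K = "N x / (1 - 2 powr (- s))"
  show "(\<lambda>n. norm1 (x - ?S n) + ?K) \<longlonglongrightarrow> ?K"
    using tendsto_add[OF V_rep(2)[OF assms] tendsto_const, of ?K] by simp
  have le: "level_norm s p (mart_diff x) k \<le> N x" for k
    by (rule lq_le_nth[OF N_bound[OF assms] _ q]) simp
  have sum_le: "norm1 (?S n) \<le> (\<Sum>j<n. norm1 (step j (mart_diff x j)))" for n
  proof (induction n)
    case (Suc n)
    then show ?case using norm1_add_le[of "?S n" "step n (mart_diff x n)"] by simp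
  qed simp
  have "norm1 x \<le> norm1 (x - ?S n) + ?K" for n
  proof -
    have "norm1 (?S n) \<le> (\<Sum>j<n. mean_norm p j (mart_diff x j))"
      using sum_le[of n] sum_mono[of "{..<n}" "\<lambda>j. norm1 (step j (mart_diff x j))" "\<lambda>j. mean_norm p j (mart_diff x j)"]
        norm1_step_le mean_norm_1_le[OF p] by (meson order_trans)
    also have "\<dots> \<le> ?K"
      using sum_mean_norm_le[OF s le, of 0 n] by (simp add: lessThan_atLeast0)
    finally show ?thesis
      using norm1_add_le[of "x - ?S n" "?S n"] V_int[OF assms] by simp
  qed
  then show "\<exists>N. \<forall>n\<ge>N. norm1 x \<le> norm1 (x - ?S n) + ?K" by blast
qed

lemma N_eq_0: assumes "x \<in> V" "N x \<le> 0" shows "x = 0"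
proof -
  have "norm1 x \<le> N x / (1 - 2 powr (- s))" by (rule norm1_le_N[OF assms(1)])
  also have "\<dots> \<le> 0"
    using assms(2) s powr_less_mono[of "- s" 0 "2 :: real"] by (simp add: divide_nonpos_pos)
  finally have "norm1 x = 0" using norm1_nonneg[of x] by linarith
  then show ?thesis using V_int[OF assms(1)] by (rule norm1_eq_0[rotated])
qed

text \<open>Completeness in the form that Neumann series use. The L^1 norms of the terms are
  summable, so the sum exists almost everywhere and its averages are the sums of the averages.
  \<open>lq_le_limit\<close> then transports the tail bounds from finite blocks to the
  remainder.\<close>

lemma V_complete:
  assumes x: "\<And>i. x i \<in> V" and le: "\<And>i. N (x i) \<le> C * \<rho> ^ i" and \<rho>: "0 \<le> \<rho>" "\<rho> < 1"
  obtains y where "y \<in> V" "\<And>m. y - (\<Sum>i<m. x i) \<in> V \<and> N (y - (\<Sum>i<m. x i)) \<le> C / (1 - \<rho>) * \<rho> ^ m"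
proof -
  have "\<forall>i. \<exists>\<phi>. x i = abs_aefun \<phi>" by (metis aefun_cases)
  then obtain \<phi> where \<phi>: "\<And>i. x i = abs_aefun (\<phi> i)" by metis
  have int: "integrable unit_leb (\<phi> i)" for i
    using V_int[OF x, of i] by (simp add: \<phi> ae_int.abs_eq)
  have n1: "norm1 (x i) = (LINT t|unit_leb. norm (\<phi> i t))" for i
    by (simp add: \<phi> norm1.abs_eq)
  define K where "K = 1 / (1 - 2 powr (- s))"
  have K: "0 \<le> K" unfolding K_def using s powr_less_mono[of "- s" 0 "2 :: real"] by simp
  have "norm1 (x i) \<le> K * C * \<rho> ^ i" for i
    using norm1_le_N[OF x, of i] mult_left_mono[OF le[of i] K] by (simp add: K_def mult.assoc)
  moreover have sg: "summable (\<lambda>i. K * C * \<rho> ^ i)" using \<rho> by (intro summable_mult summable_geometric) simp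
  ultimately have sn: "summable (\<lambda>i. (LINT t|unit_leb. norm (\<phi> i t)))"
    unfolding n1[symmetric] by (intro summable_comparison_test'[OF sg]) simp
  have AEs: "AE t in unit_leb. summable (\<lambda>i. norm (\<phi> i t))"
  proof -
    have "(\<integral>\<^sup>+t. (\<Sum>i. ennreal (norm (\<phi> i t))) \<partial>unit_leb) = (\<Sum>i. \<integral>\<^sup>+t. ennreal (norm (\<phi> i t)) \<partial>unit_leb)"
      using int by (intro nn_integral_suminf) auto
    also have "\<dots> = (\<Sum>i. ennreal (LINT t|unit_leb. norm (\<phi> i t)))"
      using int by (intro suminf_cong nn_integral_eq_integral) auto
    also have "\<dots> = ennreal (\<Sum>i. (LINT t|unit_leb. norm (\<phi> i t)))"
      by (rule suminf_ennreal2[OF _ sn]) simp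
    finally have "(\<integral>\<^sup>+t. (\<Sum>i. ennreal (norm (\<phi> i t))) \<partial>unit_leb) \<noteq> \<infinity>" by simp
    then have "AE t in unit_leb. (\<Sum>i. ennreal (norm (\<phi> i t))) \<noteq> \<infinity>"
      using int by (intro nn_integral_PInf_AE) auto
    then show ?thesis by eventually_elim (auto intro: summable_suminf_not_top)
  qed
  define \<psi> where "\<psi> t = (\<Sum>i. \<phi> i t)" for t
  define y where "y = abs_aefun \<psi>"
  have i\<psi>: "integrable unit_leb \<psi>"
    unfolding \<psi>_def by (rule integrable_suminf[OF int AEs sn])
  then have iy: "ae_int y" by (simp add: y_def ae_int.abs_eq)
  have avg: "(\<lambda>i. avg (x i) k j) sums avg y k j" for k j
  proof -
    let ?Q = "dyadic_interval k j"
    let ?f = "\<lambda>i t. indicator ?Q t * \<phi> i t"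
    have iQ: "integrable unit_leb (?f i)" for i
      using ae_int_restr[of ?Q "x i"] V_int[OF x, of i] by (simp add: \<phi> restr.abs_eq ae_int.abs_eq)
    have le: "norm (?f i t) \<le> norm (\<phi> i t)" for i t by (simp add: indicator_def)
    have a: "AE t in unit_leb. summable (\<lambda>i. norm (?f i t))"
      using AEs by eventually_elim (use le in \<open>auto intro: summable_comparison_test'[where N = 0]\<close>)
    have "(LINT t|unit_leb. norm (?f i t)) \<le> (LINT t|unit_leb. norm (\<phi> i t))" for i
      using iQ int le by (intro integral_mono) auto
    then have b: "summable (\<lambda>i. (LINT t|unit_leb. norm (?f i t)))"
      by (intro summable_comparison_test'[OF sn, where N = 0]) simp
    have "(\<lambda>i. integral\<^sup>L unit_leb (?f i)) sums (LINT t|unit_leb. (\<Sum>i. ?f i t))"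
      by (rule sums_integral[OF iQ a b])
    moreover have "(LINT t|unit_leb. (\<Sum>i. ?f i t)) = (LINT t|unit_leb. indicator ?Q t * \<psi> t)"
    proof (rule unit_leb_AE_cong(3), use AEs in eventually_elim)
      case (elim t)
      then have "summable (\<lambda>i. \<phi> i t)" by (rule summable_norm_cancel)
      then show ?case unfolding \<psi>_def by (rule suminf_mult)
    qed
    ultimately have "(\<lambda>i. 2 ^ k * lint (restr ?Q (x i))) sums (2 ^ k * lint (restr ?Q y))"
      by (intro sums_mult) (simp add: \<phi> y_def restr.abs_eq lint.abs_eq)
    then show ?thesis by (simp add: avg_def)
  qed
  have main: "lq_le q (level_norm s p (mart_diff (y - (\<Sum>i<m. x i)))) (C / (1 - \<rho>) * \<rho> ^ m)" for m
  proof (rule lq_le_limit[where b = "\<lambda>n. level_norm s p (mart_diff (\<Sum>i\<in>{m..<m + n}. x i))" and B = "\<lambda>_. C / (1 - \<rho>) * \<rho> ^ m"])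
    fix k
    have av: "(\<lambda>n. avg (\<Sum>i\<in>{m..<m + n}. x i) k l) \<longlonglongrightarrow> avg (y - (\<Sum>i<m. x i)) k l" for k l
    proof -
      have "(\<lambda>n. \<Sum>i<n + m. avg (x i) k l) \<longlonglongrightarrow> avg y k l"
        using avg[of k l] unfolding sums_def by (rule LIMSEQ_ignore_initial_segment)
      then have "(\<lambda>n. (\<Sum>i<n + m. avg (x i) k l) - (\<Sum>i<m. avg (x i) k l)) \<longlonglongrightarrow> avg y k l - (\<Sum>i<m. avg (x i) k l)"
        by (intro tendsto_diff tendsto_const)
      moreover have "(\<Sum>i<n + m. avg (x i) k l) - (\<Sum>i<m. avg (x i) k l) = avg (\<Sum>i\<in>{m..<m + n}. x i) k l" for n
      proof -
        have "(\<Sum>i<n + m. avg (x i) k l) = (\<Sum>i<m. avg (x i) k l) + (\<Sum>i\<in>{m..<m + n}. avg (x i) k l)"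
          unfolding lessThan_atLeast0 by (subst sum.atLeastLessThan_concat) (auto simp: add.commute)
        then show ?thesis using V_int[OF x] by (simp add: avg_sum)
      qed
      ultimately show ?thesis using iy V_int[OF x] by (simp add: avg_diff avg_sum)
    qed
    show "(\<lambda>n. level_norm s p (mart_diff (\<Sum>i\<in>{m..<m + n}. x i)) k) \<longlonglongrightarrow> level_norm s p (mart_diff (y - (\<Sum>i<m. x i))) k"
      unfolding level_norm_def using p
      by (intro tendsto_mult tendsto_const mean_norm_tendsto) (auto simp: mart_diff_def intro!: tendsto_diff av)
    fix n
    have "N (\<Sum>i\<in>{m..<m + n}. x i) \<le> (\<Sum>i\<in>{m..<m + n}. N (x i))" using V_sum[of "{m..<m + n}" x, OF x] by simp
    also have "\<dots> \<le> (\<Sum>i\<in>{m..<m + n}. C * \<rho> ^ i)" by (intro sum_mono le)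
    also have "\<dots> = C * (\<Sum>i\<in>{m..<m + n}. \<rho> ^ i)" by (simp add: sum_distrib_left)
    also have "\<dots> \<le> C * (\<rho> ^ m / (1 - \<rho>))"
      using le[of 0] N_nonneg[OF x, of 0] by (intro mult_left_mono geometric_tail_le \<rho>) simp
    finally have "N (\<Sum>i\<in>{m..<m + n}. x i) \<le> C / (1 - \<rho>) * \<rho> ^ m" by simp
    then show "lq_le q (level_norm s p (mart_diff (\<Sum>i\<in>{m..<m + n}. x i))) (C / (1 - \<rho>) * \<rho> ^ m)"
      using V_sum[of "{m..<m + n}" x, OF x] q by (intro lq_le_mono[OF N_bound]) auto
  qed (use q in auto)
  have 1: "y - (\<Sum>i<m. x i) \<in> V \<and> N (y - (\<Sum>i<m. x i)) \<le> C / (1 - \<rho>) * \<rho> ^ m" for m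
    using main iy V_int[OF x] by (intro N_le) auto
  moreover from 1[of 0] have "y \<in> V" by simp
  ultimately show ?thesis using that by blast
qed

section \<open>Neumann series and the Fredholm criterion\<close>

lemma neumann:
  assumes R: "\<And>x. x \<in> V \<Longrightarrow> R x \<in> V \<and> N (R x) \<le> \<rho> * N x"
    and lin: "\<And>x y. x \<in> V \<Longrightarrow> y \<in> V \<Longrightarrow> R (x + y) = R x + R y" "\<And>c x. x \<in> V \<Longrightarrow> R (cscale c x) = cscale c (R x)"
    and \<rho>: "0 \<le> \<rho>" "\<rho> < norm w"
  shows "\<And>x. x \<in> V \<Longrightarrow> cscale w x - R x = 0 \<Longrightarrow> x = 0"
    and "\<And>x. x \<in> V \<Longrightarrow> \<exists>y\<in>V. cscale w y - R y = x"
proof -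
  have w: "w \<noteq> 0" using \<rho> by auto
  define r where "r = \<rho> / norm w"
  have r: "0 \<le> r" "r < 1" using \<rho> w by (auto simp: r_def)
  \<comment> \<open>Dividing by w leaves a contraction of ratio r < 1, and the equation becomes y -
    R' y = x / w.\<close>
  define R' where "R' x = cscale (1 / w) (R x)" for x
  have R': "R' x \<in> V \<and> N (R' x) \<le> r * N x" if "x \<in> V" for x
  proof -
    have "N (R' x) \<le> norm (1 / w) * N (R x)" unfolding R'_def using V_cscale R that by blast
    also have "\<dots> \<le> norm (1 / w) * (\<rho> * N x)" using R that by (intro mult_left_mono) auto
    finally show ?thesis using V_cscale R that by (simp add: R'_def r_def norm_divide)
  qed
  have eq: "cscale w x - R x = cscale w (x - R' x)" for x
    using w by (simp add: R'_def ae.scale_right_diff_distrib)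
  show "x = 0" if x: "x \<in> V" "cscale w x - R x = 0" for x
  proof (rule N_eq_0[OF x(1)])
    have "cscale w (x - R' x) = 0" using x(2) by (simp only: eq)
    then have "x - R' x = 0" using w ae.scale_eq_0_iff by blast
    then have "x = R' x" by (simp only: right_minus_eq)
    then have "N x \<le> r * N x" using R'[OF x(1)] by metis
    then have "(1 - r) * N x \<le> 0" by (simp add: algebra_simps)
    then show "N x \<le> 0" using r by (simp add: mult_le_0_iff)
  qed
  show "\<exists>y\<in>V. cscale w y - R y = x" if x: "x \<in> V" for x
  proof -
    define x0 where "x0 = cscale (1 / w) x"
    have x0: "x0 \<in> V" using V_cscale x by (simp add: x0_def)
    define X where "X i = (R' ^^ i) x0" for i
    have X: "X i \<in> V \<and> N (X i) \<le> N x0 * r ^ i" for i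
    proof (induction i)
      case 0
      then show ?case using x0 by (simp add: X_def)
    next
      case (Suc i)
      have "N (X (Suc i)) \<le> r * N (X i)" using R' Suc by (simp add: X_def)
      also have "\<dots> \<le> r * (N x0 * r ^ i)" using Suc r by (intro mult_left_mono) auto
      finally show ?case using R' Suc by (simp add: X_def mult_ac)
    qed
    obtain y where y: "y \<in> V"
      "\<And>m. y - (\<Sum>i<m. X i) \<in> V \<and> N (y - (\<Sum>i<m. X i)) \<le> N x0 / (1 - r) * r ^ m"
      using V_complete[of X "N x0" r] X r by blast
    have lin': "R' (a + b) = R' a + R' b" if "a \<in> V" "b \<in> V" for a b
      using lin(1)[OF that] by (simp add: R'_def ae.scale_right_distrib)
    have linm: "R' (- b) = - R' b" if "b \<in> V" for b
      using lin(2)[OF that, of "-1"] by (simp add: R'_def)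
    have mV: "- b \<in> V" if "b \<in> V" for b using V_cscale[OF that, of "-1"] by simp
    have S: "(\<Sum>i<m. X i) \<in> V" for m using V_sum[of "{..<m}" X] X by simp
    have S_Suc: "(\<Sum>i<Suc m. X i) = x0 + R' (\<Sum>i<m. X i)" for m
    proof (induction m)
      case 0
      have "R' 0 = 0" using linm[of 0] lin'[of 0 0] V_zero by simp
      then show ?case by (simp add: X_def)
    next
      case (Suc m)
      have "(\<Sum>i<Suc (Suc m). X i) = (\<Sum>i<Suc m. X i) + R' (X m)" by (simp add: X_def)
      also have "\<dots> = x0 + (R' (\<Sum>i<m. X i) + R' (X m))" using Suc by simp
      also have "R' (\<Sum>i<m. X i) + R' (X m) = R' ((\<Sum>i<m. X i) + X m)"
        using lin'[OF S] X by simp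
      finally show ?case by simp
    qed
    \<comment> \<open>The residual of the candidate solution. Comparing y with the partial sums
      bounds its norm by a constant times r^m for every m, so it vanishes.\<close>
    define z where "z = y - R' y - x0"
    have z: "z \<in> V" unfolding z_def using y(1) R' x0 V_diff by blast
    have "N z \<le> N x0 / (1 - r) * (2 * r) * r ^ m" for m
    proof -
      let ?S = "\<Sum>i<m. X i"
      have d: "y - ?S \<in> V" "N (y - ?S) \<le> N x0 / (1 - r) * r ^ m" using y(2) by blast+
      have "R' (y - ?S) = R' y - R' ?S" using lin'[OF y(1) mV[OF S]] linm[OF S] by simp
      then have ze: "z = (y - (\<Sum>i<Suc m. X i)) - R' (y - ?S)"
        unfolding S_Suc z_def by (simp add: algebra_simps)
      have "N z \<le> N (y - (\<Sum>i<Suc m. X i)) + N (R' (y - ?S))"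
        unfolding ze using V_diff y(2) R' by blast
      also have "\<dots> \<le> N x0 / (1 - r) * r ^ Suc m + r * (N x0 / (1 - r) * r ^ m)"
      proof (rule add_mono)
        show "N (y - (\<Sum>i<Suc m. X i)) \<le> N x0 / (1 - r) * r ^ Suc m" using y(2) by blast
        have "N (R' (y - ?S)) \<le> r * N (y - ?S)" using R'[OF d(1)] by blast
        also have "\<dots> \<le> r * (N x0 / (1 - r) * r ^ m)" by (rule mult_left_mono[OF d(2) r(1)])
        finally show "N (R' (y - ?S)) \<le> r * (N x0 / (1 - r) * r ^ m)" .
      qed
      finally show ?thesis by (simp add: algebra_simps)
    qed
    moreover have "(\<lambda>m. N x0 / (1 - r) * (2 * r) * r ^ m) \<longlonglongrightarrow> 0"
      using r by (intro tendsto_mult_right_zero LIMSEQ_realpow_zero)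
    ultimately have "N z \<le> 0" by (intro LIMSEQ_le_const) auto
    then have "z = 0" using N_eq_0[OF z] by simp
    then have "y - R' y = x0" by (simp add: z_def)
    then have "cscale w y - R y = cscale w x0" by (simp add: eq)
    then show ?thesis using y(1) w by (auto simp: x0_def)
  qed
qed

text \<open>\<open>A\<close> = z^n - R is invertible and differs from z^n - T^n by a map into the
  span of \<open>B\<close>. A vector killed by z - T satisfies T^n x = z^n x, so A x lies in that
  span and x in the span of finitely many A-preimages. For the cokernel, x = A y is (z^n - T^n) y
  plus an element of the span of \<open>B\<close>, and z^n - T^n has z - T as a left factor.\<close>

lemma fredholm_resolvent:
  assumes T: "L1op T" and TV: "\<And>x. x \<in> V \<Longrightarrow> T x \<in> V"
    and bd: "bounded_op V' N' (\<lambda>x. cscale z x - T x)" and V': "V' = V"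
    and R: "\<And>x. x \<in> V \<Longrightarrow> R x \<in> V \<and> N (R x) \<le> \<rho> * N x"
    and lin: "\<And>x y. x \<in> V \<Longrightarrow> y \<in> V \<Longrightarrow> R (x + y) = R x + R y" "\<And>c x. x \<in> V \<Longrightarrow> R (cscale c x) = cscale c (R x)"
    and fin: "finite B" "B \<subseteq> V" and K: "\<And>x. x \<in> V \<Longrightarrow> (T ^^ n) x - R x \<in> ae.span B"
    and \<rho>: "0 \<le> \<rho>" "\<rho> < norm z ^ n"
  shows "fredholm V' N' (\<lambda>x. cscale z x - T x)"
proof -
  define w where "w = z ^ n"
  have w: "\<rho> < norm w" using \<rho> by (simp add: w_def norm_power)
  have inj: "x = 0" if "x \<in> V" "cscale w x - R x = 0" for x
    by (rule neumann(1)[where R = R and \<rho> = \<rho> and w = w]) (rule R lin \<rho>(1) w that | assumption)+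
  have surj: "\<exists>y\<in>V. cscale w y - R y = x" if "x \<in> V" for x
    by (rule neumann(2)[where R = R and \<rho> = \<rho> and w = w]) (rule R lin \<rho>(1) w that | assumption)+
  define A where "A x = cscale w x - R x" for x
  have AV: "A x \<in> V" if "x \<in> V" for x unfolding A_def using that R V_cscale V_diff by blast
  have A_add: "A (x + y) = A x + A y" if "x \<in> V" "y \<in> V" for x y
    by (simp add: A_def lin(1)[OF that] ae.scale_right_distrib)
  have A_scale: "A (cscale c x) = cscale c (A x)" if "x \<in> V" for c x
    by (simp add: A_def lin(2)[OF that] ae.scale_right_diff_distrib mult.commute)
  have R0: "R 0 = 0" using lin(2)[of 0 0] V_zero by simp
  have A_sum: "A (\<Sum>i\<in>F. f i) = (\<Sum>i\<in>F. A (f i))" if "\<And>i. i \<in> F \<Longrightarrow> f i \<in> V" for F :: "aefun set" and f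
    using that
  proof (induction F rule: infinite_finite_induct)
    case (insert x F)
    then show ?case using V_sum[of F f] by (simp add: A_add)
  qed (simp_all add: A_def R0)
  have "\<forall>b\<in>B. \<exists>g\<in>V. A g = b" using surj fin(2) unfolding A_def by blast
  then obtain g where g: "\<And>b. b \<in> B \<Longrightarrow> g b \<in> V \<and> A (g b) = b" by metis
  have pow: "(T ^^ k) x = cscale (z ^ k) x" if "T x = cscale z x" for k x
    using that by (induction k) (simp_all add: L1opD(2)[OF T])
  have ker: "x \<in> ae.span (g ` B)" if x: "x \<in> V" "cscale z x - T x = 0" for x
  proof -
    have "(T ^^ n) x = cscale w x" using x(2) pow[of x n] by (simp add: w_def)
    then have "A x \<in> ae.span B" using K[OF x(1)] by (simp add: A_def)
    then obtain u where u: "A x = (\<Sum>b\<in>B. cscale (u b) b)"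
      unfolding ae.span_finite[OF fin(1)] by auto
    define y where "y = (\<Sum>b\<in>B. cscale (u b) (g b))"
    have yV: "y \<in> V" unfolding y_def using V_sum[of B "\<lambda>b. cscale (u b) (g b)"] g V_cscale by blast
    have "A y = (\<Sum>b\<in>B. cscale (u b) b)"
      unfolding y_def using g V_cscale by (subst A_sum) (auto simp: A_scale)
    then have "A y = A x" using u by simp
    have myV: "- y \<in> V" using V_cscale[OF yV, of "-1"] by simp
    have "A (- y) = - A y" using A_scale[OF yV, of "-1"] by simp
    then have "A (x - y) = 0" using A_add[OF x(1) myV] \<open>A y = A x\<close> by simp
    then have "x - y = 0" using inj[of "x - y"] V_diff[OF x(1) yV] by (simp add: A_def)
    moreover have "y \<in> ae.span (g ` B)"
      unfolding y_def by (intro ae.span_sum ae.span_scale ae.span_base) simp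
    ultimately show ?thesis by simp
  qed
  have TnV: "(T ^^ k) x \<in> V" if "x \<in> V" for x k using that TV by (induction k) auto
  \<comment> \<open>The left factor is extracted by induction from z^(k+1) - T^(k+1) = z (z^k - T^k)
    + (z - T) T^k.\<close>
  have tel: "\<exists>u\<in>V. cscale (z ^ k) y - (T ^^ k) y = cscale z u - T u" if y: "y \<in> V" for y k
  proof (induction k)
    case 0
    then show ?case using V_zero L1op_zero[OF T] by (intro bexI[of _ 0]) auto
  next
    case (Suc k)
    then obtain u where u: "u \<in> V" "cscale (z ^ k) y - (T ^^ k) y = cscale z u - T u" by blast
    have "cscale (z ^ Suc k) y - (T ^^ Suc k) y
        = cscale z (cscale (z ^ k) y - (T ^^ k) y) + (cscale z ((T ^^ k) y) - T ((T ^^ k) y))"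
      by (simp add: ae.scale_right_diff_distrib)
    also have "\<dots> = cscale z (cscale z u + (T ^^ k) y) - T (cscale z u + (T ^^ k) y)"
      unfolding u(2) by (simp add: L1opD(1,2)[OF T] ae.scale_right_diff_distrib ae.scale_right_distrib)
    finally show ?case
      using V_add V_cscale u(1) TnV[OF y] by blast
  qed
  have coker: "x \<in> ae.span ((\<lambda>x. cscale z x - T x) ` V \<union> B)" if x: "x \<in> V" for x
  proof -
    obtain y where y: "y \<in> V" "A y = x" using surj[OF x] unfolding A_def by blast
    obtain u where u: "u \<in> V" "cscale w y - (T ^^ n) y = cscale z u - T u"
      using tel[OF y(1)] unfolding w_def by blast
    have "x = (cscale z u - T u) + ((T ^^ n) y - R y)"
      using y(2) u(2) by (simp add: A_def flip: u(2))
    moreover have "cscale z u - T u \<in> ae.span ((\<lambda>x. cscale z x - T x) ` V \<union> B)"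
      using u(1) by (intro ae.span_base) auto
    moreover have "(T ^^ n) y - R y \<in> ae.span ((\<lambda>x. cscale z x - T x) ` V \<union> B)"
      using K[OF y(1)] ae.span_mono[of B "(\<lambda>x. cscale z x - T x) ` V \<union> B"] by blast
    ultimately show ?thesis using ae.span_add by metis
  qed
  show ?thesis
    unfolding fredholm_def V'
  proof (intro conjI)
    show "bounded_op V N' (\<lambda>x. cscale z x - T x)" using bd V' by simp
    show "\<exists>B. finite B \<and> {x \<in> V. cscale z x - T x = 0} \<subseteq> ae.span B"
      using ker fin by (intro exI[of _ "g ` B"]) auto
    show "\<exists>B. finite B \<and> B \<subseteq> V \<and> V \<subseteq> ae.span ((\<lambda>x. cscale z x - T x) ` V \<union> B)"
      using coker fin by blast
  qed
qed

end

section \<open>Equivalence of the atomic and the martingale norm\<close>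

lemma step_refine_iter: "step j \<alpha> = step (j + i) (\<lambda>l. \<alpha> (l div 2 ^ i))"
proof (induction i)
  case (Suc i)
  have "step j \<alpha> = step (Suc (j + i)) (\<lambda>l. \<alpha> (l div 2 div 2 ^ i))"
    unfolding Suc by (rule step_refine)
  then show ?case by (simp add: div_mult2_eq)
qed simp

lemma avg_step_fine:
  assumes "j \<le> k" "l < 2 ^ k"
  shows "avg (step j \<alpha>) k l = \<alpha> (l div 2 ^ (k - j))"
  using avg_step[OF assms(2), of "\<lambda>l. \<alpha> (l div 2 ^ (k - j))"] step_refine_iter[of j \<alpha> "k - j"] assms(1) by simp

lemma ae_ind_eq_step: "i < 2 ^ j \<Longrightarrow> ae_ind (dyadic_interval j i) = step j (\<lambda>l. if l = i then 1 else 0)"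
  by (simp add: step_def if_distrib[of "\<lambda>c. cscale c _"] cong: if_cong)

lemma avg_one: "j < 2 ^ k \<Longrightarrow> avg ae_one k j = 1"
  using avg_step[of j k "\<lambda>_. 1"] by (simp add: step_one)

text \<open>The kernel hypothesis of \<open>kernel_estimate\<close>; 1/2^j is the L^1 norm of the
  cell. The threshold \<open>m\<close> may depend on the operator as long as \<open>C\<close> does
  not, since coarse levels are split off as a part of finite rank.\<close>

definition small_on :: "real \<Rightarrow> real \<Rightarrow> real \<Rightarrow> nat \<Rightarrow> (aefun \<Rightarrow> aefun) \<Rightarrow> bool" where
  "small_on \<beta> C G m T \<longleftrightarrow> (\<forall>j i k. m \<le> j \<longrightarrow> i < 2 ^ j \<longrightarrow>
     mean_norm 1 k (mart_diff (T (ae_ind (dyadic_interval j i))) k) \<le> C * min 1 ((G * 2 powr (real j - real k)) powr \<beta>) / 2 ^ j)"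

text \<open>The indicator of a cell of level j has no martingale differences above level j, and up
  to level j the minimum is 1. Hence every positive exponent is admissible.\<close>

lemma small_on_id: "0 < \<beta> \<Longrightarrow> small_on \<beta> 2 1 0 (\<lambda>x. x)"
  unfolding small_on_def
proof (intro allI impI)
  fix j i k :: nat assume i: "i < 2 ^ j" and \<beta>: "0 < \<beta>"
  let ?x = "ae_ind (dyadic_interval j i)"
  show "mean_norm 1 k (mart_diff ?x k) \<le> 2 * min 1 ((1 * 2 powr (real j - real k)) powr \<beta>) / 2 ^ j"
  proof (cases "k \<le> j")
    case True
    then have "1 \<le> (2::real) powr ((real j - real k) * \<beta>)" using \<beta> by (intro ge_one_powr_ge_zero) auto
    then have m: "min 1 ((1 * 2 powr (real j - real k)) powr \<beta>) = 1" by (simp add: powr_powr)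
    have "norm1 ?x = 1 / 2 ^ j"
      using i by (subst norm1_ae_ind) (simp_all only: dyadic_interval_subset measure_dyadic_interval dyadic_interval_sets)
    then show ?thesis unfolding m using sum_mart_diff_le[of ?x k] by (simp add: mean_norm_1)
  next
    case False
    have "mart_diff ?x k l = 0" if l: "l < 2 ^ k" for l
    proof -
      obtain k' where k': "k = Suc k'" "j \<le> k'" using False by (cases k) auto
      have "l div 2 < 2 ^ k'" using l by (simp add: k')
      moreover have "l div 2 div 2 ^ (k' - j) = l div 2 ^ (k - j)"
        using k' by (simp add: div_mult2_eq[symmetric] Suc_diff_le)
      ultimately show ?thesis
        using False k' l by (simp add: mart_diff_def ae_ind_eq_step[OF i] avg_step_fine)
    qed
    then have "mean_norm 1 k (mart_diff ?x k) = 0" by (simp add: mean_norm_1)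
    then show ?thesis by simp
  qed
qed

context besov_params
begin

text \<open>The constant of \<open>kernel_estimate\<close> for the identity, with M = 1, C = 2, G =
  1 and \<eta> = s.\<close>

definition equiv_const :: real where "equiv_const = 2 powr (1 - 1 / p) * 2 powr (1 / p) * kernel_const s"

lemma equiv_const_pos: "0 < equiv_const"
  unfolding equiv_const_def kernel_const_def using s powr_less_mono[of "- s" 0 "2 :: real"] by simp

text \<open>The kernel estimate for the identity converts an arbitrary atomic representation into
  martingale differences. The exponent 2sp makes both decay rates of the kernel equal to s.\<close>

lemma rep_N:
  assumes "besov_rep s p \<psi> c" "coeff_finite p q c"
  shows "\<psi> \<in> V \<and> N \<psi> \<le> equiv_const * coeff_norm p q c"
proof -
  have \<beta>: "0 < 2 * s * p" using s p by simp
  have "lq_le q (level_norm s p (mart_diff \<psi>)) ((2 * 1) powr (1 - 1 / p) * 2 powr (1 / p) * (1 powr s * kernel_const s) * coeff_norm p q c)"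
  proof (rule kernel_estimate(2)[where T = "\<lambda>x. x" and \<beta> = "2 * s * p" and N = 0 and a = "amplitude s p c"])
    show "L1op (\<lambda>x. x)" by (simp add: L1op_def)
    show "posop 1 (\<lambda>x. x)" by (simp add: posop_def)
    show "s \<le> 2 * s * p / p - s" using p by simp
    show "mean_norm 1 k (mart_diff (ae_ind (dyadic_interval j i)) k) \<le> 2 * min 1 ((1 * 2 powr (real j - real k)) powr (2 * s * p)) / 2 ^ j"
      if "i < 2 ^ j" for j i k
      using small_on_id[OF \<beta>] that unfolding small_on_def by blast
  qed (use s p q besov_rep_norm1[OF assms(1) p] lq_le_coeff_norm[OF p q assms(2)] in auto)
  then show ?thesis using N_le[OF besov_rep_norm1(1)[OF assms(1) p]] by (simp add: equiv_const_def)
qed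

text \<open>In this direction the martingale differences are themselves atomic coefficients after
  normalisation, so the constant is 1.\<close>

lemma V_coeff:
  assumes "\<psi> \<in> V"
  shows "\<exists>c. besov_rep s p \<psi> c \<and> coeff_finite p q c \<and> coeff_norm p q c \<le> N \<psi>"
proof -
  obtain c where c: "besov_rep s p \<psi> c" "level_norm s p (amplitude s p c) = level_norm s p (mart_diff \<psi>)"
    using V_rep(1)[OF assms] by blast
  then show ?thesis using coeff_norm_le[OF p q] N_bound[OF assms] by metis
qed

lemma besov_eq: "besov s p q = V"
  unfolding besov_def using rep_N V_coeff by blast

lemma besov_norm_le: "\<psi> \<in> V \<Longrightarrow> besov_norm s p q \<psi> \<le> N \<psi>"
proof -
  assume "\<psi> \<in> V"
  then obtain c where c: "besov_rep s p \<psi> c" "coeff_finite p q c" "coeff_norm p q c \<le> N \<psi>"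
    using V_coeff by blast
  have "bdd_below {coeff_norm p q c | c. besov_rep s p \<psi> c \<and> coeff_finite p q c}"
    using lq_le_nonneg[OF lq_le_coeff_norm[OF p q]] by (intro bdd_belowI[of _ 0]) auto
  then have "besov_norm s p q \<psi> \<le> coeff_norm p q c"
    unfolding besov_norm_def using c by (intro cInf_lower) auto
  then show ?thesis using c by linarith
qed

lemma N_le_besov_norm: "\<psi> \<in> V \<Longrightarrow> N \<psi> \<le> equiv_const * besov_norm s p q \<psi>"
proof -
  assume V: "\<psi> \<in> V"
  have "N \<psi> / equiv_const \<le> besov_norm s p q \<psi>"
    unfolding besov_norm_def
  proof (rule cInf_greatest)
    show "{coeff_norm p q c | c. besov_rep s p \<psi> c \<and> coeff_finite p q c} \<noteq> {}"
      using V_coeff[OF V] by auto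
    fix t assume "t \<in> {coeff_norm p q c | c. besov_rep s p \<psi> c \<and> coeff_finite p q c}"
    then show "N \<psi> / equiv_const \<le> t" using rep_N equiv_const_pos by (auto simp: divide_le_eq mult.commute)
  qed
  then show ?thesis using equiv_const_pos by (simp add: divide_le_eq mult.commute)
qed

lemma bounded_opI:
  assumes V: "\<And>x. x \<in> V \<Longrightarrow> T x \<in> V \<and> N (T x) \<le> C * N x" and C: "0 \<le> C"
    and lin: "\<And>x y. T (x + y) = T x + T y" "\<And>c x. T (cscale c x) = cscale c (T x)"
  shows "bounded_op (besov s p q) (besov_norm s p q) T"
  unfolding bounded_op_def besov_eq
proof (intro conjI)
  have "besov_norm s p q (T x) \<le> C * equiv_const * besov_norm s p q x" if "x \<in> V" for x
  proof -
    have "besov_norm s p q (T x) \<le> N (T x)" using V that by (intro besov_norm_le) blast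
    also have "\<dots> \<le> C * N x" using V that by blast
    also have "\<dots> \<le> C * (equiv_const * besov_norm s p q x)" using that C by (intro mult_left_mono N_le_besov_norm)
    finally show ?thesis by (simp add: mult.assoc)
  qed
  then show "\<exists>C. \<forall>x\<in>V. besov_norm s p q (T x) \<le> C * besov_norm s p q x" by blast
qed (use V lin in auto)

section \<open>Boundedness and spectral bounds on the Besov space\<close>

lemma N_high_part:
  assumes T: "L1op T" and pos: "posop M T" and C: "0 \<le> C" and G: "0 < G"
    and \<eta>: "0 < \<eta>" "\<eta> \<le> s" "\<eta> \<le> \<beta> / p - s" and sm: "small_on \<beta> C G m T" and x: "x \<in> V"
  defines "y \<equiv> T (x - step m (avg x m))"
  shows "y \<in> V \<and> N y \<le> (2 * M) powr (1 - 1 / p) * C powr (1 / p) * (G powr s * kernel_const \<eta>) * N x"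
proof -
  \<comment> \<open>Subtracting the conditional expectation removes the differences of all levels up
    to m, including m itself, and leaves the finer ones unchanged. Hence no level norm
    increases.\<close>
  define a where "a j i = (if j \<le> m then 0 else mart_diff x j i)" for j i
  define \<psi> where "\<psi> = x - step m (avg x m)"
  have \<psi>: "ae_int \<psi>" using V_int[OF x] by (simp add: \<psi>_def)
  have lim: "(\<lambda>n. norm1 (\<psi> - (\<Sum>j<n. step j (a j)))) \<longlonglongrightarrow> 0"
  proof (rule Lim_transform_eventually[OF V_rep(2)[OF x]])
    have "\<psi> - (\<Sum>j<n. step j (a j)) = x - (\<Sum>j<n. step j (mart_diff x j))" if n: "Suc m \<le> n" for n
    proof -
      have z: "a j = (\<lambda>i. 0)" if "j \<le> m" for j using that by (simp add: a_def fun_eq_iff)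
      have e: "a j = mart_diff x j" if "m < j" for j using that by (simp add: a_def fun_eq_iff)
      have "(\<Sum>j<n. step j (mart_diff x j)) = (\<Sum>j<Suc m. step j (mart_diff x j)) + (\<Sum>j\<in>{Suc m..<n}. step j (mart_diff x j))"
        unfolding lessThan_atLeast0 using n by (intro sum.atLeastLessThan_concat[symmetric]) auto
      moreover have "(\<Sum>j<n. step j (a j)) = (\<Sum>j<Suc m. step j (a j)) + (\<Sum>j\<in>{Suc m..<n}. step j (a j))"
        unfolding lessThan_atLeast0 using n by (intro sum.atLeastLessThan_concat[symmetric]) auto
      moreover have "(\<Sum>j<Suc m. step j (a j)) = 0" by (intro sum.neutral) (simp add: z)
      moreover have "(\<Sum>j\<in>{Suc m..<n}. step j (a j)) = (\<Sum>j\<in>{Suc m..<n}. step j (mart_diff x j))"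
        by (intro sum.cong) (simp_all add: e)
      ultimately show ?thesis unfolding \<psi>_def using sum_step_mart_diff[of x m] by (simp del: sum.lessThan_Suc)
    qed
    then show "\<forall>\<^sub>F n in sequentially. norm1 (x - (\<Sum>j<n. step j (mart_diff x j))) = norm1 (\<psi> - (\<Sum>j<n. step j (a j)))"
      by (intro eventually_sequentiallyI[of "Suc m"]) simp
  qed
  have "level_norm s p a k \<le> level_norm s p (mart_diff x) k" for k
    using p by (cases "k \<le> m") (simp_all add: level_norm_def a_def mean_norm_def)
  then have le: "lq_le q (level_norm s p a) (N x)"
    by (intro lq_le_mono[OF N_bound[OF x]]) (auto simp: q)
  have sm': "mean_norm 1 k (mart_diff (T (ae_ind (dyadic_interval j i))) k) \<le> C * min 1 ((G * 2 powr (real j - real k)) powr \<beta>) / 2 ^ j"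
    if "m \<le> j" "i < 2 ^ j" for j i k using sm that unfolding small_on_def by blast
  have a0: "a j i = 0" if "j < m" for j i using that by (simp add: a_def)
  show ?thesis
    unfolding y_def \<psi>_def[symmetric]
    using kernel_estimate[OF T pos p q C G \<eta> sm' \<psi> lim a0 le] by (intro N_le)
qed

text \<open>Nothing is assumed on cells coarser than level m, so the whole coarse part of x is
  rewritten as one layer at level m, made of averages instead of differences. Such a layer is
  controlled through L^1, at a price \<open>L\<close> that depends on m and is harmless for mere
  boundedness.\<close>

lemma N_op_bounded:
  assumes T: "L1op T" and pos: "posop M T" and C: "0 \<le> C" and G: "0 < G"
    and \<eta>: "0 < \<eta>" "\<eta> \<le> s" "\<eta> \<le> \<beta> / p - s" and sm: "small_on \<beta> C G m T"
  shows "\<exists>D\<ge>0. \<forall>x\<in>V. T x \<in> V \<and> N (T x) \<le> D * N x"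
proof -
  define D where "D = (2 * M) powr (1 - 1 / p) * C powr (1 / p) * (G powr s * kernel_const \<eta>)"
  \<comment> \<open>2^m bounds an average by the L^1 norm, 1 / (1 - 2^(-s)) bounds the L^1 norm by
    \<open>N\<close>, and 2^(ms) is the weight of level m.\<close>
  define L where "L = 2 powr (real m * s) * (2 ^ m * (1 / (1 - 2 powr (- s))))"
  have x2: "(2::real) powr (- s) < 1" using s powr_less_mono[of "- s" 0 "2 :: real"] by simp
  have L: "0 \<le> L" using x2 by (simp add: L_def)
  have "(2::real) powr (- \<eta>) < 1" using \<eta> powr_less_mono[of "- \<eta>" 0 "2 :: real"] by simp
  then have D: "0 \<le> D" by (simp add: D_def kernel_const_def)
  have "T x \<in> V \<and> N (T x) \<le> D * (L + 1) * N x" if x: "x \<in> V" for x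
  proof -
    define a where "a j i = (if j < m then 0 else if j = m then avg x m i else mart_diff x j i)" for j i
    have lim: "(\<lambda>n. norm1 (x - (\<Sum>j<n. step j (a j)))) \<longlonglongrightarrow> 0"
    proof (rule Lim_transform_eventually[OF V_rep(2)[OF x]])
      have "(\<Sum>j<n. step j (a j)) = (\<Sum>j<n. step j (mart_diff x j))" if n: "Suc m \<le> n" for n
      proof -
        have z: "a j = (\<lambda>i. 0)" if "j < m" for j using that by (simp add: a_def fun_eq_iff)
        have e: "a j = mart_diff x j" if "m < j" for j using that by (simp add: a_def fun_eq_iff)
        have am: "a m = avg x m" by (simp add: a_def fun_eq_iff)
        have "(\<Sum>j<n. step j (mart_diff x j)) = (\<Sum>j<Suc m. step j (mart_diff x j)) + (\<Sum>j\<in>{Suc m..<n}. step j (mart_diff x j))"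
          unfolding lessThan_atLeast0 using n by (intro sum.atLeastLessThan_concat[symmetric]) auto
        moreover have "(\<Sum>j<n. step j (a j)) = (\<Sum>j<Suc m. step j (a j)) + (\<Sum>j\<in>{Suc m..<n}. step j (a j))"
          unfolding lessThan_atLeast0 using n by (intro sum.atLeastLessThan_concat[symmetric]) auto
        moreover have "(\<Sum>j<Suc m. step j (a j)) = step m (avg x m)" by (simp add: z am)
        moreover have "(\<Sum>j\<in>{Suc m..<n}. step j (a j)) = (\<Sum>j\<in>{Suc m..<n}. step j (mart_diff x j))"
          by (intro sum.cong) (simp_all add: e)
        ultimately show ?thesis unfolding sum_step_mart_diff by simp
      qed
      then show "\<forall>\<^sub>F n in sequentially. norm1 (x - (\<Sum>j<n. step j (mart_diff x j))) = norm1 (x - (\<Sum>j<n. step j (a j)))"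
        by (intro eventually_sequentiallyI[of "Suc m"]) simp
    qed
    have Nx: "0 \<le> N x" by (rule N_nonneg[OF x])
    have am: "level_norm s p a m \<le> L * N x"
    proof -
      have "norm (avg x m j) \<le> 2 ^ m * (1 / (1 - 2 powr (- s)) * N x)" for j
        using norm_avg_le[OF V_int[OF x], of m j] mult_left_mono[OF norm1_le_N[OF x], of "2 ^ m"] by simp
      then have "(\<Sum>j<2 ^ m. norm (avg x m j) powr p) / 2 ^ m
          \<le> (\<Sum>j<(2::nat) ^ m. (2 ^ m * (1 / (1 - 2 powr (- s)) * N x)) powr p) / 2 ^ m"
        using p by (intro divide_right_mono sum_mono powr_mono2) auto
      then have "mean_norm p m (avg x m) \<le> 2 ^ m * (1 / (1 - 2 powr (- s)) * N x)"
        using p Nx x2 by (subst mean_norm_le_iff) auto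
      moreover have "a m = avg x m" by (simp add: a_def fun_eq_iff)
      ultimately have "level_norm s p a m \<le> 2 powr (real m * s) * (2 ^ m * (1 / (1 - 2 powr (- s)) * N x))"
        unfolding level_norm_def by (intro mult_left_mono) auto
      then show ?thesis by (simp add: L_def)
    qed
    have level_norm_le: "level_norm s p a k \<le> (if k = m then L * N x else 0) + level_norm s p (mart_diff x) k" for k
    proof -
      consider "k < m" | "k = m" | "m < k" by linarith
      then show ?thesis
      proof cases
        case 1
        then have "level_norm s p a k = 0" using p by (simp add: level_norm_def a_def mean_norm_def)
        then show ?thesis using 1 by simp
      next
        case 2
        then show ?thesis using am level_norm_nonneg[of s p "mart_diff x" m] by (simp add: add_increasing2)
      next
        case 3
        then have "a k = mart_diff x k" by (simp add: a_def fun_eq_iff)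
        then show ?thesis using 3 by (simp add: level_norm_def)
      qed
    qed
    have le: "lq_le q (level_norm s p a) (L * N x + N x)"
      by (rule lq_le_mono[OF lq_le_add[OF lq_le_single[OF _ q] N_bound[OF x]] _ level_norm_le order_refl q])
        (use L Nx q in auto)
    have sm': "mean_norm 1 k (mart_diff (T (ae_ind (dyadic_interval j i))) k) \<le> C * min 1 ((G * 2 powr (real j - real k)) powr \<beta>) / 2 ^ j"
      if "m \<le> j" "i < 2 ^ j" for j i k using sm that unfolding small_on_def by blast
    have a0: "a j i = 0" if "j < m" for j i using that by (simp add: a_def)
    from kernel_estimate[OF T pos p q C G \<eta> sm' V_int[OF x] lim a0 le]
    have "T x \<in> V \<and> N (T x) \<le> D * (L * N x + N x)"
      unfolding D_def by (intro N_le)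
    then show ?thesis by (simp add: algebra_simps)
  qed
  moreover have "0 \<le> D * (L + 1)" using D L by simp
  ultimately show ?thesis by blast
qed

lemma step_in_V: "step m \<alpha> \<in> V"
proof -
  have "ae_ind (dyadic_interval m i) \<in> V" if i: "i < 2 ^ m" for i
  proof -
    have 0: "mart_diff (ae_ind (dyadic_interval m i)) k l = 0" if "m < k" "l < 2 ^ k" for k l
    proof -
      define k' where "k' = k - 1"
      have k': "k = Suc k'" "m \<le> k'" using that by (auto simp: k'_def)
      have "l div 2 < 2 ^ k'" using that by (simp add: k')
      moreover have "l div 2 div 2 ^ (k' - m) = l div 2 ^ (k - m)"
        using k' by (simp add: div_mult2_eq[symmetric] Suc_diff_le)
      ultimately show ?thesis
        using k' that by (simp add: mart_diff_def ae_ind_eq_step[OF i] avg_step_fine)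
    qed
    define x where "x = ae_ind (dyadic_interval m i)"
    define B where "B k = level_norm s p (mart_diff x) k" for k
    have z: "B k = 0" if "m < k" for k
      using 0[OF that] p by (simp add: B_def level_norm_def x_def mean_norm_def)
    \<comment> \<open>Only the levels up to m are nonzero, so the sequence is a finite sum of
      sequences supported on a single level.\<close>
    have "lq_le q (\<lambda>k. \<Sum>i\<in>A. if k = i then B i else 0) (\<Sum>i\<in>A. B i)" if "finite A" for A
      using that
    proof (induction A rule: finite_induct)
      case (insert i A)
      have "lq_le q (\<lambda>k. (if k = i then B i else 0) + (\<Sum>i\<in>A. if k = i then B i else 0)) (B i + (\<Sum>i\<in>A. B i))"
        by (intro lq_le_add lq_le_single insert.IH q) (simp_all add: B_def sum_nonneg)
      then show ?case by (simp only: sum.insert[OF insert.hyps])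
    qed (simp add: lq_le_zero q)
    from this[of "{..m}"] have *: "lq_le q (\<lambda>k. \<Sum>i\<le>m. if k = i then B i else 0) (\<Sum>i\<le>m. B i)" by simp
    have "(\<lambda>k. \<Sum>i\<le>m. if k = i then B i else 0) = level_norm s p (mart_diff x)"
      using z by (auto simp: fun_eq_iff B_def)
    then have "lq_le q (level_norm s p (mart_diff x)) (\<Sum>i\<le>m. B i)" using * by simp
    then show ?thesis using N_le[of x] by (simp add: x_def)
  qed
  then have "cscale (\<alpha> i) (ae_ind (dyadic_interval m i)) \<in> V" if "i < 2 ^ m" for i
    using V_cscale that by blast
  then show ?thesis unfolding step_def using V_sum[of "{..<2 ^ m}" "\<lambda>i. cscale (\<alpha> i) (ae_ind (dyadic_interval m i))"] by simp
qed

lemma bounded_op_besov: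
  assumes T: "L1op T" and pos: "posop M T" and \<eta>: "0 < \<eta>" "\<eta> \<le> s" "\<eta> \<le> \<beta> / p - s"
    and C: "0 \<le> C" and G: "0 < G" and sm: "small_on \<beta> C G m T"
  shows "bounded_op (besov s p q) (besov_norm s p q) T"
proof -
  obtain D where "0 \<le> D" "\<And>x. x \<in> V \<Longrightarrow> T x \<in> V \<and> N (T x) \<le> D * N x"
    using N_op_bounded[OF T pos C G \<eta> sm] by blast
  then show ?thesis using L1opD(1,2)[OF T] by (intro bounded_opI[of T D]) auto
qed

text \<open>The two kernel bounds have different purposes: the one for T says that T is bounded, the
  one for T^n supplies the sharp constant. For |z| > r the operator R = T^n (1 - E), with E the
  conditional expectation at level m, has norm below |z|^n, and T^n E has finite rank.\<close>

lemma ess_radius_le: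
  assumes T: "L1op T" and pos: "posop M T" and \<eta>: "0 < \<eta>" "\<eta> \<le> s" "\<eta> \<le> \<beta> / p - s"
    and C1: "0 \<le> C1" and G1: "0 < G1" and sm1: "small_on \<beta> C1 G1 m1 T"
    and C: "0 \<le> C" and G: "0 < G" and sm: "small_on \<beta> C G m (T ^^ n)"
    and r: "0 < r" and small: "(2 * M ^ n) powr (1 - 1 / p) * C powr (1 / p) * (G powr s * kernel_const \<eta>) < r ^ n"
  shows "ess_radius (besov s p q) (besov_norm s p q) T \<le> ennreal r"
  unfolding ess_radius_def
proof (rule SUP_least)
  define \<rho> where "\<rho> = (2 * M ^ n) powr (1 - 1 / p) * C powr (1 / p) * (G powr s * kernel_const \<eta>)"
  have "(2::real) powr (- \<eta>) < 1" using \<eta> powr_less_mono[of "- \<eta>" 0 "2 :: real"] by simp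
  then have \<rho>: "0 \<le> \<rho>" by (simp add: \<rho>_def kernel_const_def)
  note Tn = L1op_funpow[OF T, of n] and posn = posop_funpow[OF pos, of n]
  obtain D where D: "0 \<le> D" "\<And>x. x \<in> V \<Longrightarrow> T x \<in> V \<and> N (T x) \<le> D * N x"
    using N_op_bounded[OF T pos C1 G1 \<eta> sm1] by blast
  fix z assume z: "z \<in> ess_spectrum (besov s p q) (besov_norm s p q) T"
  show "ennreal (norm z) \<le> ennreal r"
  proof (rule ccontr)
    assume "\<not> ennreal (norm z) \<le> ennreal r"
    then have "\<not> norm z \<le> r" using ennreal_leI by blast
    then have zr: "r < norm z" by simp
    define R where "R x = (T ^^ n) (x - step m (avg x m))" for x
    have R: "R x \<in> V \<and> N (R x) \<le> \<rho> * N x" if "x \<in> V" for x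
      unfolding R_def \<rho>_def by (rule N_high_part[OF Tn posn C G \<eta> sm that])
    have st_add: "step m (avg (x + y) m) = step m (avg x m) + step m (avg y m)" if "x \<in> V" "y \<in> V" for x y
    proof -
      have "avg (x + y) m = (\<lambda>j. avg x m j + avg y m j)" using that V_int by (simp add: fun_eq_iff avg_add)
      then show ?thesis by (simp add: step_add)
    qed
    have st_scale: "step m (avg (cscale c x) m) = cscale c (step m (avg x m))" for c x
      by (simp add: step_def avg_cscale ae.scale_sum_right)
    have lin: "R (x + y) = R x + R y" if "x \<in> V" "y \<in> V" for x y
    proof -
      have "x + y - step m (avg (x + y) m) = (x - step m (avg x m)) + (y - step m (avg y m))"
        using st_add[OF that] by (simp add: algebra_simps)
      then show ?thesis unfolding R_def using L1opD(1)[OF Tn] by metis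
    qed
    have lin2: "R (cscale c x) = cscale c (R x)" for c x
    proof -
      have "cscale c x - step m (avg (cscale c x) m) = cscale c (x - step m (avg x m))"
        by (simp add: st_scale ae.scale_right_diff_distrib)
      then show ?thesis unfolding R_def using L1opD(2)[OF Tn] by metis
    qed
    define B where "B = (\<lambda>i. (T ^^ n) (ae_ind (dyadic_interval m i))) ` {..<2 ^ m}"
    have TnV: "(T ^^ k) x \<in> V" if "x \<in> V" for x k using that D(2) by (induction k) auto
    have indV: "ae_ind (dyadic_interval m i) \<in> V" if "i < 2 ^ m" for i
      unfolding ae_ind_eq_step[OF that] by (rule step_in_V)
    have K: "(T ^^ n) x - R x \<in> ae.span B" for x
    proof -
      have "(T ^^ n) x - R x = (T ^^ n) (step m (avg x m))"
        by (simp add: R_def L1op_diff[OF Tn])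
      also have "\<dots> = (\<Sum>i<2 ^ m. cscale (avg x m i) ((T ^^ n) (ae_ind (dyadic_interval m i))))"
        by (simp add: step_def L1op_sum[OF Tn] L1opD(2)[OF Tn])
      also have "\<dots> \<in> ae.span B"
        by (intro ae.span_sum ae.span_scale ae.span_base) (auto simp: B_def)
      finally show ?thesis .
    qed
    have bd: "bounded_op (besov s p q) (besov_norm s p q) (\<lambda>x. cscale z x - T x)"
    proof (rule bounded_opI[where C = "norm z + D"])
      fix x assume x: "x \<in> V"
      have "N (cscale z x - T x) \<le> N (cscale z x) + N (T x)" using V_diff V_cscale D(2) x by blast
      also have "\<dots> \<le> norm z * N x + D * N x" using V_cscale D(2) x by (intro add_mono) auto
      finally show "cscale z x - T x \<in> V \<and> N (cscale z x - T x) \<le> (norm z + D) * N x"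
        using V_diff V_cscale D(2) x by (simp add: distrib_right)
    next
      show "0 \<le> norm z + D" using D(1) by simp
    qed (simp_all add: L1opD(1,2)[OF T] ae.scale_right_distrib ae.scale_right_diff_distrib mult.commute)
    have "\<rho> < r ^ n" unfolding \<rho>_def by (rule small)
    also have "r ^ n \<le> norm z ^ n" using r zr by (intro power_mono) auto
    finally have \<rho>z: "\<rho> < norm z ^ n" .
    have "fredholm (besov s p q) (besov_norm s p q) (\<lambda>x. cscale z x - T x)"
    proof (rule fredholm_resolvent[OF T _ bd besov_eq R lin lin2, where B = B])
      show "finite B" by (simp add: B_def)
      show "B \<subseteq> V" using TnV indV by (auto simp: B_def)
      show "0 \<le> \<rho>" "\<rho> < norm z ^ n" by fact+
    qed (use D(2) K in auto)
    then show False using z by (simp add: ess_spectrum_def)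
  qed
qed

text \<open>Since T preserves the integral, the range of 1 - T consists of classes of integral 0 and
  misses the constant 1. So 1 - T is not onto.\<close>

lemma spec_radius_ge_1:
  assumes T: "L1op T" and pres: "\<And>x. ae_int x \<Longrightarrow> lint (T x) = lint x"
  shows "1 \<le> spec_radius (besov s p q) (besov_norm s p q) T"
proof -
  have "1 \<in> op_spectrum (besov s p q) (besov_norm s p q) T"
    unfolding op_spectrum_def besov_eq
  proof (intro CollectI notI)
    assume "\<exists>S. bounded_op V (besov_norm s p q) S \<and>
       (\<forall>x\<in>V. S (cscale 1 x - T x) = x \<and> cscale 1 (S x) - T (S x) = x)"
    then obtain S where S: "bounded_op V (besov_norm s p q) S" "\<And>x. x \<in> V \<Longrightarrow> cscale 1 (S x) - T (S x) = x"
      by blast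
    have one: "ae_one \<in> V" using step_in_V[of 0 "\<lambda>_. 1"] by (simp add: step_one)
    then have "S ae_one \<in> V" using S(1) by (auto simp: bounded_op_def)
    then have i: "ae_int (S ae_one)" by (rule V_int)
    have "lint ae_one = lint (S ae_one - T (S ae_one))" using S(2)[OF one] by simp
    also have "\<dots> = 0" using i L1opD(3)[OF T i] by (simp add: lint_diff pres)
    finally have "lint ae_one = 0" .
    moreover have "lint ae_one = 1"
      using avg_one[of 0 0] restr_unit[of ae_one] by (simp add: avg_def dyadic_interval_def)
    ultimately show False by simp
  qed
  then have "ennreal (norm (1::complex)) \<le> spec_radius (besov s p q) (besov_norm s p q) T"
    unfolding spec_radius_def by (rule SUP_upper)
  then show ?thesis by simp
qed

end

section \<open>Transferred indicator functions\<close>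

lemma avg_close:
  assumes i: "integrable unit_leb \<phi>" and j: "j < 2 ^ k" and \<epsilon>: "0 \<le> \<epsilon>"
    and close: "\<And>y. y \<in> dyadic_interval k j \<Longrightarrow> norm (\<phi> y - c) \<le> \<epsilon>"
  shows "norm (avg (abs_aefun \<phi>) k j - c) \<le> \<epsilon>"
proof -
  let ?Q = "dyadic_interval k j"
  define \<psi> where "\<psi> = abs_aefun \<phi> - cscale c ae_one"
  have i\<phi>: "ae_int (abs_aefun \<phi>)" using i by (simp add: ae_int.abs_eq)
  have \<psi>: "\<psi> = abs_aefun (\<lambda>y. \<phi> y - c)"
    by (simp add: \<psi>_def ae_one_def cscale.abs_eq minus_aefun.abs_eq)
  have i\<psi>: "ae_int \<psi>" using i\<phi> by (simp add: \<psi>_def)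
  have "ae_int (restr ?Q \<psi>)" using i\<psi> by simp
  then have int: "integrable unit_leb (\<lambda>y. indicator ?Q y * (\<phi> y - c))"
    by (simp add: \<psi> restr.abs_eq ae_int.abs_eq)
  have "ae_int (ae_ind ?Q)" by simp
  then have int1: "integrable unit_leb (\<lambda>y. indicator ?Q y * (1::complex))"
    by (simp add: ae_ind_def ae_one_def restr.abs_eq ae_int.abs_eq)
  have "avg (abs_aefun \<phi>) k j - c = avg \<psi> k j"
    unfolding \<psi>_def using i\<phi> by (subst avg_diff) (simp_all add: avg_cscale avg_one[OF j])
  also have "norm (avg \<psi> k j) = 2 ^ k * norm (lint (restr ?Q \<psi>))"
    by (simp add: avg_def norm_mult norm_power)
  also have "\<dots> \<le> 2 ^ k * norm1 (restr ?Q \<psi>)"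
    by (intro mult_left_mono norm_lint_le) simp
  also have "norm1 (restr ?Q \<psi>) = (LINT y|unit_leb. norm (indicator ?Q y * (\<phi> y - c)))"
    by (simp add: \<psi> restr.abs_eq norm1.abs_eq)
  also have "\<dots> \<le> (LINT y|unit_leb. \<epsilon> * norm (indicator ?Q y * (1::complex)))"
    using int int1 close \<epsilon> by (intro integral_mono integrable_norm integrable_mult_right) (auto simp: indicator_def)
  also have "\<dots> = \<epsilon> * norm1 (ae_ind ?Q)"
    by (simp only: integral_mult_right_zero ae_ind_def ae_one_def restr.abs_eq norm1.abs_eq)
  also have "norm1 (ae_ind ?Q) = 1 / 2 ^ k"
    using j by (subst norm1_ae_ind) (simp_all only: dyadic_interval_subset measure_dyadic_interval dyadic_interval_sets)
  finally show ?thesis by (simp add: mult_left_mono)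
qed

text \<open>The parent average is within \<epsilon> of every value on the parent cell, in particular
  of every value on the child, hence of the child average. Measuring the oscillation over the parent
  avoids a factor 2.\<close>

lemma mart_diff_Suc_le:
  assumes i: "integrable unit_leb \<phi>" and j: "j < 2 ^ Suc m" and \<epsilon>: "0 \<le> \<epsilon>"
    and osc: "\<And>y y'. y \<in> dyadic_interval m (j div 2) \<Longrightarrow> y' \<in> dyadic_interval m (j div 2) \<Longrightarrow> norm (\<phi> y - \<phi> y') \<le> \<epsilon>"
  shows "norm (mart_diff (abs_aefun \<phi>) (Suc m) j) \<le> \<epsilon>"
proof -
  have j2: "j div 2 < 2 ^ m" using j by simp
  have sub: "dyadic_interval (Suc m) j \<subseteq> dyadic_interval m (j div 2)"
  proof -
    have "j = 2 * (j div 2) \<or> j = Suc (2 * (j div 2))" by presburger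
    then show ?thesis unfolding dyadic_interval_split[OF j2] by fastforce
  qed
  have 1: "norm (avg (abs_aefun \<phi>) m (j div 2) - \<phi> y) \<le> \<epsilon>" if "y \<in> dyadic_interval m (j div 2)" for y
    using osc that by (intro avg_close[OF i j2 \<epsilon>]) auto
  have "norm (avg (abs_aefun \<phi>) (Suc m) j - avg (abs_aefun \<phi>) m (j div 2)) \<le> \<epsilon>"
    using 1 sub by (intro avg_close[OF i j \<epsilon>]) (auto simp: norm_minus_commute)
  then show ?thesis by (simp add: mart_diff_def)
qed

lemma sum_div_2: "(\<Sum>j<2 ^ Suc m. h (j div 2)) = 2 * (\<Sum>i<2 ^ m. h i)" for h :: "nat \<Rightarrow> real"
  by (simp add: sum_double sum_distrib_left)

lemma card_nat_between_le:
  assumes "\<And>i::nat. i \<in> I \<Longrightarrow> u \<le> real i \<and> real i \<le> v" "u \<le> v"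
  shows "real (card I) \<le> v - u + 1"
proof -
  have "int ` I \<subseteq> {\<lceil>u\<rceil>..\<lfloor>v\<rfloor>}"
    using assms(1) by (auto simp: ceiling_le_iff le_floor_iff)
  then have "card (int ` I) \<le> card {\<lceil>u\<rceil>..\<lfloor>v\<rfloor>}" by (intro card_mono) auto
  then have "card I \<le> nat (\<lfloor>v\<rfloor> - \<lceil>u\<rceil> + 1)" by (simp add: card_image)
  also have "real \<dots> \<le> v - u + 1"
    using assms(2) by (cases "0 \<le> \<lfloor>v\<rfloor> - \<lceil>u\<rceil> + 1") (simp, linarith, simp)
  finally show ?thesis by simp
qed

text \<open>The monotone function \<open>w\<close> controls the whole of \<open>1\<^sub>K g\<close>: it is \<open>v\<close> on \<open>K\<close> up to a constant, with
  two jumps at the ends of \<open>K\<close>.\<close>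

lemma control_extend:
  fixes g v :: "real \<Rightarrow> real"
  assumes K: "is_interval K" "z0 \<in> K" and \<beta>: "0 < \<beta>" and A: "0 \<le> A"
    and g: "\<And>y. y \<in> K \<Longrightarrow> 0 \<le> g y \<and> g y \<le> A powr \<beta>"
    and v: "mono_on K v" and osc: "\<And>y y'. y \<in> K \<Longrightarrow> y' \<in> K \<Longrightarrow> \<bar>v y - v y'\<bar> \<le> \<delta>"
    and ctrl: "\<And>y y'. y \<in> K \<Longrightarrow> y' \<in> K \<Longrightarrow> \<bar>g y - g y'\<bar> \<le> \<bar>v y - v y'\<bar> powr \<beta>"
  obtains w where "mono w" "\<And>y. 0 \<le> w y \<and> w y \<le> 2 * A + 2 * \<delta>"
    "\<And>y y'. y \<le> y' \<Longrightarrow> \<bar>indicator K y * g y - indicator K y' * g y'\<bar> \<le> (w y' - w y) powr \<beta>"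
proof -
  have \<delta>: "0 \<le> \<delta>" using osc[OF K(2) K(2)] by simp
  \<comment> \<open>Inside K the values lie between A and A + 2\<delta>, so both jumps, from 0 and
    to 2A + 2\<delta>, are at least A, and A^\<beta> dominates g.\<close>
  define w where "w y = (if y \<in> K then A + \<delta> + (v y - v z0) else if y < z0 then 0 else 2 * A + 2 * \<delta>)" for y
  have mid: "\<bar>v y - v z0\<bar> \<le> \<delta>" if "y \<in> K" for y using osc[OF that K(2)] .
  have conv: "z \<in> K" if "x \<in> K" "y \<in> K" "x \<le> z" "z \<le> y" for x y z
    by (rule mem_is_interval_1_I[OF K(1) that(1) that(2) that(3) that(4)])
  have below: "y < z0" if "y \<notin> K" "y' \<in> K" "y \<le> y'" for y y'
    using conv[of z0 y' y] that K(2) by force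
  have above: "z0 \<le> y'" if "y \<in> K" "y' \<notin> K" "y \<le> y'" for y y'
    using conv[of y z0 y'] that K(2) by force
  have vm: "v y \<le> v y'" if "y \<in> K" "y' \<in> K" "y \<le> y'" for y y'
    using v that by (simp add: mono_on_def)
  have wm: "w y \<le> w y'" if le: "y \<le> y'" for y y'
  proof (cases "y \<in> K")
    case True
    show ?thesis
    proof (cases "y' \<in> K")
      case True
      then show ?thesis using \<open>y \<in> K\<close> vm[of y y'] le by (simp add: w_def)
    next
      case False
      then show ?thesis using \<open>y \<in> K\<close> above[of y y'] le mid[of y] A by (simp add: w_def)
    qed
  next
    case False
    show ?thesis
    proof (cases "y' \<in> K")
      case True
      then show ?thesis using False below[of y y'] le mid[of y'] A by (simp add: w_def)
    next
      case False
      then show ?thesis using \<open>y \<notin> K\<close> le A \<delta> by (simp add: w_def)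
    qed
  qed
  have rng: "0 \<le> w y \<and> w y \<le> 2 * A + 2 * \<delta>" for y
    using mid[of y] A \<delta> by (auto simp: w_def)
  have dom: "\<bar>indicator K y * g y - indicator K y' * g y'\<bar> \<le> (w y' - w y) powr \<beta>" if le: "y \<le> y'" for y y'
  proof (cases "y \<in> K")
    case True
    show ?thesis
    proof (cases "y' \<in> K")
      case True
      then show ?thesis using \<open>y \<in> K\<close> ctrl[of y y'] vm[of y y'] le by (simp add: w_def)
    next
      case False
      then have "A \<le> w y' - w y" using \<open>y \<in> K\<close> above[of y y'] le mid[of y] by (simp add: w_def)
      then have "A powr \<beta> \<le> (w y' - w y) powr \<beta>" using A \<beta> by (intro powr_mono2) auto
      then show ?thesis using g[of y] \<open>y \<in> K\<close> False by simp
    qed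
  next
    case False
    show ?thesis
    proof (cases "y' \<in> K")
      case True
      then have "A \<le> w y' - w y" using False below[of y y'] le mid[of y'] by (simp add: w_def)
      then have "A powr \<beta> \<le> (w y' - w y) powr \<beta>" using A \<beta> by (intro powr_mono2) auto
      then show ?thesis using g[of y'] \<open>y' \<in> K\<close> False by simp
    next
      case False
      then show ?thesis using \<open>y \<notin> K\<close> by simp
    qed
  qed
  show ?thesis using that[of w] wm rng dom by (simp add: mono_def)
qed

text \<open>On K the weight stays between c/2 and 2c, so the L^1 norm is comparable to c |K| and can
  measure the length of K. For cells longer than K the trivial L^1 bound suffices. For shorter ones
  only about |K| 2^k cells matter, each difference is at most the power \<beta> of the oscillation
  of one monotone function, and concavity of that power distributes the total oscillation over the
  cells. The constant depends on neither g nor K, as iteration requires.\<close>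

lemma piece_estimate:
  fixes g v :: "real \<Rightarrow> real" and K :: "real set"
  defines "\<psi> \<equiv> abs_aefun (\<lambda>y. indicator K y * complex_of_real (g y))"
  assumes K: "is_interval K" "K \<subseteq> {0..1}" and \<beta>: "0 < \<beta>" "\<beta> < 1" and lo: "0 < lo"
    and g: "\<And>y. y \<in> K \<Longrightarrow> lo \<le> g y \<and> g y \<le> G" and G: "0 < G"
    and v: "mono_on K v" and osc: "\<And>y y'. y \<in> K \<Longrightarrow> y' \<in> K \<Longrightarrow> \<bar>v y - v y'\<bar> \<le> \<delta>"
    and ctrl: "\<And>y y'. y \<in> K \<Longrightarrow> y' \<in> K \<Longrightarrow> \<bar>g y - g y'\<bar> \<le> \<bar>v y - v y'\<bar> powr \<beta>"
    and \<delta>: "2 * \<delta> powr \<beta> \<le> lo" and \<psi>: "ae_int \<psi>"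
  shows "mean_norm 1 k (mart_diff \<psi> k) \<le> 96 * norm1 \<psi> powr (1 - \<beta>) * (G / 2 ^ k) powr \<beta>"
proof (cases "K = {}")
  case True
  then have "\<psi> = 0" by (simp add: \<psi>_def zero_aefun_def)
  then show ?thesis by (simp add: mean_norm_1)
next
  case False
  then obtain y0 where y0: "y0 \<in> K" by blast
  define c where "c = g y0"
  define \<phi> where "\<phi> = (\<lambda>y. indicator K y * complex_of_real (g y))"
  have \<psi>\<phi>: "\<psi> = abs_aefun \<phi>" by (simp add: \<psi>_def \<phi>_def)
  have i\<phi>: "integrable unit_leb \<phi>" using \<psi> by (simp add: \<psi>\<phi> ae_int.abs_eq)
  have c: "lo \<le> c" "c \<le> G" using g[OF y0] by (auto simp: c_def)
  have c0: "0 < c" using c lo by simp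
  have \<delta>0: "0 \<le> \<delta>" using osc[OF y0 y0] by simp
  have gc: "c / 2 \<le> g y" "g y \<le> 2 * c" if "y \<in> K" for y
  proof -
    have "\<bar>g y - g y0\<bar> \<le> \<bar>v y - v y0\<bar> powr \<beta>" by (rule ctrl[OF that y0])
    also have "\<dots> \<le> \<delta> powr \<beta>" using osc[OF that y0] \<beta> by (intro powr_mono2) auto
    finally have "\<bar>g y - c\<bar> \<le> c / 2" using \<delta> c by (simp add: c_def)
    then show "c / 2 \<le> g y" "g y \<le> 2 * c" using c0 by linarith+
  qed
  \<comment> \<open>Chosen so that A^\<beta> = 2c bounds g. Then \<delta> <= A, and the total
    variation of \<open>w\<close> is at most 4A.\<close>
  define A where "A = (2 * c) powr (1 / \<beta>)"
  have A: "0 \<le> A" "A powr \<beta> = 2 * c" using \<beta> c0 by (auto simp: A_def powr_powr)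
  have \<delta>A: "\<delta> \<le> A"
  proof -
    have "\<delta> powr \<beta> \<le> 2 * c" using \<delta> c c0 by linarith
    then have "(\<delta> powr \<beta>) powr (1 / \<beta>) \<le> A" unfolding A_def using \<beta> by (intro powr_mono2) auto
    then show ?thesis using \<beta> \<delta>0 by (simp add: powr_powr)
  qed
  have gA: "0 \<le> g y \<and> g y \<le> A powr \<beta>" if "y \<in> K" for y
    using gc[OF that] c0 A(2) by simp
  obtain w where w: "mono w" "\<And>y. 0 \<le> w y \<and> w y \<le> 2 * A + 2 * \<delta>"
    "\<And>y y'. y \<le> y' \<Longrightarrow> \<bar>indicator K y * g y - indicator K y' * g y'\<bar> \<le> (w y' - w y) powr \<beta>"
    by (rule control_extend[where K = K and g = g and v = v and \<beta> = \<beta> and A = A and \<delta> = \<delta>])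
      (rule K(1) \<beta>(1) A(1) gA v osc ctrl that y0 | assumption)+
  define a b where "a = Inf K" "b = Sup K"
  have bK: "bdd_below K" "bdd_above K" using bdd_below_mono[OF bdd_below_Icc K(2)] bdd_above_mono[OF bdd_above_Icc K(2)] by auto
  have ab: "a \<le> y" "y \<le> b" if "y \<in> K" for y
    using that bK by (auto simp: a_b_def cInf_lower cSup_upper)
  have ab01: "0 \<le> a" "b \<le> 1" "a \<le> b"
  proof -
    show "0 \<le> a" unfolding a_b_def using False K(2) by (intro cInf_greatest) auto
    show "b \<le> 1" unfolding a_b_def using False K(2) by (intro cSup_least) auto
    show "a \<le> b" using ab[OF y0] by linarith
  qed
  have KL: "K \<in> lmeasurable"
    using K by (intro measurable_convex is_interval_convex) (auto intro: bounded_subset[OF bounded_closed_interval])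
  then have Km: "K \<in> sets lebesgue" by (rule fmeasurableD)
  have mK: "measure lebesgue K = b - a"
  proof -
    have 1: "{a<..<b} \<subseteq> K"
    proof
      fix y assume y: "y \<in> {a<..<b}"
      then have y': "Inf K < y" "y < Sup K" by (simp_all add: a_b_def)
      obtain t where t: "t \<in> K" "t < y" using cInf_lessD[OF False y'(1)] by blast
      obtain u where u: "u \<in> K" "y < u" by (rule less_cSupE[OF y'(2) False])
      show "y \<in> K"
        by (rule mem_is_interval_1_I[OF K(1) t(1) u(1)]) (use t u in simp_all)
    qed
    have 2: "K \<subseteq> {a..b}" using ab by auto
    have "measure lebesgue {a<..<b} \<le> measure lebesgue K"
      using 1 KL by (intro measure_mono_fmeasurable) auto
    moreover have "measure lebesgue K \<le> measure lebesgue {a..b}"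
      using 2 Km by (intro measure_mono_fmeasurable) auto
    ultimately show ?thesis using ab01 by simp
  qed
  define l where "l = norm1 \<psi>"
  have l: "c / 2 * (b - a) \<le> l" "l \<le> 2 * c * (b - a)"
  proof -
    have lI: "l = (LINT y|unit_leb. norm (\<phi> y))" by (simp add: l_def \<psi>\<phi> norm1.abs_eq)
    have "ae_int (ae_ind K)" using Km by simp
    then have iK: "integrable unit_leb (\<lambda>y. indicator K y * (1::complex))"
      by (simp add: ae_ind_def ae_one_def restr.abs_eq ae_int.abs_eq)
    have nK: "(LINT y|unit_leb. norm (indicator K y * (1::complex))) = b - a"
      using norm1_ae_ind[OF Km K(2)] unfolding mK by (simp add: ae_ind_def ae_one_def restr.abs_eq norm1.abs_eq)
    have pt: "c / 2 * norm (indicator K y * (1::complex)) \<le> norm (\<phi> y)"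
      "norm (\<phi> y) \<le> 2 * c * norm (indicator K y * (1::complex))" for y
      using gc[of y] c0 by (auto simp: \<phi>_def indicator_def)
    have "(LINT y|unit_leb. c / 2 * norm (indicator K y * (1::complex))) \<le> l"
      unfolding lI using iK i\<phi> pt by (intro integral_mono integrable_mult_right integrable_norm)
    then show "c / 2 * (b - a) \<le> l" by (simp only: integral_mult_right_zero nK)
    have "l \<le> (LINT y|unit_leb. 2 * c * norm (indicator K y * (1::complex)))"
      unfolding lI using iK i\<phi> pt by (intro integral_mono integrable_mult_right integrable_norm)
    then show "l \<le> 2 * c * (b - a)" by (simp only: integral_mult_right_zero nK)
  qed
  have l0: "0 \<le> l" by (simp add: l_def)
  have four: "x powr \<beta> \<le> x" if "1 \<le> x" for x :: real
    using powr_mono[of \<beta> 1 x] \<beta> that by simp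
  have main: "mean_norm 1 k (mart_diff \<psi> k) \<le> 96 * l powr (1 - \<beta>) * (c / 2 ^ k) powr \<beta>"
  \<comment> \<open>Level 0 goes together with the case of a parent cell longer than K: in both, the
    L^1 norm is at most 4c / 2^k.\<close>
  proof (cases "\<exists>m. k = Suc m \<and> 1 \<le> 2 ^ m * (b - a)")
    case False
    have "l \<le> 4 * (c / 2 ^ k)"
    proof (cases k)
      case 0
      have "2 * c * (b - a) \<le> 2 * c * 1" using ab01 c0 by (intro mult_left_mono) auto
      then have "l \<le> 2 * c" using l(2) by linarith
      then show ?thesis using 0 c0 by simp
    next
      case (Suc m)
      then have "2 ^ m * (b - a) \<le> 1" using False by auto
      then have "b - a \<le> 1 / 2 ^ m" by (simp add: field_simps)
      then have "2 * c * (b - a) \<le> 2 * c * (1 / 2 ^ m)" using c0 by (intro mult_left_mono) auto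
      then show ?thesis using l(2) Suc by simp
    qed
    then have "l powr \<beta> \<le> (4 * (c / 2 ^ k)) powr \<beta>" using l0 \<beta> by (intro powr_mono2) auto
    also have "\<dots> = 4 powr \<beta> * (c / 2 ^ k) powr \<beta>" by (rule powr_mult)
    also have "\<dots> \<le> 4 * (c / 2 ^ k) powr \<beta>" using four[of 4] by (intro mult_right_mono) auto
    finally have lb: "l powr \<beta> \<le> 4 * (c / 2 ^ k) powr \<beta>" .
    have "mean_norm 1 k (mart_diff \<psi> k) \<le> 2 * l" using sum_mart_diff_le[OF \<psi>, of k] by (simp add: mean_norm_1 l_def)
    also have "l = l powr (1 - \<beta>) * l powr \<beta>" using l0 by (simp flip: powr_add)
    also have "2 * (l powr (1 - \<beta>) * l powr \<beta>) \<le> 2 * (l powr (1 - \<beta>) * (4 * (c / 2 ^ k) powr \<beta>))"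
      using lb by (intro mult_left_mono) auto
    also have "\<dots> \<le> 96 * l powr (1 - \<beta>) * (c / 2 ^ k) powr \<beta>" by simp
    finally show ?thesis .
  next
    case True
    then obtain m where m: "k = Suc m" "1 \<le> 2 ^ m * (b - a)" by blast
    define M where "M = (2::real) ^ m"
    have M: "0 < M" "1 \<le> M * (b - a)" using m by (auto simp: M_def)
    define os where "os i = w (real (Suc i) / M) - w (real i / M)" for i
    have os0: "0 \<le> os i" for i
      using w(1) M unfolding os_def by (simp add: monoD divide_right_mono)
    define I where "I = {i. i < 2 ^ m \<and> {real i / M..real (Suc i) / M} \<inter> K \<noteq> {}}"
    have finI: "finite I" by (simp add: I_def)
    have dl: "norm (mart_diff \<psi> k j) \<le> (if j div 2 \<in> I then os (j div 2) powr \<beta> else 0)" if j: "j < 2 ^ k" for j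
    proof -
      let ?i = "j div 2"
      have i: "?i < 2 ^ m" using j by (simp add: m)
      have b1: "real (Suc ?i) / M = 1" if "Suc ?i = 2 ^ m"
        using arg_cong[OF that, of real] M by (simp add: M_def)
      have sub: "dyadic_interval m ?i \<subseteq> {real ?i / M..real (Suc ?i) / M}"
        using b1 unfolding dyadic_interval_def M_def[symmetric] by (auto split: if_splits simp del: of_nat_Suc)
      show ?thesis
      proof (cases "?i \<in> I")
        case True
        have "norm (mart_diff (abs_aefun \<phi>) (Suc m) j) \<le> os ?i powr \<beta>"
        proof (rule mart_diff_Suc_le[OF i\<phi>])
          have le: "\<bar>indicator K y * g y - indicator K y' * g y'\<bar> \<le> os ?i powr \<beta>"
            if "y \<le> y'" "real ?i / M \<le> y" "y' \<le> real (Suc ?i) / M" for y y'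
          proof -
            have "w y' - w y \<le> os ?i" unfolding os_def
              using monoD[OF w(1) that(2)] monoD[OF w(1) that(3)] by linarith
            moreover have "0 \<le> w y' - w y" using monoD[OF w(1) that(1)] by simp
            ultimately have "(w y' - w y) powr \<beta> \<le> os ?i powr \<beta>" using \<beta> by (intro powr_mono2) auto
            then show ?thesis using w(3)[OF that(1)] by linarith
          qed
          fix y y' assume yy: "y \<in> dyadic_interval m ?i" "y' \<in> dyadic_interval m ?i"
          have e: "norm (\<phi> y - \<phi> y') = \<bar>indicator K y * g y - indicator K y' * g y'\<bar>"
          proof -
            have "\<phi> y - \<phi> y' = complex_of_real (indicator K y * g y - indicator K y' * g y')"
              by (simp add: \<phi>_def indicator_def)
            then show ?thesis by (simp only: norm_of_real)
          qed
          show "norm (\<phi> y - \<phi> y') \<le> os ?i powr \<beta>"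
          proof -
            note mem = subsetD[OF sub yy(1), unfolded atLeastAtMost_iff] subsetD[OF sub yy(2), unfolded atLeastAtMost_iff]
            show ?thesis
            proof (cases "y \<le> y'")
              case True
              then show ?thesis unfolding e using mem by (intro le) auto
            next
              case False
              then have "\<bar>indicator K y' * g y' - indicator K y * g y\<bar> \<le> os ?i powr \<beta>"
                using mem by (intro le) auto
              then show ?thesis unfolding e by (simp only: abs_minus_commute)
            qed
          qed
        qed (use j m in auto)
        then show ?thesis using True by (simp add: \<psi>\<phi> m)
      next
        case False
        then have z: "\<phi> y = 0" if "y \<in> dyadic_interval m ?i" for y
          using that sub i by (auto simp: I_def \<phi>_def indicator_def)
        have "norm (mart_diff (abs_aefun \<phi>) (Suc m) j) \<le> 0"
          using j m z by (intro mart_diff_Suc_le[OF i\<phi>]) auto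
        then show ?thesis using False by (simp add: \<psi>\<phi> m)
      qed
    qed
    have "mean_norm 1 k (mart_diff \<psi> k) \<le> (\<Sum>j<2 ^ k. (if j div 2 \<in> I then os (j div 2) powr \<beta> else 0)) / 2 ^ k"
      unfolding mean_norm_1 using dl by (intro divide_right_mono sum_mono) auto
    also have "\<dots> = (\<Sum>i<2 ^ m. (if i \<in> I then os i powr \<beta> else 0)) / M"
      unfolding m(1) sum_div_2[of "\<lambda>i. if i \<in> I then os i powr \<beta> else 0"] by (simp add: M_def)
    also have "(\<Sum>i<2 ^ m. (if i \<in> I then os i powr \<beta> else 0)) = (\<Sum>i\<in>I. os i powr \<beta>)"
      by (subst sum.inter_restrict[symmetric]) (auto simp: I_def intro!: sum.cong)
    \<comment> \<open>At most M (b - a) + 2 closed cells meet K, and M (b - a) >= 1 turns this into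
      3M (b - a).\<close>
    also have "(\<Sum>i\<in>I. os i powr \<beta>) / M \<le> ((3 * M * (b - a)) powr (1 - \<beta>) * (4 * A) powr \<beta>) / M"
    proof (intro divide_right_mono sum_powr_le_card[OF finI])
      have "M * a - 1 \<le> real i \<and> real i \<le> M * b" if i: "i \<in> I" for i
      proof -
        obtain y where y: "y \<in> K" "real i / M \<le> y" "y \<le> real (Suc i) / M" using i by (auto simp: I_def)
        have "real i \<le> M * y" "M * y \<le> real i + 1" using y M by (auto simp: field_simps)
        moreover have "M * a \<le> M * y" "M * y \<le> M * b" using ab[OF y(1)] M by auto
        ultimately show ?thesis by linarith
      qed
      moreover have "M * a - 1 \<le> M * b" using mult_left_mono[OF ab01(3), of M] M by linarith
      ultimately have "real (card I) \<le> M * b - (M * a - 1) + 1" by (rule card_nat_between_le)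
      then show "real (card I) \<le> 3 * M * (b - a)" using M(2) by (simp add: algebra_simps)
      have "(\<Sum>i\<in>I. os i) \<le> (\<Sum>i<2 ^ m. os i)"
        using os0 by (intro sum_mono2) (auto simp: I_def)
      also have "\<dots> = w (real (2 ^ m) / M) - w (real 0 / M)"
        unfolding os_def by (rule sum_lessThan_telescope)
      also have "\<dots> \<le> 4 * A" using w(2)[of "real (2 ^ m) / M"] w(2)[of "real 0 / M"] \<delta>A by linarith
      finally show "(\<Sum>i\<in>I. os i) \<le> 4 * A" .
    qed (use os0 \<beta> M in auto)
    also have "\<dots> \<le> ((6 * (M * (l / c))) powr (1 - \<beta>) * (8 * c)) / M"
    proof (intro divide_right_mono mult_mono)
      have "c * (b - a) \<le> 2 * l" using l(1) by simp
      then have "b - a \<le> 2 * l / c" using c0 by (simp add: field_simps)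
      then have "3 * M * (b - a) \<le> 3 * M * (2 * l / c)" using M by (intro mult_left_mono) auto
      then show "(3 * M * (b - a)) powr (1 - \<beta>) \<le> (6 * (M * (l / c))) powr (1 - \<beta>)"
        using \<beta> M ab01 by (intro powr_mono2) (auto simp: mult_ac)
      have "(4 * A) powr \<beta> = 4 powr \<beta> * (2 * c)" using A by (simp add: powr_mult)
      also have "\<dots> \<le> 4 * (2 * c)" using four[of 4] c0 by (intro mult_right_mono) auto
      finally show "(4 * A) powr \<beta> \<le> 8 * c" by simp
    qed (use M in auto)
    also have "\<dots> = 6 powr (1 - \<beta>) * l powr (1 - \<beta>) * (8 * (c powr \<beta> * M powr (- \<beta>)))"
    proof -
      have "(6 * (M * (l / c))) powr (1 - \<beta>) = 6 powr (1 - \<beta>) * (M powr (1 - \<beta>) * (l powr (1 - \<beta>) / c powr (1 - \<beta>)))"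
        using M c0 l0 by (simp add: powr_mult powr_divide)
      then have "((6 * (M * (l / c))) powr (1 - \<beta>) * (8 * c)) / M
          = 6 powr (1 - \<beta>) * l powr (1 - \<beta>) * (8 * ((c / c powr (1 - \<beta>)) * (M powr (1 - \<beta>) / M)))"
        by (simp add: mult_ac)
      moreover have "c / c powr (1 - \<beta>) = c powr \<beta>" "M powr (1 - \<beta>) / M = M powr (- \<beta>)"
        using c0 M by (simp_all add: powr_diff powr_minus_divide field_simps)
      ultimately show ?thesis by (simp only:)
    qed
    also have "M powr (- \<beta>) = 2 powr \<beta> * (1 / 2 ^ k) powr \<beta>"
      using M by (simp add: m M_def powr_minus_divide powr_divide powr_mult)
    also have "6 powr (1 - \<beta>) * l powr (1 - \<beta>) * (8 * (c powr \<beta> * (2 powr \<beta> * (1 / 2 ^ k) powr \<beta>)))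
        = (6 powr (1 - \<beta>) * 2 powr \<beta> * 8) * (l powr (1 - \<beta>) * (c / 2 ^ k) powr \<beta>)"
      using c0 by (simp add: powr_divide mult_ac)
    \<comment> \<open>The origin of 96: 6 comes from counting the cells through the L^1 norm, 2 from
      the parent level m = k - 1, and 8 from 4^\<beta> times 2c.\<close>
    also have "\<dots> \<le> (6 * 2 * 8) * (l powr (1 - \<beta>) * (c / 2 ^ k) powr \<beta>)"
    proof (intro mult_right_mono mult_mono)
      show "(6::real) powr (1 - \<beta>) \<le> 6" using powr_mono[of "1 - \<beta>" 1 "6 :: real"] \<beta> by simp
      show "(2::real) powr \<beta> \<le> 2" using four[of 2] by simp
    qed auto
    finally show ?thesis by simp
  qed
  also have "\<dots> \<le> 96 * l powr (1 - \<beta>) * (G / 2 ^ k) powr \<beta>"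
    using c c0 \<beta> by (intro mult_left_mono powr_mono2 divide_right_mono) auto
  finally show ?thesis by (simp add: l_def)
qed

section \<open>Functions of finite variation and Lipschitz functions\<close>

text \<open>The inf-convolution of a with the pseudometric d. It serves once with a multiple of the
  distance, for the inverse branches, and once with |u x - u y|^\<beta>, for the Jacobian; both have
  to be extended to the whole line.\<close>

lemma mcshane_extension:
  fixes a :: "'a \<Rightarrow> real" and d :: "'a \<Rightarrow> 'a \<Rightarrow> real"
  assumes D: "D \<noteq> {}" and d: "\<And>x y. d x y = d y x" "\<And>x y z. d x z \<le> d x y + d y z" "\<And>x. d x x = 0"
    and a: "\<And>x y. x \<in> D \<Longrightarrow> y \<in> D \<Longrightarrow> \<bar>a x - a y\<bar> \<le> d x y"
  obtains e where "\<And>x. x \<in> D \<Longrightarrow> e x = a x" "\<And>x y. \<bar>e x - e y\<bar> \<le> d x y"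
proof -
  define e where "e x = (INF z\<in>D. a z + d x z)" for x
  obtain z0 where z0: "z0 \<in> D" using D by blast
  have bdd: "bdd_below ((\<lambda>z. a z + d x z) ` D)" for x
  proof (rule bdd_belowI2)
    fix z assume z: "z \<in> D"
    have "a z0 - a z \<le> d z0 z" using a[OF z0 z] by linarith
    also have "\<dots> \<le> d z0 x + d x z" by (rule d(2))
    finally show "a z0 - d z0 x \<le> a z + d x z" by simp
  qed
  have le: "e x \<le> e y + d x y" for x y
  proof -
    have "e x - d x y \<le> a z + d y z" if z: "z \<in> D" for z
    proof -
      have "e x \<le> a z + d x z" unfolding e_def by (rule cINF_lower[OF bdd z])
      also have "\<dots> \<le> a z + (d x y + d y z)" using d(2)[of x z y] by simp
      finally show ?thesis by simp
    qed
    then have "e x - d x y \<le> e y" unfolding e_def[of y] by (rule cINF_greatest[OF D])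
    then show ?thesis by simp
  qed
  have 1: "e x = a x" if x: "x \<in> D" for x
  proof (rule antisym)
    show "e x \<le> a x" unfolding e_def using cINF_lower[OF bdd x, of x] d(3) by simp
    show "a x \<le> e x" unfolding e_def
    proof (rule cINF_greatest[OF D])
      fix z assume "z \<in> D"
      then show "a x \<le> a z + d x z" using a[OF x, of z] by simp
    qed
  qed
  have 2: "\<bar>e x - e y\<bar> \<le> d x y" for x y using le[of x y] le[of y x] d(1)[of x y] by linarith
  show ?thesis using that[of e] 1 2 by blast
qed

text \<open>The function \<open>\<phi>(x) = H(x) + (C + 1) x\<close> is bi-Lipschitz and increasing, so that
  \<open>A \<mapsto> |\<phi>(A)|\<close> is an absolutely continuous measure whose density is the derivative of \<open>\<phi>\<close>.\<close>

lemma lipschitz_AE_differentiable: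
  fixes H :: "real \<Rightarrow> real"
  assumes C: "0 \<le> C" and lip: "\<And>x y. \<bar>H x - H y\<bar> \<le> C * \<bar>x - y\<bar>"
  obtains N where "negligible N" "\<And>x. x \<notin> N \<Longrightarrow> H differentiable (at x)"
proof -
  define \<phi> where "\<phi> x = H x + (C + 1) * x" for x
  have up: "y - x \<le> \<phi> y - \<phi> x" "\<phi> y - \<phi> x \<le> (2 * C + 1) * (y - x)" if "x \<le> y" for x y
  proof -
    have "\<bar>H y - H x\<bar> \<le> C * (y - x)" using lip[of y x] that by simp
    moreover have "\<phi> y - \<phi> x = (H y - H x) + C * (y - x) + (y - x)" by (simp add: \<phi>_def algebra_simps)
    ultimately show "y - x \<le> \<phi> y - \<phi> x" "\<phi> y - \<phi> x \<le> (2 * C + 1) * (y - x)"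
      by (simp_all add: algebra_simps)
  qed
  have mono: "\<phi> x \<le> \<phi> y \<longleftrightarrow> x \<le> y" for x y
    using up(1)[of x y] up(1)[of y x] by (cases "x \<le> y") auto
  have lip\<phi>: "\<bar>\<phi> y - \<phi> x\<bar> \<le> (2 * C + 1) * \<bar>y - x\<bar>" for x y
    using up[of x y] up[of y x] by (cases "x \<le> y") (auto simp: abs_minus_commute)
  have cont: "continuous_on UNIV \<phi>"
  proof (rule continuous_on_subset[OF lipschitz_on_continuous_on subset_UNIV])
    show "(2 * C + 1)-lipschitz_on UNIV \<phi>"
      using lip\<phi> C by (intro lipschitz_onI) (auto simp: dist_real_def abs_minus_commute)
  qed
  have surj: "\<exists>x. \<phi> x = y" for y
  proof -
    define r where "r = \<bar>y - \<phi> 0\<bar>"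
    have "\<phi> (- r) \<le> y" "y \<le> \<phi> r" using up(1)[of 0 r] up(1)[of "- r" 0] by (auto simp: r_def)
    moreover have "- r \<le> r" by (simp add: r_def)
    ultimately show ?thesis
      using IVT'[of \<phi> "- r" y r] continuous_on_subset[OF cont] by blast
  qed
  have inj: "inj \<phi>"
  proof (rule injI)
    fix x y assume "\<phi> x = \<phi> y"
    then show "x = y" using mono[of x y] mono[of y x] by simp
  qed
  define \<psi> where "\<psi> = inv \<phi>"
  have \<psi>1: "\<psi> (\<phi> x) = x" for x by (simp add: \<psi>_def inv_f_f[OF inj])
  have \<psi>2: "\<phi> (\<psi> y) = y" for y
  proof -
    obtain x where "y = \<phi> x" using surj[of y] by blast
    then show ?thesis by (simp add: \<psi>1)
  qed
  have "mono \<psi>"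
  proof (rule monoI)
    fix x y :: real assume "x \<le> y"
    then show "\<psi> x \<le> \<psi> y" using mono[of "\<psi> x" "\<psi> y"] by (simp add: \<psi>2)
  qed
  then have m\<psi>: "\<psi> \<in> borel_measurable borel" by (rule borel_measurable_mono)
  have vim: "\<psi> -` A = \<phi> ` A" for A
  proof
    show "\<psi> -` A \<subseteq> \<phi> ` A"
    proof
      fix x assume "x \<in> \<psi> -` A"
      then show "x \<in> \<phi> ` A" using \<psi>2[of x] by (intro image_eqI[of _ _ "\<psi> x"]) auto
    qed
  qed (auto simp: \<psi>1)
  \<comment> \<open>As a push-forward under the inverse of \<phi> this is a measure by construction,
    and it assigns to A the length of \<phi>(A).\<close>
  define \<nu> where "\<nu> = distr lborel borel \<psi>"
  have \<nu>: "emeasure \<nu> A = emeasure lborel (\<phi> ` A)" if "A \<in> sets borel" for A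
    using that m\<psi> by (simp add: \<nu>_def emeasure_distr vim)
  have ac: "absolutely_continuous lborel \<nu>"
    unfolding absolutely_continuous_def
  proof
    fix A :: "real set" assume A: "A \<in> null_sets lborel"
    then have sA: "A \<in> sets borel" by auto
    have "negligible A" using A by (simp add: negligible_iff_null_sets null_sets_completionI)
    then have "negligible (\<phi> ` A)"
    proof (rule negligible_locally_Lipschitz_image[OF order_refl])
      show "\<exists>T B. open T \<and> x \<in> T \<and> (\<forall>y\<in>A \<inter> T. norm (\<phi> y - \<phi> x) \<le> B * norm (y - x))" for x
        using lip\<phi> by (intro exI[of _ UNIV] exI[of _ "2 * C + 1"]) auto
    qed
    moreover have "\<phi> ` A \<in> sets lborel"
      using measurable_sets[OF m\<psi> sA] by (simp add: vim)
    ultimately have "\<phi> ` A \<in> null_sets lborel"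
      by (simp add: negligible_iff_null_sets null_sets_completion_iff)
    then show "A \<in> null_sets \<nu>" using \<nu>[OF sA] sA by (auto simp: null_sets_def \<nu>_def)
  qed
  have "sets \<nu> = sets lborel" by (simp add: \<nu>_def)
  from sigma_finite_measure.Radon_Nikodym[OF sigma_finite_lborel ac this] obtain g where g: "g \<in> borel_measurable lborel" "density lborel g = \<nu>"
    by blast
  \<comment> \<open>The density integrates to the increments of \<phi>, so its Lebesgue points are
    points of differentiability of \<phi>.\<close>
  have hi: "((\<lambda>x. enn2real (g x)) has_integral (\<phi> b - \<phi> a)) {a..b}" if ab: "a \<le> b" for a b
  proof -
    have im: "\<phi> ` {a..b} = {\<phi> a..\<phi> b}"
      unfolding vim[symmetric] using mono[of _ "\<psi> _"] mono[of "\<psi> _"] by (auto simp: \<psi>2)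
    have "(\<integral>\<^sup>+x. g x * indicator {a..b} x \<partial>lborel) = emeasure \<nu> {a..b}"
      using g by (simp add: emeasure_density flip: g(2))
    also have "\<dots> = ennreal (\<phi> b - \<phi> a)" using ab mono by (simp add: \<nu> im)
    finally have I: "(\<integral>\<^sup>+x. g x * indicator {a..b} x \<partial>lborel) = ennreal (\<phi> b - \<phi> a)" .
    then have "AE x in lborel. g x * indicator {a..b} x \<noteq> \<infinity>"
      using g(1) by (intro nn_integral_PInf_AE) auto
    then have "(\<integral>\<^sup>+x. ennreal (enn2real (g x) * indicator {a..b} x) \<partial>lborel) = (\<integral>\<^sup>+x. g x * indicator {a..b} x \<partial>lborel)"
      by (intro nn_integral_cong_AE, eventually_elim) (auto simp: indicator_def top.not_eq_extremum)
    then have "(\<integral>\<^sup>+x. ennreal (enn2real (g x) * indicator {a..b} x) \<partial>lborel) = ennreal (\<phi> b - \<phi> a)"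
      using I by simp
    then have "((\<lambda>x. enn2real (g x) * indicator {a..b} x) has_integral (\<phi> b - \<phi> a)) UNIV"
      using g(1) mono[of a b] ab by (intro nn_integral_has_integral) auto
    then have "((\<lambda>x. if x \<in> {a..b} then enn2real (g x) else 0) has_integral (\<phi> b - \<phi> a)) UNIV"
      by (rule has_integral_eq[rotated]) (simp add: indicator_def)
    then show ?thesis by (simp only: has_integral_restrict_UNIV)
  qed
  have int: "(\<lambda>x. enn2real (g x)) integrable_on {a..b}" for a b
    using hi[of a b] by (cases "a \<le> b") (auto simp: integrable_on_def)
  obtain N where N: "negligible N"
    "\<And>x e. x \<notin> N \<Longrightarrow> 0 < e \<Longrightarrow> \<exists>d>0. \<forall>a b. a \<le> x \<and> x \<le> b \<and> b - a < d \<longrightarrow>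
       norm (integral {a..b} (\<lambda>x. enn2real (g x)) - (b - a) *\<^sub>R enn2real (g x)) \<le> e * (b - a)"
    using lebesgue_differentiation[OF int] by blast
  have "H differentiable (at x)" if x: "x \<notin> N" for x
  proof -
    have "(\<phi> has_derivative (\<lambda>h. h * enn2real (g x))) (at x)"
      unfolding has_derivative_at_alt
    proof (intro conjI allI impI)
      show "bounded_linear (\<lambda>h. h * enn2real (g x))" by (rule bounded_linear_mult_left)
      fix e :: real assume "0 < e"
      from N(2)[OF x this] obtain d where d: "d > 0" "\<And>a b. a \<le> x \<Longrightarrow> x \<le> b \<Longrightarrow> b - a < d \<Longrightarrow>
         norm (integral {a..b} (\<lambda>x. enn2real (g x)) - (b - a) *\<^sub>R enn2real (g x)) \<le> e * (b - a)" by blast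
      have "norm (\<phi> y - \<phi> x - (y - x) * enn2real (g x)) \<le> e * norm (y - x)" if y: "norm (y - x) < d" for y
      proof (cases "x \<le> y")
        case True
        then show ?thesis using d(2)[of x y] y integral_unique[OF hi[of x y]] by simp
      next
        case False
        then have "norm (\<phi> x - \<phi> y - (x - y) * enn2real (g x)) \<le> e * (x - y)"
          using d(2)[of y x] y integral_unique[OF hi[of y x]] by simp
        moreover have "\<phi> y - \<phi> x - (y - x) * enn2real (g x) = - (\<phi> x - \<phi> y - (x - y) * enn2real (g x))"
          by (simp add: algebra_simps)
        ultimately show ?thesis using False by (simp only: norm_minus_cancel) simp
      qed
      then show "\<exists>d>0. \<forall>y. norm (y - x) < d \<longrightarrow> norm (\<phi> y - \<phi> x - (y - x) * enn2real (g x)) \<le> e * norm (y - x)"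
        using d(1) by blast
    qed
    then have "((\<lambda>y. \<phi> y - (C + 1) * y) has_derivative (\<lambda>h. h * enn2real (g x) - (C + 1) * h)) (at x)"
      by (intro derivative_intros)
    then show ?thesis by (auto simp: \<phi>_def differentiable_def)
  qed
  then show ?thesis using that N(1) by blast
qed

text \<open>v t is the supremum of the 1/r-variation sums over finite chains in D that end at or
  before t. A chain up to x, with x appended if necessary, can be continued by y, which raises the
  sum by |a y - a x|^(1/r); hence v grows by at least this amount from x to y.\<close>

lemma finite_variation_control:
  assumes fv: "finite_variation_on r a D" and r: "0 < r"
  obtains v B where "mono v" "\<And>t. 0 \<le> v t \<and> v t \<le> B"
    "\<And>x y. x \<in> D \<Longrightarrow> y \<in> D \<Longrightarrow> x < y \<Longrightarrow> \<bar>a x - a y\<bar> \<le> (v y - v x) powr r"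
proof -
  define var where "var X n = (\<Sum>k<n. \<bar>a (X (Suc k)) - a (X k)\<bar> powr (1 / r))" for X n
  define good where "good X n t \<longleftrightarrow> (\<forall>k\<le>n. X k \<in> D) \<and> (\<forall>k<n. X k < X (Suc k)) \<and> X n \<le> t" for X n and t :: real
  obtain B0 where B0: "var X n powr r \<le> B0" if "\<forall>k\<le>n. X k \<in> D" "\<forall>k<n. X k < X (Suc k)" for X n
    using fv unfolding finite_variation_on_def var_def bdd_above_def by blast
  define B where "B = (max 0 B0) powr (1 / r)"
  have var0: "0 \<le> var X n" for X n unfolding var_def by (intro sum_nonneg) simp
  have bd: "var X n \<le> B" if "good X n t" for X n t
  proof -
    have "var X n powr r \<le> max 0 B0" using B0[of n X] that by (simp add: good_def le_max_iff_disj)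
    then have "(var X n powr r) powr (1 / r) \<le> B" unfolding B_def using r by (intro powr_mono2) auto
    then show ?thesis using r var0 by (simp add: powr_powr)
  qed
  \<comment> \<open>The 0 covers those t that have no point of D at or below them, where no chain
    exists.\<close>
  define S where "S t = insert 0 {var X n | X n. good X n t}" for t
  have S_bdd: "bdd_above (S t)" for t
    using bd by (intro bdd_aboveI[of _ B]) (auto simp: S_def B_def)
  define v where "v t = Sup (S t)" for t
  have v0: "0 \<le> v t" for t unfolding v_def by (rule cSup_upper[OF _ S_bdd]) (simp add: S_def)
  have vB: "v t \<le> B" for t unfolding v_def by (rule cSup_least) (use bd in \<open>auto simp: S_def B_def\<close>)
  have mono: "mono v"
  proof (rule monoI)
    fix t u :: real assume "t \<le> u"
    then have "good X n u" if "good X n t" for X n using that by (simp add: good_def)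
    then have "S t \<subseteq> S u" unfolding S_def by blast
    then show "v t \<le> v u" unfolding v_def by (intro cSup_subset_mono S_bdd) (auto simp: S_def)
  qed
  have app: "good (\<lambda>k. if k \<le> n then X k else y) (Suc n) y \<and>
      var (\<lambda>k. if k \<le> n then X k else y) (Suc n) = var X n + \<bar>a y - a (X n)\<bar> powr (1 / r)"
    if "good X n t" "X n < y" "y \<in> D" for X n t y
  proof
    show "good (\<lambda>k. if k \<le> n then X k else y) (Suc n) y"
      using that by (auto simp: good_def le_Suc_eq less_Suc_eq)
    have "var (\<lambda>k. if k \<le> n then X k else y) n = var X n"
      unfolding var_def by (intro sum.cong) auto
    then show "var (\<lambda>k. if k \<le> n then X k else y) (Suc n) = var X n + \<bar>a y - a (X n)\<bar> powr (1 / r)"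
      by (simp add: var_def)
  qed
  have gap: "\<bar>a x - a y\<bar> \<le> (v y - v x) powr r" if x: "x \<in> D" and y: "y \<in> D" and xy: "x < y" for x y
  proof -
    define \<Delta> where "\<Delta> = \<bar>a y - a x\<bar> powr (1 / r)"
    have up: "w \<le> v y" if "w \<in> S y" for w unfolding v_def by (rule cSup_upper[OF that S_bdd])
    have ends: "var X n + \<Delta> \<le> v y" if "good X n x" "X n = x" for X n
    proof -
      have "X n < y" using that(2) xy by simp
      note ap = app[OF that(1) this y]
      then have "var (\<lambda>k. if k \<le> n then X k else y) (Suc n) \<in> S y" unfolding S_def by blast
      from up[OF this] show ?thesis using ap that(2) by (simp add: \<Delta>_def)
    qed
    have "w \<le> v y - \<Delta>" if w: "w \<in> S x" for w
    proof -
      consider "w = 0" | X n where "w = var X n" "good X n x" using w by (auto simp: S_def)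
      then show ?thesis
      proof cases
        case 1
        have "good (\<lambda>_. x) 0 x" using x by (simp add: good_def)
        then show ?thesis using ends[of "\<lambda>_. x" 0] 1 by (simp add: var_def)
      next
        case (2 X n)
        show ?thesis
        proof (cases "X n = x")
          case True
          then show ?thesis using ends[OF 2(2)] 2(1) by simp
        next
          case False
          then have "X n < x" using 2(2) by (simp add: good_def)
          note ap = app[OF 2(2) this x]
          have "var X n \<le> var (\<lambda>k. if k \<le> n then X k else x) (Suc n)" using ap by simp
          moreover have "var (\<lambda>k. if k \<le> n then X k else x) (Suc n) + \<Delta> \<le> v y"
            using ap by (intro ends) auto
          ultimately show ?thesis using 2(1) by simp
        qed
      qed
    qed
    then have "v x \<le> v y - \<Delta>" unfolding v_def[of x] by (intro cSup_least) (auto simp: S_def)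
    then have "\<Delta> powr r \<le> (v y - v x) powr r" using r by (intro powr_mono2) (auto simp: \<Delta>_def)
    then show ?thesis using r by (simp add: \<Delta>_def powr_powr abs_minus_commute)
  qed
  show ?thesis using that[of v B] mono v0 vB gap by blast
qed

text \<open>F consists of the points where v crosses the multiples of \<delta>. If v rose by more
  than \<delta> between two points of E, some multiple would lie between the two values and its
  crossing point between the two points, hence in E.\<close>

lemma mono_small_pieces:
  fixes v :: "real \<Rightarrow> real"
  assumes v: "mono v" "\<And>t. 0 \<le> v t \<and> v t \<le> B" and \<delta>: "0 < \<delta>"
  obtains F where "finite F"
    "\<And>E x y. is_interval E \<Longrightarrow> E \<inter> F = {} \<Longrightarrow> x \<in> E \<Longrightarrow> y \<in> E \<Longrightarrow> \<bar>v x - v y\<bar> \<le> \<delta>"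
proof -
  define P where "P i = Sup {t. v t \<le> real i * \<delta>}" for i :: nat
  define F where "F = P ` {..nat \<lceil>B / \<delta>\<rceil>}"
  have main: "v y - v x \<le> \<delta>" if E: "is_interval E" "E \<inter> F = {}" "x \<in> E" "y \<in> E" and xy: "x \<le> y" for E x y
  proof (rule ccontr)
    assume "\<not> v y - v x \<le> \<delta>"
    then have gap: "v x + \<delta> < v y" by simp
    define i where "i = nat \<lceil>v x / \<delta>\<rceil>"
    have vx: "0 \<le> v x / \<delta>" using v(2)[of x] \<delta> by simp
    have ri: "v x / \<delta> \<le> real i" "real i < v x / \<delta> + 1"
      using vx unfolding i_def by linarith+
    have i: "v x \<le> real i * \<delta>" "real i * \<delta> < v y"
      using ri gap \<delta> by (auto simp: field_simps)
    have "\<lceil>v x / \<delta>\<rceil> \<le> \<lceil>B / \<delta>\<rceil>"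
      using v(2)[of x] \<delta> by (intro ceiling_mono divide_right_mono) auto
    then have iF: "P i \<in> F" unfolding F_def i_def by (intro imageI) (simp only: atMost_iff nat_mono)
    have below: "t \<le> y" if "v t \<le> real i * \<delta>" for t
    proof (rule ccontr)
      assume "\<not> t \<le> y"
      then have "v y \<le> v t" using monoD[OF v(1), of y t] by simp
      then show False using that i(2) by linarith
    qed
    have "bdd_above {t. v t \<le> real i * \<delta>}" using below by (auto intro: bdd_aboveI[of _ y])
    then have "x \<le> P i" unfolding P_def using i(1) by (intro cSup_upper) auto
    moreover have "P i \<le> y" unfolding P_def using i(1) below by (intro cSup_least) auto
    ultimately have "P i \<in> E" using mem_is_interval_1_I[OF E(1) E(3) E(4)] by blast
    then show False using iF E(2) by blast
  qed
  have "\<bar>v x - v y\<bar> \<le> \<delta>" if "is_interval E" "E \<inter> F = {}" "x \<in> E" "y \<in> E" for E x y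
  proof (cases "x \<le> y")
    case True
    then show ?thesis using main[OF that True] monoD[OF v(1) True] by simp
  next
    case False
    then have yx: "y \<le> x" by simp
    show ?thesis using main[OF that(1,2,4,3) yx] monoD[OF v(1) yx] by simp
  qed
  moreover have "finite F" by (simp add: F_def)
  ultimately show ?thesis using that by blast
qed

section \<open>Operators that are weighted compositions on small intervals\<close>

text \<open>On functions supported in E the operator is a single weighted composition with an
  inverse branch H from K to E. The map f enters only through f (H y) = y, which pulls exceptional
  sets back when operators are composed. The monotone v is a modulus on K: its oscillation is at
  most \<delta>, and its power \<beta> controls the differences of g.\<close>

definition branch_at :: "real \<Rightarrow> (real \<Rightarrow> real) \<Rightarrow> (aefun \<Rightarrow> aefun) \<Rightarrow> real \<Rightarrow> real \<Rightarrow> real \<Rightarrow> real set \<Rightarrow> bool" where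
  "branch_at \<beta> f S lo hi \<delta> E \<longleftrightarrow> (\<exists>K H g v. is_interval K \<and> K \<subseteq> {0..1} \<and> H ` K \<subseteq> E \<and> (\<forall>y\<in>K. f (H y) = y) \<and>
     (mono_on K H \<or> mono_on K (\<lambda>y. - H y)) \<and>
     (\<forall>\<phi>. S (abs_aefun (\<lambda>x. indicator E x * \<phi> x)) =
           abs_aefun (\<lambda>y. indicator K y * (complex_of_real (g y) * \<phi> (H y)))) \<and>
     (\<forall>y\<in>K. lo \<le> g y \<and> g y \<le> hi) \<and> mono_on K v \<and>
     (\<forall>y\<in>K. \<forall>y'\<in>K. \<bar>v y - v y'\<bar> \<le> \<delta> \<and> \<bar>g y - g y'\<bar> \<le> \<bar>v y - v y'\<bar> powr \<beta>))"

text \<open>The weight bounds are the same for all \<delta>; only the finite exceptional set depends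
  on it.\<close>

definition branched :: "real \<Rightarrow> (real \<Rightarrow> real) \<Rightarrow> (aefun \<Rightarrow> aefun) \<Rightarrow> real \<Rightarrow> real \<Rightarrow> bool" where
  "branched \<beta> f S lo hi \<longleftrightarrow> (\<forall>\<delta>>0. \<exists>F. finite F \<and>
     (\<forall>E. is_interval E \<longrightarrow> E \<subseteq> {0..1} \<longrightarrow> E \<inter> F = {} \<longrightarrow> branch_at \<beta> f S lo hi \<delta> E))"

lemma branchedE:
  assumes "branched \<beta> f S lo hi" and "0 < \<delta>"
  obtains F where "finite F"
    "\<And>E. is_interval E \<Longrightarrow> E \<subseteq> {0..1} \<Longrightarrow> E \<inter> F = {} \<Longrightarrow> branch_at \<beta> f S lo hi \<delta> E"
proof -
  from assms(1)[unfolded branched_def, THEN spec, THEN mp, OF assms(2)]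
  obtain F where F: "finite F"
    "\<forall>E. is_interval E \<longrightarrow> E \<subseteq> {0..1} \<longrightarrow> E \<inter> F = {} \<longrightarrow> branch_at \<beta> f S lo hi \<delta> E"
    by (elim exE conjE)
  show ?thesis
    by (rule that[OF F(1)]) (rule F(2)[THEN spec, THEN mp, THEN mp, THEN mp])
qed

lemma branched_id: "branched \<beta> (\<lambda>x. x) (\<lambda>x. x) 1 1"
  unfolding branched_def
proof (intro allI impI, rule exI[of _ "{}"], intro conjI allI impI)
  fix \<delta> :: real and E :: "real set" assume "0 < \<delta>" "is_interval E" "E \<subseteq> {0..1}"
  then show "branch_at \<beta> (\<lambda>x. x) (\<lambda>x. x) 1 1 \<delta> E"
    unfolding branch_at_def
    by (intro exI[of _ E] exI[of _ "\<lambda>y. y"] exI[of _ "\<lambda>y. 1"] exI[of _ "\<lambda>y. 0"])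
      (auto simp: mono_on_def)
qed simp

text \<open>If E avoids F1 and the preimage of F2, then the first branch lives on an interval K1
  that avoids F2, so both branches are single and compose. Weights multiply; as all of them are at
  most 1, the oscillation of the product is at most the sum of the two oscillations.\<close>

lemma branched_comp:
  assumes S: "branched \<beta> fS S lo hi" and T: "branched \<beta> fT T lo' hi'"
    and fin: "\<And>F. finite F \<Longrightarrow> finite {x \<in> {0..1}. fT x \<in> F}"
    and \<beta>: "0 < \<beta>" "\<beta> < 1" and lo: "0 \<le> lo" "0 \<le> lo'" and hi: "hi \<le> 1" "hi' \<le> 1"
  shows "branched \<beta> (\<lambda>x. fS (fT x)) (\<lambda>x. S (T x)) (lo * lo') (hi * hi')"
  unfolding branched_def
proof (intro allI impI)
  fix \<delta> :: real
  assume \<delta>: "0 < \<delta>"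
  \<comment> \<open>c^\<beta> = 2 absorbs the 2 in a^\<beta> + b^\<beta> <= 2 (a + b)^\<beta>. The
    tolerance \<delta>1 allows for this rescaling and for the sum of two moduli.\<close>
  define c where "c = (2::real) powr (1 / \<beta>)"
  have c: "0 < c" "c powr \<beta> = 2" using \<beta> by (auto simp: c_def powr_powr)
  define \<delta>1 where "\<delta>1 = \<delta> / (2 * c)"
  have \<delta>1: "0 < \<delta>1" using \<delta> c by (simp add: \<delta>1_def)
  obtain F2 where F2: "finite F2" "\<And>E. is_interval E \<Longrightarrow> E \<subseteq> {0..1} \<Longrightarrow> E \<inter> F2 = {} \<Longrightarrow> branch_at \<beta> fS S lo hi \<delta>1 E"
    by (rule branchedE[OF S \<delta>1]) (rule that; assumption)
  obtain F1 where F1: "finite F1" "\<And>E. is_interval E \<Longrightarrow> E \<subseteq> {0..1} \<Longrightarrow> E \<inter> F1 = {} \<Longrightarrow> branch_at \<beta> fT T lo' hi' \<delta>1 E"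
    by (rule branchedE[OF T \<delta>1]) (rule that; assumption)
  define F where "F = F1 \<union> {x \<in> {0..1}. fT x \<in> F2}"
  show "\<exists>F. finite F \<and> (\<forall>E. is_interval E \<longrightarrow> E \<subseteq> {0..1} \<longrightarrow> E \<inter> F = {} \<longrightarrow>
     branch_at \<beta> (\<lambda>x. fS (fT x)) (\<lambda>x. S (T x)) (lo * lo') (hi * hi') \<delta> E)"
  proof (rule exI[of _ F], intro conjI allI impI)
    show "finite F" using F1(1) fin[OF F2(1)] by (simp add: F_def)
    fix E :: "real set" assume E: "is_interval E" "E \<subseteq> {0..1}" "E \<inter> F = {}"
    then have "E \<inter> F1 = {}" by (auto simp: F_def)
    from F1(2)[OF E(1,2) this] obtain K1 H1 g1 v1 where 1: "is_interval K1" "K1 \<subseteq> {0..1}" "H1 ` K1 \<subseteq> E"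
      "\<forall>y\<in>K1. fT (H1 y) = y" "mono_on K1 H1 \<or> mono_on K1 (\<lambda>y. - H1 y)"
      "\<forall>\<phi>. T (abs_aefun (\<lambda>x. indicator E x * \<phi> x)) = abs_aefun (\<lambda>y. indicator K1 y * (complex_of_real (g1 y) * \<phi> (H1 y)))"
      "\<forall>y\<in>K1. lo' \<le> g1 y \<and> g1 y \<le> hi'" "mono_on K1 v1"
      "\<forall>y\<in>K1. \<forall>y'\<in>K1. \<bar>v1 y - v1 y'\<bar> \<le> \<delta>1 \<and> \<bar>g1 y - g1 y'\<bar> \<le> \<bar>v1 y - v1 y'\<bar> powr \<beta>"
      unfolding branch_at_def by (elim exE conjE) (rule that; assumption)
    have "K1 \<inter> F2 = {}"
    proof (rule ccontr)
      assume "K1 \<inter> F2 \<noteq> {}"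
      then obtain y where y: "y \<in> K1" "y \<in> F2" by blast
      then have "H1 y \<in> E" "fT (H1 y) \<in> F2" using 1(3,4) by auto
      then have "H1 y \<in> E \<inter> F" using E(2) by (auto simp: F_def)
      then show False using E(3) by blast
    qed
    from F2(2)[OF 1(1,2) this] obtain K2 H2 g2 v2 where 2: "is_interval K2" "K2 \<subseteq> {0..1}" "H2 ` K2 \<subseteq> K1"
      "\<forall>y\<in>K2. fS (H2 y) = y" "mono_on K2 H2 \<or> mono_on K2 (\<lambda>y. - H2 y)"
      "\<forall>\<phi>. S (abs_aefun (\<lambda>x. indicator K1 x * \<phi> x)) = abs_aefun (\<lambda>y. indicator K2 y * (complex_of_real (g2 y) * \<phi> (H2 y)))"
      "\<forall>y\<in>K2. lo \<le> g2 y \<and> g2 y \<le> hi" "mono_on K2 v2"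
      "\<forall>y\<in>K2. \<forall>y'\<in>K2. \<bar>v2 y - v2 y'\<bar> \<le> \<delta>1 \<and> \<bar>g2 y - g2 y'\<bar> \<le> \<bar>v2 y - v2 y'\<bar> powr \<beta>"
      unfolding branch_at_def by (elim exE conjE) (rule that; assumption)
    have H2K: "H2 y \<in> K1" if "y \<in> K2" for y using 2(3) that by blast
    \<comment> \<open>The sign keeps the pulled-back modulus increasing when H2 is
      decreasing.\<close>
    define \<sigma> where "\<sigma> = (if mono_on K2 H2 then 1 else - 1 :: real)"
    have \<sigma>: "\<bar>\<sigma>\<bar> = 1" by (simp add: \<sigma>_def)
    define u where "u y = \<sigma> * v1 (H2 y)" for y
    have u: "mono_on K2 u"
    proof (rule mono_onI)
      fix y y' assume y: "y \<in> K2" "y' \<in> K2" "y \<le> y'"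
      show "u y \<le> u y'"
      proof (cases "mono_on K2 H2")
        case True
        then have "H2 y \<le> H2 y'" using y by (simp add: mono_on_def)
        then have "v1 (H2 y) \<le> v1 (H2 y')" using 1(8) H2K y by (simp add: mono_on_def)
        then show ?thesis using True by (simp add: u_def \<sigma>_def)
      next
        case False
        then have "mono_on K2 (\<lambda>y. - H2 y)" using 2(5) by blast
        then have "H2 y' \<le> H2 y" using y by (auto simp: mono_on_def)
        then have "v1 (H2 y') \<le> v1 (H2 y)" using 1(8) H2K y by (simp add: mono_on_def)
        then show ?thesis using False by (simp add: u_def \<sigma>_def)
      qed
    qed
    have uabs: "\<bar>u y - u y'\<bar> = \<bar>v1 (H2 y) - v1 (H2 y')\<bar>" for y y'
      using \<sigma> by (simp add: u_def abs_mult flip: right_diff_distrib)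
    define v where "v y = c * (v2 y + u y)" for y
    have vabs: "\<bar>v y - v y'\<bar> = c * (\<bar>v2 y - v2 y'\<bar> + \<bar>u y - u y'\<bar>)" if "y \<in> K2" "y' \<in> K2" for y y'
    proof -
      have "(v2 y \<le> v2 y' \<and> u y \<le> u y') \<or> (v2 y' \<le> v2 y \<and> u y' \<le> u y)"
        using 2(8) u that by (cases "y \<le> y'") (auto simp: mono_on_def)
      then have "\<bar>(v2 y - v2 y') + (u y - u y')\<bar> = \<bar>v2 y - v2 y'\<bar> + \<bar>u y - u y'\<bar>" by linarith
      moreover have "v y - v y' = c * ((v2 y - v2 y') + (u y - u y'))" by (simp add: v_def algebra_simps)
      ultimately show ?thesis using c by (simp add: abs_mult)
    qed
    let ?g = "\<lambda>y. g2 y * g1 (H2 y)" and ?H = "\<lambda>y. H1 (H2 y)"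
    have main: "\<bar>v y - v y'\<bar> \<le> \<delta> \<and> \<bar>?g y - ?g y'\<bar> \<le> \<bar>v y - v y'\<bar> powr \<beta>" if y: "y \<in> K2" "y' \<in> K2" for y y'
    proof
      have "\<bar>v y - v y'\<bar> \<le> c * (\<delta>1 + \<delta>1)"
        unfolding vabs[OF y] uabs using 2(9) 1(9) y H2K c by (intro mult_left_mono add_mono) auto
      then show "\<bar>v y - v y'\<bar> \<le> \<delta>" using c by (simp add: \<delta>1_def)
      have b2: "\<bar>g2 y'\<bar> \<le> 1" using 2(7) y lo hi by force
      have b1: "\<bar>g1 (H2 y)\<bar> \<le> 1" using 1(7) H2K[OF y(1)] lo hi by force
      have d2: "\<bar>g2 y - g2 y'\<bar> \<le> \<bar>v2 y - v2 y'\<bar> powr \<beta>" using 2(9) y by blast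
      have d1: "\<bar>g1 (H2 y) - g1 (H2 y')\<bar> \<le> \<bar>u y - u y'\<bar> powr \<beta>" unfolding uabs using 1(9) y H2K by blast
      have "?g y - ?g y' = (g2 y - g2 y') * g1 (H2 y) + g2 y' * (g1 (H2 y) - g1 (H2 y'))"
        by (simp add: algebra_simps)
      then have "\<bar>?g y - ?g y'\<bar> \<le> \<bar>g2 y - g2 y'\<bar> * \<bar>g1 (H2 y)\<bar> + \<bar>g2 y'\<bar> * \<bar>g1 (H2 y) - g1 (H2 y')\<bar>"
        using abs_triangle_ineq[of "(g2 y - g2 y') * g1 (H2 y)" "g2 y' * (g1 (H2 y) - g1 (H2 y'))"] by (simp only: abs_mult)
      also have "\<dots> \<le> \<bar>v2 y - v2 y'\<bar> powr \<beta> * 1 + 1 * \<bar>u y - u y'\<bar> powr \<beta>"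
        using b1 b2 d1 d2 by (intro add_mono mult_mono) auto
      also have "\<dots> \<le> 2 * (\<bar>v2 y - v2 y'\<bar> + \<bar>u y - u y'\<bar>) powr \<beta>"
        using powr_add_le[of "\<bar>v2 y - v2 y'\<bar>" "\<bar>u y - u y'\<bar>" \<beta>] \<beta> by simp
      also have "\<dots> = \<bar>v y - v y'\<bar> powr \<beta>"
        unfolding vabs[OF y] using c by (simp add: powr_mult)
      finally show "\<bar>?g y - ?g y'\<bar> \<le> \<bar>v y - v y'\<bar> powr \<beta>" .
    qed
    have vm: "mono_on K2 v"
    proof (rule mono_onI)
      fix y y' assume y: "y \<in> K2" "y' \<in> K2" "y \<le> y'"
      then have "v2 y + u y \<le> v2 y' + u y'" using 2(8) u by (intro add_mono) (auto simp: mono_on_def)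
      then show "v y \<le> v y'" using c by (simp add: v_def)
    qed
    have Hm: "mono_on K2 ?H \<or> mono_on K2 (\<lambda>y. - ?H y)"
    proof -
      have up: "mono_on K2 (\<lambda>y. h (H2 y))" if "mono_on K1 h" "mono_on K2 H2" for h :: "real \<Rightarrow> real"
        using that H2K by (auto simp: mono_on_def)
      have dn: "mono_on K2 (\<lambda>y. - h (H2 y))" if "mono_on K1 h" "mono_on K2 (\<lambda>y. - H2 y)" for h :: "real \<Rightarrow> real"
        using that H2K by (auto simp: mono_on_def)
      from 1(5) 2(5) show ?thesis
        using up[of H1] up[of "\<lambda>y. - H1 y"] dn[of H1] dn[of "\<lambda>y. - H1 y"] by auto
    qed
    have op: "S (T (abs_aefun (\<lambda>x. indicator E x * \<phi> x))) =
        abs_aefun (\<lambda>y. indicator K2 y * (complex_of_real (?g y) * \<phi> (?H y)))" for \<phi>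
    proof -
      have "S (T (abs_aefun (\<lambda>x. indicator E x * \<phi> x)))
          = S (abs_aefun (\<lambda>y. indicator K1 y * (complex_of_real (g1 y) * \<phi> (H1 y))))"
        by (simp only: spec[OF 1(6), of \<phi>])
      also have "\<dots> = abs_aefun (\<lambda>y. indicator K2 y * (complex_of_real (g2 y) * (complex_of_real (g1 (H2 y)) * \<phi> (H1 (H2 y)))))"
        by (rule spec[OF 2(6)])
      finally show ?thesis by (simp add: mult.assoc)
    qed
    have gb: "lo * lo' \<le> ?g y \<and> ?g y \<le> hi * hi'" if y: "y \<in> K2" for y
    proof -
      have "lo \<le> g2 y" "g2 y \<le> hi" "lo' \<le> g1 (H2 y)" "g1 (H2 y) \<le> hi'" using 2(7) 1(7) y H2K[OF y] by auto
      then show ?thesis using lo by (intro conjI mult_mono) auto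
    qed
    show "branch_at \<beta> (\<lambda>x. fS (fT x)) (\<lambda>x. S (T x)) (lo * lo') (hi * hi') \<delta> E"
      unfolding branch_at_def
    proof (rule exI[of _ K2], rule exI[of _ ?H], rule exI[of _ ?g], rule exI[of _ v], intro conjI allI ballI)
      show "?H ` K2 \<subseteq> E" using H2K 1(3) by blast
      show "fS (fT (?H y)) = y" if "y \<in> K2" for y using H2K[OF that] 1(4) 2(4) that by simp
    qed (use 2(1,2) Hm op gb vm main in simp_all)
  qed
qed

lemma branched_funpow:
  assumes T: "branched \<beta> f T lo hi"
    and fin: "\<And>F. finite F \<Longrightarrow> finite {x \<in> {0..1}. f x \<in> F}"
    and \<beta>: "0 < \<beta>" "\<beta> < 1" and lo: "0 \<le> lo" and hi: "0 \<le> hi" "hi \<le> 1"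
  shows "branched \<beta> (f ^^ n) (T ^^ n) (lo ^ n) (hi ^ n)"
proof (induction n)
  case 0
  then show ?case using branched_id by (simp add: id_def)
next
  case (Suc n)
  have "branched \<beta> (\<lambda>x. (f ^^ n) (f x)) (\<lambda>x. (T ^^ n) (T x)) (lo ^ n * lo) (hi ^ n * hi)"
    using lo hi by (intro branched_comp[OF Suc T fin \<beta>]) (auto intro: power_le_one)
  then show ?case by (simp add: funpow_Suc_right comp_def mult.commute del: funpow.simps)
qed

lemma finite_separated:
  fixes F :: "real set"
  assumes "finite F"
  obtains m :: nat where "\<And>x y j. x \<in> F \<Longrightarrow> y \<in> F \<Longrightarrow> m \<le> j \<Longrightarrow> \<bar>x - y\<bar> \<le> 1 / 2 ^ j \<Longrightarrow> x = y"
proof -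
  define G where "G = insert 1 ((\<lambda>(x, y). \<bar>x - y\<bar>) ` {(x, y) \<in> F \<times> F. x \<noteq> y})"
  have "finite {(x, y) \<in> F \<times> F. x \<noteq> y}" using assms by (intro finite_subset[OF _ finite_cartesian_product]) auto
  then have G: "finite G" "G \<noteq> {}" by (auto simp: G_def)
  have pos: "0 < Min G" using G by (auto simp: G_def)
  obtain m where m: "(1 / 2) ^ m < Min G" using pos real_arch_pow_inv[of "Min G" "1 / 2"] by auto
  have "x = y" if xy: "x \<in> F" "y \<in> F" "m \<le> j" "\<bar>x - y\<bar> \<le> 1 / 2 ^ j" for x y j
  proof (rule ccontr)
    assume "x \<noteq> y"
    then have "\<bar>x - y\<bar> \<in> G" using xy by (auto simp: G_def)
    then have "Min G \<le> \<bar>x - y\<bar>" using G by simp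
    also have "\<dots> \<le> 1 / 2 ^ j" by (rule xy(4))
    also have "\<dots> \<le> (1 / 2) ^ m" using xy(3) by (simp add: power_one_over power_increasing divide_left_mono)
    finally show False using m by simp
  qed
  then show ?thesis using that by blast
qed

lemma dyadic_interval_diam: "x \<in> dyadic_interval k j \<Longrightarrow> y \<in> dyadic_interval k j \<Longrightarrow> j < 2 ^ k \<Longrightarrow> \<bar>x - y\<bar> \<le> 1 / 2 ^ k"
proof -
  assume xy: "x \<in> dyadic_interval k j" "y \<in> dyadic_interval k j" "j < 2 ^ k"
  have e: "real (Suc j) / 2 ^ k = real j / 2 ^ k + 1 / 2 ^ k" by (simp add: add_divide_distrib)
  have sub: "dyadic_interval k j \<subseteq> {real j / 2 ^ k..real (Suc j) / 2 ^ k}"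
  proof (cases "Suc j = 2 ^ k")
    case True
    have "real (Suc j) / 2 ^ k = 1" using arg_cong[OF True, of real] by simp
    then show ?thesis unfolding dyadic_interval_def using True by (simp del: of_nat_Suc)
  next
    case False
    then show ?thesis unfolding dyadic_interval_def by (simp add: atLeastLessThan_subseteq_atLeastAtMost_iff del: of_nat_Suc)
  qed
  have "x \<in> {real j / 2 ^ k..real (Suc j) / 2 ^ k}" "y \<in> {real j / 2 ^ k..real (Suc j) / 2 ^ k}"
    using subsetD[OF sub] xy by auto
  then show ?thesis unfolding e by (simp add: abs_le_iff)
qed

lemma is_interval_dyadic: "is_interval (dyadic_interval k j)"
  by (auto simp: dyadic_interval_def is_interval_1)

lemma norm1_ae_ind_mono:
  assumes "E \<in> sets lebesgue" "E' \<in> sets lebesgue" "E \<subseteq> E'"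
  shows "norm1 (ae_ind E) \<le> norm1 (ae_ind E')"
proof -
  have "restr E (ae_ind E') = ae_ind E" using assms(3) by (simp add: restr_ae_ind Int_absorb2)
  then show ?thesis
    using norm1_partition[of "ae_ind E'" "{()}" "\<lambda>_. E"] assms by (simp add: disjoint_family_on_def)
qed

text \<open>The tolerance \<delta> makes the oscillation of the weight at most half of its lower
  bound. Cells of level at least m contain at most one exceptional point; removing it leaves two
  intervals to which \<open>piece_estimate\<close> applies, whence 2 * 96 = 192. The bound
  \<open>lo\<close> influences only \<delta> and m, so the constant is the same for all
  iterates.\<close>

lemma small_on_branched:
  assumes br: "branched \<beta> f S lo hi" and S: "L1op S" and \<beta>: "0 < \<beta>" "\<beta> < 1" and lo: "0 < lo" "lo \<le> hi"
  shows "\<exists>m. small_on \<beta> 192 hi m S"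
proof -
  define \<delta> where "\<delta> = (lo / 2) powr (1 / \<beta>)"
  have \<delta>: "0 < \<delta>" "2 * \<delta> powr \<beta> \<le> lo" using lo \<beta> by (auto simp: \<delta>_def powr_powr)
  obtain F where F: "finite F" "\<And>E. is_interval E \<Longrightarrow> E \<subseteq> {0..1} \<Longrightarrow> E \<inter> F = {} \<Longrightarrow> branch_at \<beta> f S lo hi \<delta> E"
    by (rule branchedE[OF br \<delta>(1)]) (rule that; assumption)
  obtain m where m: "\<And>x y j. x \<in> F \<Longrightarrow> y \<in> F \<Longrightarrow> m \<le> j \<Longrightarrow> \<bar>x - y\<bar> \<le> 1 / 2 ^ j \<Longrightarrow> x = y"
    using finite_separated[OF F(1)] by blast
  have piece: "mean_norm 1 k (mart_diff (S (ae_ind E)) k) \<le> 96 * min 1 ((hi * 2 powr (real j - real k)) powr \<beta>) / 2 ^ j"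
    if E: "is_interval E" "E \<subseteq> {0..1}" "E \<inter> F = {}" "E \<in> sets lebesgue" and l: "norm1 (ae_ind E) \<le> 1 / 2 ^ j" for E j k
  proof -
    from F(2)[OF E(1-3)] obtain K H g v where K: "is_interval K" "K \<subseteq> {0..1}"
      "\<forall>\<phi>. S (abs_aefun (\<lambda>x. indicator E x * \<phi> x)) = abs_aefun (\<lambda>y. indicator K y * (complex_of_real (g y) * \<phi> (H y)))"
      "\<forall>y\<in>K. lo \<le> g y \<and> g y \<le> hi" "mono_on K v"
      "\<forall>y\<in>K. \<forall>y'\<in>K. \<bar>v y - v y'\<bar> \<le> \<delta> \<and> \<bar>g y - g y'\<bar> \<le> \<bar>v y - v y'\<bar> powr \<beta>"
      unfolding branch_at_def by (elim exE conjE) (rule that; assumption)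
    define \<psi> where "\<psi> = S (ae_ind E)"
    have \<psi>: "\<psi> = abs_aefun (\<lambda>y. indicator K y * complex_of_real (g y))"
      using spec[OF K(3), of "\<lambda>_. 1"] by (simp add: \<psi>_def ae_ind_def ae_one_def restr.abs_eq)
    have i\<psi>: "ae_int \<psi>" using L1opD(3)[OF S] E(4) by (simp add: \<psi>_def)
    have n\<psi>: "norm1 \<psi> \<le> 1 / 2 ^ j" using L1opD(4)[OF S, of "ae_ind E"] E(4) l by (simp add: \<psi>_def)
    \<comment> \<open>The trivial bound holds with 2; it is enlarged to 96 so that both bounds
      combine into one minimum.\<close>
    have 1: "mean_norm 1 k (mart_diff \<psi> k) \<le> 96 * (1 / 2 ^ j)"
    proof -
      have "(0::real) \<le> 1 / 2 ^ j" by simp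
      then show ?thesis using sum_mart_diff_le[OF i\<psi>, of k] n\<psi> unfolding mean_norm_1 by linarith
    qed
    have "mean_norm 1 k (mart_diff \<psi> k) \<le> 96 * norm1 \<psi> powr (1 - \<beta>) * (hi / 2 ^ k) powr \<beta>"
      using K(4,6) lo unfolding \<psi>
      by (intro piece_estimate[OF K(1,2) \<beta> lo(1) _ _ K(5) _ _ \<delta>(2)]) (use i\<psi> in \<open>auto simp: \<psi>\<close>)
    also have "\<dots> \<le> 96 * (1 / 2 ^ j) powr (1 - \<beta>) * (hi / 2 ^ k) powr \<beta>"
      using n\<psi> \<beta> by (intro mult_right_mono mult_left_mono powr_mono2) auto
    also have "\<dots> = 96 * ((hi * 2 powr (real j - real k)) powr \<beta>) * (1 / 2 ^ j)"
    proof -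
      have "hi / 2 ^ k = (hi * 2 powr (real j - real k)) * (1 / 2 ^ j)"
        by (simp add: powr_diff powr_realpow)
      then have e1: "(hi / 2 ^ k) powr \<beta> = (hi * 2 powr (real j - real k)) powr \<beta> * (1 / 2 ^ j) powr \<beta>"
        by (simp only: powr_mult)
      have e2: "(1 / 2 ^ j :: real) powr (1 - \<beta>) * (1 / 2 ^ j) powr \<beta> = 1 / 2 ^ j"
        by (simp flip: powr_add)
      have e3: "96 * a * (x * b) = 96 * x * (a * b)" for a b x :: real by (simp only: mult_ac)
      show ?thesis unfolding e1 by (rule trans[OF e3]) (simp only: e2)
    qed
    finally have 2: "mean_norm 1 k (mart_diff \<psi> k) \<le> 96 * ((hi * 2 powr (real j - real k)) powr \<beta>) * (1 / 2 ^ j)" .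
    show ?thesis unfolding \<psi>_def[symmetric] using 1 2 by (simp add: min_def)
  qed
  have "small_on \<beta> 192 hi m S"
    unfolding small_on_def
  proof (intro allI impI)
    fix j i k :: nat assume j: "m \<le> j" and i: "i < 2 ^ j"
    let ?Q = "dyadic_interval j i"
    have "\<exists>t. ?Q \<inter> F \<subseteq> {t}"
    proof (cases "?Q \<inter> F = {}")
      case False
      then obtain t where t: "t \<in> ?Q" "t \<in> F" by blast
      have "x = t" if "x \<in> ?Q \<inter> F" for x
        using m[of x t j] that t j dyadic_interval_diam[OF _ _ i] by blast
      then show ?thesis by blast
    qed auto
    then obtain t where t: "?Q \<inter> F \<subseteq> {t}" by blast
    define E1 E2 where "E1 = ?Q \<inter> {..<t}" "E2 = ?Q \<inter> {t<..}"
    have Es: "E1 \<in> sets lebesgue" "E2 \<in> sets lebesgue" unfolding E1_E2_def by (intro sets.Int) auto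
    have Ei: "is_interval E1" "is_interval E2"
      unfolding E1_E2_def by (intro is_interval_Int is_interval_dyadic; simp add: is_interval_1)+
    have Esub: "E1 \<subseteq> ?Q" "E2 \<subseteq> ?Q" by (auto simp: E1_E2_def)
    then have E01: "E1 \<subseteq> {0..1}" "E2 \<subseteq> {0..1}" using dyadic_interval_subset[OF i] by auto
    have EF: "E1 \<inter> F = {}" "E2 \<inter> F = {}" using t by (auto simp: E1_E2_def)
    have nQ: "norm1 (ae_ind ?Q) = 1 / 2 ^ j"
      using i by (subst norm1_ae_ind) (simp_all only: dyadic_interval_subset measure_dyadic_interval dyadic_interval_sets)
    have nE: "norm1 (ae_ind E1) \<le> 1 / 2 ^ j" "norm1 (ae_ind E2) \<le> 1 / 2 ^ j"
      using norm1_ae_ind_mono[OF Es(1) _ Esub(1)] norm1_ae_ind_mono[OF Es(2) _ Esub(2)] nQ by auto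
    have "ae_ind ?Q = ae_ind (E1 \<union> E2)"
      unfolding ae_ind_def
    proof (rule restr_negligible)
      show "negligible (?Q - (E1 \<union> E2))" by (rule negligible_subset[of "{t}"]) (auto simp: E1_E2_def)
      show "negligible (E1 \<union> E2 - ?Q)" by (rule negligible_subset[of "{}"]) (auto simp: E1_E2_def)
    qed
    also have "\<dots> = ae_ind E1 + ae_ind E2" by (rule ae_ind_Un) (auto simp: E1_E2_def)
    finally have "S (ae_ind ?Q) = S (ae_ind E1) + S (ae_ind E2)" by (simp add: L1opD(1)[OF S])
    then have "mart_diff (S (ae_ind ?Q)) k = (\<lambda>l. mart_diff (S (ae_ind E1)) k l + mart_diff (S (ae_ind E2)) k l)"
      using L1opD(3)[OF S] Es by (simp add: fun_eq_iff mart_diff_add)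
    then have "mean_norm 1 k (mart_diff (S (ae_ind ?Q)) k) \<le> mean_norm 1 k (mart_diff (S (ae_ind E1)) k) + mean_norm 1 k (mart_diff (S (ae_ind E2)) k)"
      using mean_norm_add_le[of 1 k] by simp
    also have "\<dots> \<le> 96 * min 1 ((hi * 2 powr (real j - real k)) powr \<beta>) / 2 ^ j
        + 96 * min 1 ((hi * 2 powr (real j - real k)) powr \<beta>) / 2 ^ j"
      by (intro add_mono piece Ei E01 EF Es nE)
    finally show "mean_norm 1 k (mart_diff (S (ae_ind ?Q)) k) \<le> 192 * min 1 ((hi * 2 powr (real j - real k)) powr \<beta>) / 2 ^ j"
      by simp
  qed
  then show ?thesis by blast
qed

section \<open>The transfer operator\<close>

lemma AE_unit_lebE:
  assumes "AE x in unit_leb. P x"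
  obtains N where "negligible N" "\<And>x. x \<in> {0..1} \<Longrightarrow> x \<notin> N \<Longrightarrow> P x"
proof -
  have "AE x in lebesgue. x \<in> {0..1} \<longrightarrow> P x"
    using assms by (simp add: AE_restrict_space_iff)
  then obtain N where N: "\<And>x. x \<in> space lebesgue - N \<Longrightarrow> x \<in> {0..1} \<longrightarrow> P x" "N \<in> null_sets lebesgue"
    by (rule AE_E3) (rule that; assumption)
  have "P x" if "x \<in> {0..1}" "x \<notin> N" for x using N(1)[of x] that by simp
  then show ?thesis using that N(2) negligible_iff_null_sets by blast
qed

text \<open>\<open>r\<close> stands for the variation exponent \<beta> + \<epsilon> and
  \<open>lam\<close> for the infimum of |f'|; any lower bound above 1 satisfies the assumptions on
  \<open>lam\<close>.\<close>

locale expanding_map =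
  fixes f :: "real \<Rightarrow> real" and I :: "'i \<Rightarrow> real set" and \<Lambda> :: "'i set"
    and \<beta> r c C lam :: real
  assumes fin: "finite \<Lambda>"
    and int: "\<And>i. i \<in> \<Lambda> \<Longrightarrow> is_interval (I i)"
    and dj: "disjoint_family_on I \<Lambda>"
    and cover: "(\<Union>i\<in>\<Lambda>. I i) = {0..1}"
    and f01: "f ` {0..1} \<subseteq> {0..1}"
    and cont: "\<And>i. i \<in> \<Lambda> \<Longrightarrow> continuous_on (I i) f"
    and c: "0 < c"
    and lipl: "\<And>i x y. i \<in> \<Lambda> \<Longrightarrow> x \<in> I i \<Longrightarrow> y \<in> I i \<Longrightarrow> c * \<bar>x - y\<bar> \<le> \<bar>f x - f y\<bar>"
    and lipu: "\<And>i x y. i \<in> \<Lambda> \<Longrightarrow> x \<in> I i \<Longrightarrow> y \<in> I i \<Longrightarrow> \<bar>f x - f y\<bar> \<le> C * \<bar>x - y\<bar>"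
    and \<beta>: "0 < \<beta>" "\<beta> < 1" and r: "\<beta> \<le> r"
    and fv: "\<And>i. i \<in> \<Lambda> \<Longrightarrow> finite_variation_on r (deriv f) (diff_points f (I i))"
    and lam: "1 < lam" and lam_le: "\<And>i x. i \<in> \<Lambda> \<Longrightarrow> x \<in> diff_points f (I i) \<Longrightarrow> lam \<le> \<bar>deriv f x\<bar>"
    and C: "0 < C"
begin

abbreviation "K i \<equiv> f ` I i"
abbreviation "h i \<equiv> inv_into (I i) f"
abbreviation "T \<equiv> transfer_op \<Lambda> I f"

lemma I01: "i \<in> \<Lambda> \<Longrightarrow> I i \<subseteq> {0..1}" using cover by blast

lemma K01: "i \<in> \<Lambda> \<Longrightarrow> K i \<subseteq> {0..1}" using I01 f01 by blast

lemma inj: "i \<in> \<Lambda> \<Longrightarrow> inj_on f (I i)"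
proof (rule inj_onI)
  fix x y assume i: "i \<in> \<Lambda>" "x \<in> I i" "y \<in> I i" and "f x = f y"
  then have "c * \<bar>x - y\<bar> \<le> 0" using lipl[OF i] by simp
  then show "x = y" using c by (simp add: mult_le_0_iff)
qed

lemma h_f: "i \<in> \<Lambda> \<Longrightarrow> x \<in> I i \<Longrightarrow> h i (f x) = x" using inj by simp
lemma f_h: "y \<in> K i \<Longrightarrow> f (h i y) = y" by (rule f_inv_into_f)
lemma h_mem: "y \<in> K i \<Longrightarrow> h i y \<in> I i" by (rule inv_into_into)

lemma h_lip: assumes "i \<in> \<Lambda>" "y \<in> K i" "z \<in> K i" shows "\<bar>h i y - h i z\<bar> \<le> (1 / c) * \<bar>y - z\<bar>"
  using lipl[OF assms(1) h_mem[OF assms(2)] h_mem[OF assms(3)]] c f_h[OF assms(2)] f_h[OF assms(3)]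
  by (simp add: field_simps)

lemma h_lip_lower: assumes "i \<in> \<Lambda>" "y \<in> K i" "z \<in> K i" shows "\<bar>y - z\<bar> \<le> C * \<bar>h i y - h i z\<bar>"
  using lipu[OF assms(1) h_mem[OF assms(2)] h_mem[OF assms(3)]] f_h[OF assms(2)] f_h[OF assms(3)] by simp

lemma is_interval_K: "i \<in> \<Lambda> \<Longrightarrow> is_interval E \<Longrightarrow> E \<subseteq> I i \<Longrightarrow> is_interval (f ` E)"
  unfolding is_interval_connected_1
  by (intro connected_continuous_image continuous_on_subset[OF cont])

lemma h_mono: assumes i: "i \<in> \<Lambda>" shows "mono_on (K i) (h i) \<or> mono_on (K i) (\<lambda>y. - h i y)"
proof -
  have "(1 / c)-lipschitz_on (K i) (h i)"
    using h_lip[OF i] c by (intro lipschitz_onI) (auto simp: dist_real_def)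
  then have "continuous_on (K i) (h i)" by (rule lipschitz_on_continuous_on)
  then have "strict_mono_on (K i) (h i) \<or> strict_antimono_on (K i) (h i)"
    using injective_eq_monotone_map[of "K i" "h i"] is_interval_K[OF i int[OF i] order_refl] inj_on_inv_into[of "K i" f "I i"]
    by blast
  then show ?thesis
  proof
    assume "strict_mono_on (K i) (h i)"
    then show ?thesis by (auto intro: strict_mono_on_imp_mono_on)
  next
    assume *: "strict_antimono_on (K i) (h i)"
    have "mono_on (K i) (\<lambda>y. - h i y)"
    proof (rule mono_onI)
      fix y z assume yz: "y \<in> K i" "z \<in> K i" "y \<le> z"
      show "- h i y \<le> - h i z"
        using * yz by (cases "y = z") (auto dest: monotone_onD)
    qed
    then show ?thesis ..
  qed
qed

lemma negligible_f: assumes i: "i \<in> \<Lambda>" and N: "negligible N" shows "negligible (f ` (I i \<inter> N))"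
proof (rule negligible_locally_Lipschitz_image[OF order_refl])
  show "negligible (I i \<inter> N)" using N by (rule negligible_subset) auto
  fix x assume "x \<in> I i \<inter> N"
  then show "\<exists>T B. open T \<and> x \<in> T \<and> (\<forall>y\<in>(I i \<inter> N) \<inter> T. norm (f y - f x) \<le> B * norm (y - x))"
    using lipu[OF i] by (intro exI[of _ UNIV] exI[of _ C]) auto
qed

lemma negligible_h: assumes i: "i \<in> \<Lambda>" and N: "negligible N" shows "negligible (h i ` (K i \<inter> N))"
proof (rule negligible_locally_Lipschitz_image[OF order_refl])
  show "negligible (K i \<inter> N)" using N by (rule negligible_subset) auto
  fix x assume "x \<in> K i \<inter> N"
  then show "\<exists>T B. open T \<and> x \<in> T \<and> (\<forall>y\<in>(K i \<inter> N) \<inter> T. norm (h i y - h i x) \<le> B * norm (y - x))"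
    using h_lip[OF i] by (intro exI[of _ UNIV] exI[of _ "1 / c"]) auto
qed

lemma interval_lebesgue: "is_interval E \<Longrightarrow> E \<subseteq> {0..1} \<Longrightarrow> E \<in> sets lebesgue" for E :: "real set"
  by (rule fmeasurableD, rule measurable_convex)
    (auto intro: is_interval_convex bounded_subset[OF bounded_closed_interval])

lemma negligible_frontier_interval: "is_interval E \<Longrightarrow> negligible (frontier E)" for E :: "real set"
  by (intro negligible_convex_frontier is_interval_convex)

text \<open>The branch is extended to a Lipschitz function on the line, which is differentiable
  almost everywhere. Discarding the frontier of K i and the image of the frontier of I i leaves
  interior points on both sides. There the derivative of h i is at least 1 / C in modulus, hence
  nonzero, and the inverse function rule makes f differentiable at h i y.\<close>

lemma h_deriv:
  assumes i: "i \<in> \<Lambda>"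
  obtains N where "negligible N"
    "\<And>y. y \<in> K i \<Longrightarrow> y \<notin> N \<Longrightarrow> (h i has_real_derivative deriv (h i) y) (at y) \<and>
       h i y \<in> diff_points f (I i) \<and> deriv (h i) y = inverse (deriv f (h i y))"
proof (cases "K i = {}")
  case True
  then show ?thesis using that[of "{}"] by simp
next
  case False
  obtain H where H: "\<And>y. y \<in> K i \<Longrightarrow> H y = h i y" "\<And>x y. \<bar>H x - H y\<bar> \<le> (1 / c) * \<bar>x - y\<bar>"
  proof (rule mcshane_extension[OF False, of "\<lambda>x y. (1 / c) * \<bar>x - y\<bar>" "h i"])
    show "1 / c * \<bar>x - z\<bar> \<le> 1 / c * \<bar>x - y\<bar> + 1 / c * \<bar>y - z\<bar>" for x y z
      using c abs_triangle_ineq[of "x - y" "y - z"] by (simp add: divide_right_mono flip: add_divide_distrib)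
  qed (use h_lip[OF i] in \<open>auto simp: abs_minus_commute\<close>)
  obtain N0 where N0: "negligible N0" "\<And>y. y \<notin> N0 \<Longrightarrow> H differentiable (at y)"
    using lipschitz_AE_differentiable[of "1 / c" H] H(2) c by auto
  define N where "N = N0 \<union> frontier (K i) \<union> f ` (I i \<inter> frontier (I i))"
  have "negligible N"
    unfolding N_def using i int is_interval_K[OF i int[OF i]]
    by (intro negligible_Un N0 negligible_f negligible_frontier_interval) auto
  moreover have "(h i has_real_derivative deriv (h i) y) (at y) \<and>
       h i y \<in> diff_points f (I i) \<and> deriv (h i) y = inverse (deriv f (h i y))"
    if y: "y \<in> K i" "y \<notin> N" for y
  proof -
    define x where "x = h i y"
    have x: "x \<in> I i" "f x = y" using y h_mem f_h by (auto simp: x_def)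
    have yi: "y \<in> interior (K i)" using y closure_subset[of "K i"] by (auto simp: N_def frontier_def)
    have "x \<notin> frontier (I i)" using x y(2) by (auto simp: N_def)
    then have xi: "x \<in> interior (I i)" using x closure_subset[of "I i"] by (auto simp: frontier_def)
    obtain D where "(H has_real_derivative D) (at y)"
      using N0(2)[of y] y(2) by (auto simp: N_def real_differentiable_def)
    then have hD: "(h i has_real_derivative D) (at y)"
      by (rule has_field_derivative_transform_within_open[OF _ open_interior yi])
        (use H(1) interior_subset[of "K i"] in auto)
    have D: "1 / C \<le> \<bar>D\<bar>"
    proof (rule tendsto_lowerbound)
      show "((\<lambda>z. \<bar>(h i z - h i y) / (z - y)\<bar>) \<longlongrightarrow> \<bar>D\<bar>) (at y)"
        using hD by (intro tendsto_rabs) (simp add: has_field_derivative_iff)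
      have "\<forall>\<^sub>F z in at y. z \<in> interior (K i) - {y}"
        using eventually_at_in_open[OF open_interior yi] .
      then show "\<forall>\<^sub>F z in at y. 1 / C \<le> \<bar>(h i z - h i y) / (z - y)\<bar>"
      proof eventually_elim
        case (elim z)
        then have z: "z \<in> K i" "z \<noteq> y" using interior_subset by auto
        then show ?case using h_lip_lower[OF i z(1) y(1)] C by (simp add: abs_divide field_simps)
      qed
    qed simp
    then have D0: "D \<noteq> 0" using C by auto
    obtain e where e: "e > 0" "ball x e \<subseteq> interior (I i)"
      using xi open_interior by (meson open_contains_ball)
    have "DERIV f x :> inverse D"
    proof (rule DERIV_inverse_function[where f = "h i" and a = "x - e" and b = "x + e"])
      show "DERIV (h i) (f x) :> D" using hD x by simp
      show "isCont f x" using continuous_on_interior[OF cont[OF i] xi] .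
      fix z assume "x - e < z" "z < x + e"
      then have "z \<in> ball x e" by (auto simp: dist_real_def)
      then have "z \<in> I i" using e(2) interior_subset by blast
      then show "h i (f z) = z" by (rule h_f[OF i])
    qed (use e D0 in auto)
    then have "x \<in> diff_points f (I i)" "deriv f x = inverse D"
      using xi by (auto simp: diff_points_def real_differentiable_def DERIV_imp_deriv)
    then show ?thesis using hD DERIV_imp_deriv[OF hD] by (simp add: x_def)
  qed
  ultimately show ?thesis using that by blast
qed

text \<open>The maximum gives \<open>lam \<le> L\<close> at once, without exhibiting a point of
  differentiability.\<close>

definition L :: real where "L = max C lam"

lemma L: "lam \<le> L" "0 < L" using lam by (auto simp: L_def)

lemma deriv_f_le:
  assumes i: "i \<in> \<Lambda>" and x: "x \<in> diff_points f (I i)"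
  shows "\<bar>deriv f x\<bar> \<le> L"
proof -
  have xi: "x \<in> interior (I i)" and "(f has_real_derivative deriv f x) (at x)"
    using x by (auto simp: diff_points_def DERIV_deriv_iff_real_differentiable)
  then have lim: "((\<lambda>z. \<bar>(f z - f x) / (z - x)\<bar>) \<longlongrightarrow> \<bar>deriv f x\<bar>) (at x)"
    by (intro tendsto_rabs) (simp add: has_field_derivative_iff)
  have "\<bar>deriv f x\<bar> \<le> C"
  proof (rule tendsto_upperbound[OF lim])
    have "\<forall>\<^sub>F z in at x. z \<in> interior (I i) - {x}"
      using eventually_at_in_open[OF open_interior xi] .
    then show "\<forall>\<^sub>F z in at x. \<bar>(f z - f x) / (z - x)\<bar> \<le> C"
    proof eventually_elim
      case (elim z)
      then have z: "z \<in> I i" "z \<noteq> x" "x \<in> I i" using interior_subset xi by auto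
      then show ?case using lipu[OF i z(1) z(3)] by (simp add: abs_divide field_simps)
    qed
  qed simp
  then show ?thesis by (simp add: L_def)
qed

text \<open>The variation exponent r is lowered to \<beta> because v is bounded: t^r <= t^\<beta>
  B'^(r - \<beta>) for its increments t. For \<beta> < 1 the expression |u x - u y|^\<beta>
  satisfies the triangle inequality, so |f'| extends from the differentiability points to a function
  e on the line with the same modulus.\<close>

lemma jacobian_control:
  assumes i: "i \<in> \<Lambda>"
  obtains e v B where "mono v" "\<And>t. 0 \<le> v t \<and> v t \<le> B" "\<And>t. lam \<le> e t \<and> e t \<le> L"
    "\<And>x y. \<bar>e x - e y\<bar> \<le> \<bar>v x - v y\<bar> powr \<beta>"
    "\<And>x. x \<in> diff_points f (I i) \<Longrightarrow> e x = \<bar>deriv f x\<bar>"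
proof (cases "diff_points f (I i) = {}")
  case True
  show ?thesis
    using that[of "\<lambda>_. 0" 0 "\<lambda>_. lam"] True L(1) by (simp add: mono_def)
next
  case False
  let ?D = "diff_points f (I i)"
  have r0: "0 < r" using \<beta> r by simp
  obtain v B where v: "mono v" "\<And>t. 0 \<le> v t \<and> v t \<le> B"
    "\<And>x y. x \<in> ?D \<Longrightarrow> y \<in> ?D \<Longrightarrow> x < y \<Longrightarrow> \<bar>deriv f x - deriv f y\<bar> \<le> (v y - v x) powr r"
    by (rule finite_variation_control[OF fv[OF i] r0]) (rule that; assumption)
  define B' where "B' = B + 1"
  have B': "0 < B'" using v(2)[of 0] by (simp add: B'_def)
  \<comment> \<open>s^\<beta> equals the surplus factor B'^(r - \<beta>), so that rescaling v by s
    absorbs it.\<close>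
  define s where "s = B' powr ((r - \<beta>) / \<beta>)"
  have s: "0 < s" "s powr \<beta> = B' powr (r - \<beta>)" using B' \<beta> by (auto simp: s_def powr_powr)
  define u where "u t = s * v t" for t
  have um: "mono u" using v(1) s by (auto simp: mono_def u_def)
  have ub: "0 \<le> u t \<and> u t \<le> s * B" for t using v(2)[of t] s by (simp add: u_def)
  have d1: "\<bar>deriv f x - deriv f y\<bar> \<le> \<bar>u x - u y\<bar> powr \<beta>" if xy: "x \<in> ?D" "y \<in> ?D" "x < y" for x y
  proof -
    define t where "t = v y - v x"
    have t: "0 \<le> t" "t \<le> B'" using monoD[OF v(1), of x y] v(2)[of x] v(2)[of y] xy(3) by (auto simp: t_def B'_def)
    have "\<bar>deriv f x - deriv f y\<bar> \<le> t powr r" unfolding t_def by (rule v(3)[OF xy])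
    also have "\<dots> = t powr \<beta> * t powr (r - \<beta>)" by (simp flip: powr_add)
    also have "\<dots> \<le> t powr \<beta> * B' powr (r - \<beta>)" using t r by (intro mult_left_mono powr_mono2) auto
    also have "\<dots> = (s * t) powr \<beta>" using s by (simp add: powr_mult)
    also have "s * t = \<bar>u x - u y\<bar>" using s t(1) by (simp add: u_def t_def algebra_simps)
    finally show ?thesis .
  qed
  define d where "d x y = \<bar>u x - u y\<bar> powr \<beta>" for x y
  have tri: "d x z \<le> d x y + d y z" for x y z
  proof -
    have sub: "(a + b) powr \<beta> \<le> a powr \<beta> + b powr \<beta>" if "0 \<le> a" "0 \<le> b" for a b :: real
    proof (cases "a + b = 0")
      case False
      then have ab: "0 < a + b" using that by simp
      have le: "w \<le> w powr \<beta>" if "0 \<le> w" "w \<le> 1" for w :: real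
        using powr_mono'[of \<beta> 1 w] that \<beta> by (cases "w = 0") auto
      have "1 = a / (a + b) + b / (a + b)" using ab by (simp flip: add_divide_distrib)
      also have "\<dots> \<le> (a / (a + b)) powr \<beta> + (b / (a + b)) powr \<beta>"
        using that ab by (intro add_mono le) auto
      also have "\<dots> = (a powr \<beta> + b powr \<beta>) / (a + b) powr \<beta>"
        using that ab by (simp add: powr_divide add_divide_distrib)
      finally show ?thesis using ab by (simp add: field_simps)
    qed (use that in auto)
    have "d x z \<le> (\<bar>u x - u y\<bar> + \<bar>u y - u z\<bar>) powr \<beta>"
      unfolding d_def using \<beta> by (intro powr_mono2) auto
    also have "\<dots> \<le> d x y + d y z" unfolding d_def by (rule sub) auto
    finally show ?thesis .
  qed
  have ad: "\<bar>\<bar>deriv f x\<bar> - \<bar>deriv f y\<bar>\<bar> \<le> d x y" if xy: "x \<in> ?D" "y \<in> ?D" for x y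
  proof -
    have "\<bar>deriv f x - deriv f y\<bar> \<le> d x y"
    proof (cases x y rule: linorder_cases)
      case less
      then show ?thesis using d1[OF xy] by (simp add: d_def)
    next
      case equal
      then show ?thesis by (simp add: d_def)
    next
      case greater
      then show ?thesis using d1[OF xy(2,1)] by (simp add: d_def abs_minus_commute)
    qed
    then show ?thesis by linarith
  qed
  obtain e0 where e0: "\<And>x. x \<in> ?D \<Longrightarrow> e0 x = \<bar>deriv f x\<bar>" "\<And>x y. \<bar>e0 x - e0 y\<bar> \<le> d x y"
  proof (rule mcshane_extension[OF False, of d "\<lambda>x. \<bar>deriv f x\<bar>"])
    show "d x y = d y x" for x y by (simp add: d_def abs_minus_commute)
    show "d x x = 0" for x by (simp add: d_def)
  qed (use tri ad in auto)
  \<comment> \<open>Clamping to the range from \<open>lam\<close> to \<open>L\<close> does not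
    increase differences and changes nothing at the differentiability points.\<close>
  define e where "e x = max lam (min L (e0 x))" for x
  have "\<bar>e x - e y\<bar> \<le> \<bar>u x - u y\<bar> powr \<beta>" for x y
    using e0(2)[of x y] unfolding d_def e_def by linarith
  moreover have "e x = \<bar>deriv f x\<bar>" if "x \<in> ?D" for x
    using e0(1)[OF that] lam_le[OF i that] deriv_f_le[OF i that] by (simp add: e_def)
  moreover have "lam \<le> e t \<and> e t \<le> L" for t using L by (simp add: e_def)
  ultimately show ?thesis using that[OF um ub] by blast
qed

section \<open>The transfer operator on integrable classes\<close>

lemma transfer_fun_eq:
  "transfer_fun \<Lambda> I f \<phi> y = (\<Sum>i\<in>\<Lambda>. indicator (K i) y * (complex_of_real \<bar>deriv (h i) y\<bar> * \<phi> (h i y)))"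
  unfolding transfer_fun_def
  by (subst sum.inter_filter[OF fin]) (auto simp: indicator_def intro!: sum.cong)

text \<open>Two representatives differ on a null set N, and their images differ at most on the union
  of the sets f(I i \<inter> N), which is null because f is Lipschitz on each piece.\<close>

lemma transfer_abs: "T (abs_aefun \<phi>) = abs_aefun (transfer_fun \<Lambda> I f \<phi>)"
proof -
  have "AE x in unit_leb. rep_aefun (abs_aefun \<phi>) x = \<phi> x"
    by (rule Quotient3_rep_abs[OF Quotient3_aefun]) simp
  then obtain N where N: "negligible N" "\<And>x. x \<in> {0..1} \<Longrightarrow> x \<notin> N \<Longrightarrow> rep_aefun (abs_aefun \<phi>) x = \<phi> x"
    by (rule AE_unit_lebE) (rule that; assumption)
  note nN = N(1)
  have neg: "negligible (\<Union>i\<in>\<Lambda>. f ` (I i \<inter> N))"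
    by (rule negligible_Union) (use fin negligible_f[OF _ nN] in auto)
  have "AE y in unit_leb. transfer_fun \<Lambda> I f (rep_aefun (abs_aefun \<phi>)) y = transfer_fun \<Lambda> I f \<phi> y"
  proof (rule AE_unit_lebI[OF neg])
    fix y assume y: "y \<notin> (\<Union>i\<in>\<Lambda>. f ` (I i \<inter> N))"
    show "transfer_fun \<Lambda> I f (rep_aefun (abs_aefun \<phi>)) y = transfer_fun \<Lambda> I f \<phi> y"
      unfolding transfer_fun_eq
    proof (rule sum.cong)
      fix i assume i: "i \<in> \<Lambda>"
      show "indicator (K i) y * (complex_of_real \<bar>deriv (h i) y\<bar> * rep_aefun (abs_aefun \<phi>) (h i y))
          = indicator (K i) y * (complex_of_real \<bar>deriv (h i) y\<bar> * \<phi> (h i y))"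
      proof (cases "y \<in> K i")
        case True
        have "h i y \<notin> N"
        proof
          assume "h i y \<in> N"
          then have "f (h i y) \<in> f ` (I i \<inter> N)" using h_mem[OF True] by blast
          then show False using y i f_h[OF True] by auto
        qed
        moreover have "h i y \<in> {0..1}" using h_mem[OF True] I01[OF i] by blast
        ultimately show ?thesis using N(2) by simp
      qed simp
    qed simp
  qed
  then show ?thesis by (simp add: transfer_op_def aefun.abs_eq_iff)
qed

text \<open>Change of variables x = h i y, on K i without a null set off which h i is
  differentiable. The image of that null set under h i is null as well, since h i is
  Lipschitz.\<close>

lemma branch_integral:
  assumes i: "i \<in> \<Lambda>" and \<phi>: "integrable unit_leb \<phi>"
  defines "A \<equiv> \<lambda>y. indicator (K i) y * (complex_of_real \<bar>deriv (h i) y\<bar> * \<phi> (h i y))"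
  shows "integrable unit_leb A" and "(LINT y|unit_leb. A y) = (LINT x|unit_leb. indicator (I i) x * \<phi> x)"
proof -
  obtain N where N: "negligible N" "\<And>y. y \<in> K i \<Longrightarrow> y \<notin> N \<Longrightarrow> (h i has_real_derivative deriv (h i) y) (at y) \<and>
       h i y \<in> diff_points f (I i) \<and> deriv (h i) y = inverse (deriv f (h i y))"
    by (rule h_deriv[OF i]) (rule that; assumption)
  have NL: "N \<in> sets lebesgue" using N(1) by (rule negligible_imp_sets)
  define S where "S = K i - N"
  have KL: "K i \<in> sets lebesgue" using is_interval_K[OF i int[OF i]] K01[OF i] by (intro interval_lebesgue) auto
  have IL: "I i \<in> sets lebesgue" using int[OF i] I01[OF i] by (intro interval_lebesgue)
  have S: "S \<in> sets lebesgue" unfolding S_def using KL NL by (rule sets.Diff)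
  have S01: "S \<subseteq> {0..1}" using K01[OF i] by (auto simp: S_def)
  define N' where "N' = h i ` (K i \<inter> N)"
  have N': "negligible N'" unfolding N'_def by (rule negligible_h[OF i N(1)])
  have inj_h: "inj_on (h i) (K i)" by (rule inj_on_inv_into) simp
  have hS: "h i ` S = I i - N'"
  proof -
    have "h i ` K i = I i" using h_f[OF i] by (force simp: image_image)
    moreover have "h i ` S = h i ` K i - h i ` (K i \<inter> N)"
      unfolding S_def using inj_on_image_set_diff[OF inj_h, of "K i" "K i \<inter> N"] by (simp add: Diff_Int)
    ultimately show ?thesis by (simp add: N'_def)
  qed
  have hSL: "h i ` S \<in> sets lebesgue"
    unfolding hS using IL negligible_imp_sets[OF N'] by (rule sets.Diff)
  have hS01: "h i ` S \<subseteq> {0..1}" unfolding hS using I01[OF i] by auto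
  have "set_integrable lebesgue {0..1} \<phi>"
    using \<phi> by (simp add: integrable_restrict_space set_integrable_def)
  then have \<phi>S: "\<phi> absolutely_integrable_on (h i ` S)"
    by (rule set_integrable_subset) (use hSL hS01 in auto)
  define F where "F y = \<bar>deriv (h i) y\<bar> *\<^sub>R \<phi> (h i y)" for y
  have cov: "F absolutely_integrable_on S \<and> integral S F = integral (h i ` S) \<phi>"
    unfolding F_def
  proof (subst has_absolute_integral_change_of_variables_real[OF S])
    show "(h i has_real_derivative deriv (h i) y) (at y within S)" if "y \<in> S" for y
      using N(2)[of y] that by (auto simp: S_def intro: has_field_derivative_at_within)
    show "inj_on (h i) S" using inj_h by (rule inj_on_subset) (auto simp: S_def)
  qed (use \<phi>S in simp)
  have restrict: "integrable unit_leb (\<lambda>x. indicator E x *\<^sub>R u x) \<and>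
      (LINT x|unit_leb. indicator E x *\<^sub>R u x) = integral E u"
    if "u absolutely_integrable_on E" "E \<subseteq> {0..1}" for E and u :: "real \<Rightarrow> complex"
  proof -
    have e: "indicator {0..1} x * indicator E x = (indicator E x :: real)" for x
      using that(2) by (auto simp: indicator_def)
    show ?thesis
      using that(1) set_lebesgue_integral_eq_integral(2)[OF that(1)]
      by (simp add: integrable_restrict_space integral_restrict_space e set_integrable_def set_lebesgue_integral_def)
  qed
  have AE1: "AE y in unit_leb. A y = indicator S y *\<^sub>R F y"
    by (rule AE_unit_lebI[OF N(1)]) (auto simp: A_def S_def F_def indicator_def scaleR_conv_of_real)
  have AE2: "AE x in unit_leb. indicator (h i ` S) x *\<^sub>R \<phi> x = indicator (I i) x * \<phi> x"
    by (rule AE_unit_lebI[OF N']) (auto simp: hS indicator_def)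
  show "integrable unit_leb A"
    using unit_leb_AE_cong(2)[OF AE1] restrict[of S F] cov S01 by simp
  have "(LINT y|unit_leb. A y) = integral S F"
    using unit_leb_AE_cong(3)[OF AE1] restrict[of S F] cov S01 by simp
  also have "\<dots> = (LINT x|unit_leb. indicator (h i ` S) x *\<^sub>R \<phi> x)"
    using restrict[OF \<phi>S hS01] cov by simp
  also have "\<dots> = (LINT x|unit_leb. indicator (I i) x * \<phi> x)"
    by (rule unit_leb_AE_cong(3)[OF AE2])
  finally show "(LINT y|unit_leb. A y) = (LINT x|unit_leb. indicator (I i) x * \<phi> x)" .
qed

lemma indicator_partition:
  fixes x :: real assumes "x \<in> {0..1}"
  shows "(\<Sum>i\<in>\<Lambda>. indicator (I i) x * z) = (z :: complex)"
proof -
  obtain i where i: "i \<in> \<Lambda>" "x \<in> I i" using cover assms by blast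
  have "indicator (I j) x * z = (if j = i then z else 0)" if "j \<in> \<Lambda>" for j
    using dj i that by (auto simp: disjoint_family_on_def indicator_def)
  then have "(\<Sum>j\<in>\<Lambda>. indicator (I j) x * z) = (\<Sum>j\<in>\<Lambda>. if j = i then z else 0)" by (intro sum.cong) auto
  then show ?thesis using fin i by simp
qed

lemma integrable_piece:
  assumes "i \<in> \<Lambda>" "integrable unit_leb \<phi>"
  shows "integrable unit_leb (\<lambda>x. indicator (I i) x * \<phi> x :: complex)"
proof -
  have "I i \<in> sets lebesgue" using int[OF assms(1)] I01[OF assms(1)] by (intro interval_lebesgue)
  then show ?thesis
    using ae_int_restr[of "I i" "abs_aefun \<phi>"] assms(2) by (simp add: ae_int.abs_eq restr.abs_eq)
qed

lemma T_lint: assumes "ae_int x" shows "ae_int (T x) \<and> lint (T x) = lint x"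
proof -
  obtain \<phi> where x: "x = abs_aefun \<phi>" by (rule aefun_cases)
  have \<phi>: "integrable unit_leb \<phi>" using assms by (simp add: x ae_int.abs_eq)
  let ?A = "\<lambda>i y. indicator (K i) y * (complex_of_real \<bar>deriv (h i) y\<bar> * \<phi> (h i y))"
  have i: "integrable unit_leb (\<lambda>y. \<Sum>i\<in>\<Lambda>. ?A i y)"
    by (intro Bochner_Integration.integrable_sum branch_integral(1) \<phi>)
  have "(LINT y|unit_leb. (\<Sum>i\<in>\<Lambda>. ?A i y)) = (\<Sum>i\<in>\<Lambda>. (LINT y|unit_leb. ?A i y))"
    by (intro Bochner_Integration.integral_sum branch_integral(1) \<phi>)
  also have "\<dots> = (\<Sum>i\<in>\<Lambda>. (LINT x|unit_leb. indicator (I i) x * \<phi> x))"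
    by (intro sum.cong refl branch_integral(2) \<phi>)
  also have "\<dots> = (LINT x|unit_leb. (\<Sum>i\<in>\<Lambda>. indicator (I i) x * \<phi> x))"
    by (intro Bochner_Integration.integral_sum[symmetric] integrable_piece \<phi>)
  also have "\<dots> = (LINT x|unit_leb. \<phi> x)"
    by (intro Bochner_Integration.integral_cong refl) (simp add: indicator_partition)
  finally show ?thesis
    using i by (simp add: x transfer_abs ae_int.abs_eq lint.abs_eq transfer_fun_eq[abs_def])
qed

text \<open>Pointwise the image of \<phi> is dominated by the image of |\<phi>|, and the integral of
  the latter is preserved.\<close>

lemma T_norm1: assumes "ae_int x" shows "norm1 (T x) \<le> norm1 x"
proof -
  obtain \<phi> where x: "x = abs_aefun \<phi>" by (rule aefun_cases)
  have \<phi>: "integrable unit_leb \<phi>" using assms by (simp add: x ae_int.abs_eq)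
  define \<Phi> where "\<Phi> = (\<lambda>x. complex_of_real (norm (\<phi> x)))"
  have \<Phi>: "integrable unit_leb \<Phi>" unfolding \<Phi>_def using \<phi> by (intro integrable_of_real integrable_norm)
  have ae: "ae_int (abs_aefun \<Phi>)" using \<Phi> by (simp add: ae_int.abs_eq)
  have pt: "norm (transfer_fun \<Lambda> I f \<phi> y) \<le> Re (transfer_fun \<Lambda> I f \<Phi> y)" for y
    unfolding transfer_fun_eq Re_sum
    by (rule sum_norm_le) (auto simp: \<Phi>_def norm_mult indicator_def)
  have iT: "integrable unit_leb (transfer_fun \<Lambda> I f \<phi>)"
    using T_lint[OF assms] by (simp add: x transfer_abs ae_int.abs_eq)
  have iT\<Phi>: "integrable unit_leb (transfer_fun \<Lambda> I f \<Phi>)"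
    using T_lint[OF ae] by (simp add: transfer_abs ae_int.abs_eq)
  have "norm1 (T x) = (LINT y|unit_leb. norm (transfer_fun \<Lambda> I f \<phi> y))"
    by (simp add: x transfer_abs norm1.abs_eq)
  also have "\<dots> \<le> (LINT y|unit_leb. Re (transfer_fun \<Lambda> I f \<Phi> y))"
    using iT iT\<Phi> pt by (intro integral_mono integrable_norm integrable_Re)
  also have "\<dots> = Re (LINT y|unit_leb. transfer_fun \<Lambda> I f \<Phi> y)"
    by (rule integral_Re[OF iT\<Phi>])
  also have "\<dots> = Re (LINT y|unit_leb. \<Phi> y)"
    using T_lint[OF ae] by (simp add: transfer_abs lint.abs_eq)
  also have "\<dots> = (LINT y|unit_leb. Re (\<Phi> y))"
    by (rule integral_Re[OF \<Phi>, symmetric])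
  also have "\<dots> = norm1 x" by (simp add: \<Phi>_def x norm1.abs_eq)
  finally show ?thesis .
qed

lemma L1op_T: "L1op T"
  unfolding L1op_def
proof (intro conjI allI impI)
  fix x y c
  obtain \<phi> \<psi> where xy: "x = abs_aefun \<phi>" "y = abs_aefun \<psi>" by (metis aefun_cases)
  have "transfer_fun \<Lambda> I f (\<lambda>t. \<phi> t + \<psi> t) = (\<lambda>t. transfer_fun \<Lambda> I f \<phi> t + transfer_fun \<Lambda> I f \<psi> t)"
    by (simp add: fun_eq_iff transfer_fun_eq algebra_simps sum.distrib)
  then show "T (x + y) = T x + T y"
    by (simp add: xy plus_aefun.abs_eq transfer_abs)
  have "transfer_fun \<Lambda> I f (\<lambda>t. c * \<phi> t) = (\<lambda>t. c * transfer_fun \<Lambda> I f \<phi> t)"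
    by (simp add: fun_eq_iff transfer_fun_eq sum_distrib_left mult_ac)
  then show "T (cscale c x) = cscale c (T x)"
    by (simp add: xy cscale.abs_eq transfer_abs)
qed (use T_lint T_norm1 in auto)

lemma deriv_h_le:
  assumes i: "i \<in> \<Lambda>"
  obtains N where "negligible N" "\<And>y. y \<in> K i \<Longrightarrow> y \<notin> N \<Longrightarrow> \<bar>deriv (h i) y\<bar> \<le> 1"
proof -
  obtain N where N: "negligible N" "\<And>y. y \<in> K i \<Longrightarrow> y \<notin> N \<Longrightarrow> (h i has_real_derivative deriv (h i) y) (at y) \<and>
       h i y \<in> diff_points f (I i) \<and> deriv (h i) y = inverse (deriv f (h i y))"
    by (rule h_deriv[OF i]) (rule that; assumption)
  have "\<bar>deriv (h i) y\<bar> \<le> 1" if "y \<in> K i" "y \<notin> N" for y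
  proof -
    have "1 \<le> \<bar>deriv f (h i y)\<bar>" using lam_le[OF i] N(2)[OF that] lam by force
    then have "inverse \<bar>deriv f (h i y)\<bar> \<le> 1" by (simp add: inverse_le_1_iff)
    then show ?thesis using N(2)[OF that] by simp
  qed
  then show ?thesis using that N(1) by blast
qed

text \<open>Each branch has weight at most 1 almost everywhere since |f'| > 1, and it contributes at
  most one value. The \<open>+ 1\<close> makes the constant positive without discussing an empty
  \<Lambda>.\<close>

lemma posop_T: "posop (real (card \<Lambda>) + 1) T"
  unfolding posop_def
proof (intro conjI allI impI)
  fix R :: real and x assume R: "0 \<le> R" and x: "ae_bd R x"
  obtain \<phi> where \<phi>: "x = abs_aefun \<phi>" by (rule aefun_cases)
  have "AE t in unit_leb. Im (\<phi> t) = 0 \<and> 0 \<le> Re (\<phi> t) \<and> Re (\<phi> t) \<le> R"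
    using x unfolding \<phi> ae_bd.abs_eq .
  then obtain N where nN: "negligible N"
    and N: "\<And>t. t \<in> {0..1} \<Longrightarrow> t \<notin> N \<Longrightarrow> Im (\<phi> t) = 0 \<and> 0 \<le> Re (\<phi> t) \<and> Re (\<phi> t) \<le> R"
    by (rule AE_unit_lebE) (rule that; assumption)
  have "\<forall>i\<in>\<Lambda>. \<exists>M. negligible M \<and> (\<forall>y\<in>K i. y \<notin> M \<longrightarrow> \<bar>deriv (h i) y\<bar> \<le> 1)"
    using deriv_h_le by metis
  then obtain M where M: "\<And>i. i \<in> \<Lambda> \<Longrightarrow> negligible (M i)"
    "\<And>i y. i \<in> \<Lambda> \<Longrightarrow> y \<in> K i \<Longrightarrow> y \<notin> M i \<Longrightarrow> \<bar>deriv (h i) y\<bar> \<le> 1" by metis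
  have neg: "negligible (\<Union>i\<in>\<Lambda>. M i \<union> f ` (I i \<inter> N))"
    by (rule negligible_Union) (use fin negligible_f[OF _ nN] M(1) in auto)
  have "AE y in unit_leb. Im (transfer_fun \<Lambda> I f \<phi> y) = 0 \<and> 0 \<le> Re (transfer_fun \<Lambda> I f \<phi> y) \<and>
      Re (transfer_fun \<Lambda> I f \<phi> y) \<le> (real (card \<Lambda>) + 1) * R"
  proof (rule AE_unit_lebI[OF neg])
    fix y assume y: "y \<notin> (\<Union>i\<in>\<Lambda>. M i \<union> f ` (I i \<inter> N))"
    define a where "a i = indicator (K i) y * (complex_of_real \<bar>deriv (h i) y\<bar> * \<phi> (h i y))" for i
    have a: "Im (a i) = 0 \<and> 0 \<le> Re (a i) \<and> Re (a i) \<le> R" if i: "i \<in> \<Lambda>" for i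
    proof (cases "y \<in> K i")
      case True
      have "h i y \<notin> N"
      proof
        assume "h i y \<in> N"
        then have "f (h i y) \<in> f ` (I i \<inter> N)" using h_mem[OF True] by blast
        then show False using y i f_h[OF True] by auto
      qed
      then have b: "Im (\<phi> (h i y)) = 0" "0 \<le> Re (\<phi> (h i y))" "Re (\<phi> (h i y)) \<le> R"
        using N[of "h i y"] h_mem[OF True] I01[OF i] by auto
      have "\<bar>deriv (h i) y\<bar> \<le> 1" using M(2)[OF i True] y i by auto
      then have "\<bar>deriv (h i) y\<bar> * Re (\<phi> (h i y)) \<le> 1 * R" using b by (intro mult_mono) auto
      then show ?thesis using True b by (simp add: a_def)
    qed (use R in \<open>simp add: a_def\<close>)
    have "(\<Sum>i\<in>\<Lambda>. Re (a i)) \<le> (\<Sum>i\<in>\<Lambda>. R)" using a by (intro sum_mono) auto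
    then have "(\<Sum>i\<in>\<Lambda>. Re (a i)) \<le> (real (card \<Lambda>) + 1) * R" using R by (simp add: distrib_right)
    moreover have "0 \<le> (\<Sum>i\<in>\<Lambda>. Re (a i))" using a by (intro sum_nonneg) auto
    moreover have "(\<Sum>i\<in>\<Lambda>. Im (a i)) = 0" using a by (intro sum.neutral) auto
    ultimately show "Im (transfer_fun \<Lambda> I f \<phi> y) = 0 \<and> 0 \<le> Re (transfer_fun \<Lambda> I f \<phi> y) \<and>
      Re (transfer_fun \<Lambda> I f \<phi> y) \<le> (real (card \<Lambda>) + 1) * R"
      unfolding transfer_fun_eq a_def[symmetric] by (simp only: Re_sum Im_sum)
  qed
  then show "ae_bd ((real (card \<Lambda>) + 1) * R) (T x)"
    by (simp add: \<phi> transfer_abs ae_bd.abs_eq)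
qed simp

section \<open>Branch structure of the transfer operator\<close>

lemma finite_preimage: assumes "finite F" shows "finite {x \<in> {0..1}. f x \<in> F}"
proof -
  have "{x \<in> {0..1}. f x \<in> F} \<subseteq> (\<Union>i\<in>\<Lambda>. f -` F \<inter> I i)" using cover by blast
  moreover have "finite (\<Union>i\<in>\<Lambda>. f -` F \<inter> I i)"
    using fin inj assms by (intro finite_UN_I finite_vimage_IntI)
  ultimately show ?thesis by (rule finite_subset)
qed

text \<open>An interval that meets I i and also leaves it must contain the endpoint crossed on the
  way.\<close>

lemma interval_in_piece:
  assumes E: "is_interval E" "E \<subseteq> {0..1}" "x \<in> E" and i: "i \<in> \<Lambda>" "x \<in> I i"
    and ends: "Inf (I i) \<notin> E" "Sup (I i) \<notin> E"
  shows "E \<subseteq> I i"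
proof (rule subsetI, rule ccontr)
  fix y assume y: "y \<in> E" "y \<notin> I i"
  have bd: "bdd_below (I i)" "bdd_above (I i)"
    using bdd_below_mono[OF bdd_below_Icc I01[OF i(1)]] bdd_above_mono[OF bdd_above_Icc I01[OF i(1)]] by auto
  have ne: "I i \<noteq> {}" using i(2) by blast
  show False
  proof (cases "y < x")
    case True
    have "y \<le> z" if "z \<in> I i" for z
    proof (rule ccontr)
      assume "\<not> y \<le> z"
      then have "y \<in> I i" by (intro mem_is_interval_1_I[OF int[OF i(1)] that i(2)]) (use True in auto)
      then show False using y(2) by blast
    qed
    then have "y \<le> Inf (I i)" using ne by (intro cInf_greatest)
    moreover have "Inf (I i) \<le> x" using i(2) bd(1) by (rule cInf_lower)
    ultimately have "Inf (I i) \<in> E" by (rule mem_is_interval_1_I[OF E(1) y(1) E(3)])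
    then show False using ends(1) by blast
  next
    case False
    then have xy: "x \<le> y" by simp
    have "z \<le> y" if "z \<in> I i" for z
    proof (rule ccontr)
      assume "\<not> z \<le> y"
      then have "y \<in> I i" by (intro mem_is_interval_1_I[OF int[OF i(1)] i(2) that]) (use xy in auto)
      then show False using y(2) by blast
    qed
    then have "Sup (I i) \<le> y" using ne by (intro cSup_least)
    moreover have "x \<le> Sup (I i)" using i(2) bd(2) by (rule cSup_upper)
    ultimately have "Sup (I i) \<in> E" using mem_is_interval_1_I[OF E(1) E(3) y(1)] by blast
    then show False using ends(2) by blast
  qed
qed

text \<open>The exceptional set contains the endpoints of the pieces, so that an interval avoiding
  it lies in one piece and meets one branch. It also contains the points that cut the modulus of the
  Jacobian into parts of oscillation at most \<delta>.\<close>

lemma branched_T: "branched \<beta> f T (1 / L) (1 / lam)"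
  unfolding branched_def
proof (intro allI impI)
  fix \<delta> :: real assume \<delta>: "0 < \<delta>"
  have "\<forall>i\<in>\<Lambda>. \<exists>e v B. mono v \<and> (\<forall>t. 0 \<le> v t \<and> v t \<le> B) \<and> (\<forall>t. lam \<le> e t \<and> e t \<le> L) \<and>
    (\<forall>x y. \<bar>e x - e y\<bar> \<le> \<bar>v x - v y\<bar> powr \<beta>) \<and> (\<forall>x \<in> diff_points f (I i). e x = \<bar>deriv f x\<bar>)"
  proof
    fix i assume i: "i \<in> \<Lambda>"
    show "\<exists>e v B. mono v \<and> (\<forall>t. 0 \<le> v t \<and> v t \<le> B) \<and> (\<forall>t. lam \<le> e t \<and> e t \<le> L) \<and>
      (\<forall>x y. \<bar>e x - e y\<bar> \<le> \<bar>v x - v y\<bar> powr \<beta>) \<and> (\<forall>x \<in> diff_points f (I i). e x = \<bar>deriv f x\<bar>)"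
    proof -
      obtain e v B where J: "mono v" "\<And>t. 0 \<le> v t \<and> v t \<le> B" "\<And>t. lam \<le> e t \<and> e t \<le> L"
        "\<And>x y. \<bar>e x - e y\<bar> \<le> \<bar>v x - v y\<bar> powr \<beta>"
        "\<And>x. x \<in> diff_points f (I i) \<Longrightarrow> e x = \<bar>deriv f x\<bar>"
        by (rule jacobian_control[OF i]) (rule that; assumption)
      show ?thesis
        by (rule exI[of _ e], rule exI[of _ v], rule exI[of _ B]) (use J in simp)
    qed
  qed
  then obtain e v B where ev: "\<And>i. i \<in> \<Lambda> \<Longrightarrow> mono (v i) \<and> (\<forall>t. 0 \<le> v i t \<and> v i t \<le> B i) \<and>
    (\<forall>t. lam \<le> e i t \<and> e i t \<le> L) \<and> (\<forall>x y. \<bar>e i x - e i y\<bar> \<le> \<bar>v i x - v i y\<bar> powr \<beta>) \<and>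
    (\<forall>x \<in> diff_points f (I i). e i x = \<bar>deriv f x\<bar>)"
    by metis
  have "\<forall>i\<in>\<Lambda>. \<exists>F. finite F \<and> (\<forall>E x y. is_interval E \<longrightarrow> E \<inter> F = {} \<longrightarrow> x \<in> E \<longrightarrow> y \<in> E \<longrightarrow> \<bar>v i x - v i y\<bar> \<le> \<delta>)"
  proof
    fix i assume i: "i \<in> \<Lambda>"
    have v: "mono (v i)" "\<And>t. 0 \<le> v i t \<and> v i t \<le> B i" using ev[OF i] by auto
    show "\<exists>F. finite F \<and> (\<forall>E x y. is_interval E \<longrightarrow> E \<inter> F = {} \<longrightarrow> x \<in> E \<longrightarrow> y \<in> E \<longrightarrow> \<bar>v i x - v i y\<bar> \<le> \<delta>)"
      by (rule mono_small_pieces[OF v \<delta>]) blast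
  qed
  then obtain F where F: "\<And>i. i \<in> \<Lambda> \<Longrightarrow> finite (F i)"
    "\<And>i E x y. i \<in> \<Lambda> \<Longrightarrow> is_interval E \<Longrightarrow> E \<inter> F i = {} \<Longrightarrow> x \<in> E \<Longrightarrow> y \<in> E \<Longrightarrow> \<bar>v i x - v i y\<bar> \<le> \<delta>"
    by metis
  define G where "G = (\<Union>i\<in>\<Lambda>. F i \<union> {Inf (I i), Sup (I i)})"
  show "\<exists>F. finite F \<and> (\<forall>E. is_interval E \<longrightarrow> E \<subseteq> {0..1} \<longrightarrow> E \<inter> F = {} \<longrightarrow> branch_at \<beta> f T (1 / L) (1 / lam) \<delta> E)"
  proof (rule exI[of _ G], intro conjI allI impI)
    show "finite G" using fin F(1) by (simp add: G_def)
    fix E :: "real set" assume E: "is_interval E" "E \<subseteq> {0..1}" "E \<inter> G = {}"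
    show "branch_at \<beta> f T (1 / L) (1 / lam) \<delta> E"
    proof (cases "E = {}")
      case True
      have "T (abs_aefun (\<lambda>x. indicator {} x * \<phi> x)) = abs_aefun (\<lambda>y. 0)" for \<phi> :: "real \<Rightarrow> complex"
        by (simp add: transfer_abs transfer_fun_eq[abs_def])
      then show ?thesis
        unfolding branch_at_def True by (intro exI[of _ "{}"] exI[of _ "\<lambda>y. y"] exI[of _ "\<lambda>y. 0"]) (simp add: mono_on_def)
    next
      case False
      then obtain x0 where x0: "x0 \<in> E" by blast
      then obtain i where i: "i \<in> \<Lambda>" "x0 \<in> I i" using cover E(2) by blast
      have "Inf (I i) \<in> G" "Sup (I i) \<in> G" using i(1) by (auto simp: G_def)
      then have EI: "E \<subseteq> I i" using E(3) by (intro interval_in_piece[OF E(1,2) x0 i]) auto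
      have EF: "E \<inter> F i = {}" using E(3) i(1) by (auto simp: G_def)
      note evi = ev[OF i(1)]
      have em: "lam \<le> e i t" "e i t \<le> L" "0 < e i t" for t using evi lam by (auto intro: less_le_trans[of 0 lam])
      define KE where "KE = f ` E"
      have KEK: "KE \<subseteq> K i" using EI by (auto simp: KE_def)
      have hE: "h i y \<in> E" if "y \<in> KE" for y using that EI h_f[OF i(1)] by (force simp: KE_def)
      define \<sigma> where "\<sigma> = (if mono_on (K i) (h i) then 1 else - 1 :: real)"
      have \<sigma>: "\<bar>\<sigma>\<bar> = 1" by (simp add: \<sigma>_def)
      define u where "u y = \<sigma> * v i (h i y)" for y
      have um: "mono_on KE u"
      proof (rule mono_onI)
        fix y z assume yz: "y \<in> KE" "z \<in> KE" "y \<le> z"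
        then have yz': "y \<in> K i" "z \<in> K i" using KEK by auto
        have vm: "v i s \<le> v i t" if "s \<le> t" for s t using evi that by (simp add: mono_def)
        show "u y \<le> u z"
        proof (cases "mono_on (K i) (h i)")
          case True
          then have "h i y \<le> h i z" using yz yz' by (simp add: mono_on_def)
          then show ?thesis using True vm by (simp add: u_def \<sigma>_def)
        next
          case False
          then have "mono_on (K i) (\<lambda>y. - h i y)" using h_mono[OF i(1)] by blast
          then have "h i z \<le> h i y" using yz yz' by (auto simp: mono_on_def)
          then show ?thesis using False vm by (simp add: u_def \<sigma>_def)
        qed
      qed
      have uabs: "\<bar>u y - u z\<bar> = \<bar>v i (h i y) - v i (h i z)\<bar>" for y z
        using \<sigma> by (simp add: u_def abs_mult flip: right_diff_distrib)
      \<comment> \<open>The weight uses the extension \<open>e\<close> and not the derivative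
        itself, so it is controlled at every point; it agrees with |deriv (h i)| outside a null set.
        Since e >= 1, passing to 1 / e does not increase differences.\<close>
      define g where "g y = 1 / e i (h i y)" for y
      have gd: "\<bar>g y - g z\<bar> \<le> \<bar>u y - u z\<bar> powr \<beta>" for y z
      proof -
        let ?a = "e i (h i y)" and ?b = "e i (h i z)"
        have ab: "1 \<le> ?a * ?b" using em[of "h i y"] em[of "h i z"] lam mult_mono[of 1 ?a 1 ?b] by simp
        have "g y - g z = (?b - ?a) / (?a * ?b)"
          using em(3)[of "h i y"] em(3)[of "h i z"] by (simp add: g_def field_simps)
        then have "\<bar>g y - g z\<bar> = \<bar>?a - ?b\<bar> / (?a * ?b)"
          using ab by (simp add: abs_divide abs_minus_commute)
        also have "\<dots> \<le> \<bar>?a - ?b\<bar> / 1" using ab by (intro divide_left_mono) auto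
        also have "\<dots> \<le> \<bar>u y - u z\<bar> powr \<beta>" unfolding uabs using evi by simp
        finally show ?thesis .
      qed
      have gb: "1 / L \<le> g y \<and> g y \<le> 1 / lam" for y
        using em[of "h i y"] lam unfolding g_def by (intro conjI divide_left_mono) auto
      obtain N where N: "negligible N" "\<And>y. y \<in> K i \<Longrightarrow> y \<notin> N \<Longrightarrow> (h i has_real_derivative deriv (h i) y) (at y) \<and>
         h i y \<in> diff_points f (I i) \<and> deriv (h i) y = inverse (deriv f (h i y))"
        by (rule h_deriv[OF i(1)]) (rule that; assumption)
      have op: "T (abs_aefun (\<lambda>x. indicator E x * \<phi> x)) =
          abs_aefun (\<lambda>y. indicator KE y * (complex_of_real (g y) * \<phi> (h i y)))" for \<phi>
      proof -
        have "AE y in unit_leb. transfer_fun \<Lambda> I f (\<lambda>x. indicator E x * \<phi> x) y =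
            indicator KE y * (complex_of_real (g y) * \<phi> (h i y))"
        proof (rule AE_unit_lebI[OF N(1)])
          fix y assume y: "y \<notin> N"
          have z: "indicator (K j) y * (complex_of_real \<bar>deriv (h j) y\<bar> * (indicator E (h j y) * \<phi> (h j y))) =
              (if j = i then indicator KE y * (complex_of_real (g y) * \<phi> (h i y)) else 0)" if j: "j \<in> \<Lambda>" for j
          proof (cases "j = i")
            case True
            show ?thesis
            proof (cases "y \<in> KE")
              case y': True
              then have yK: "y \<in> K i" using KEK by blast
              have "\<bar>deriv (h i) y\<bar> = g y"
                using N(2)[OF yK y] evi by (simp add: g_def abs_inverse inverse_eq_divide)
              then show ?thesis using True y' yK hE[OF y'] by (simp add: indicator_def)
            next
              case y': False
              have "h i y \<notin> E" if "y \<in> K i"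
              proof
                assume "h i y \<in> E"
                then have "f (h i y) \<in> KE" unfolding KE_def by (rule imageI)
                then show False using y' f_h[OF that] by simp
              qed
              then show ?thesis using True y' by (auto simp: indicator_def)
            qed
          next
            case False
            have "h j y \<notin> E" if "y \<in> K j"
            proof
              assume "h j y \<in> E"
              then have "h j y \<in> I i \<inter> I j" using EI h_mem[OF that] by blast
              then show False using dj i(1) j False by (auto simp: disjoint_family_on_def)
            qed
            then show ?thesis using False by (auto simp: indicator_def)
          qed
          have "transfer_fun \<Lambda> I f (\<lambda>x. indicator E x * \<phi> x) y =
              (\<Sum>j\<in>\<Lambda>. if j = i then indicator KE y * (complex_of_real (g y) * \<phi> (h i y)) else 0)"
            unfolding transfer_fun_eq by (intro sum.cong refl z)
          then show "transfer_fun \<Lambda> I f (\<lambda>x. indicator E x * \<phi> x) y =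
              indicator KE y * (complex_of_real (g y) * \<phi> (h i y))"
            using fin i(1) by simp
        qed
        then show ?thesis by (simp add: transfer_abs aefun.abs_eq_iff)
      qed
      have du: "\<bar>u y - u z\<bar> \<le> \<delta>" if "y \<in> KE" "z \<in> KE" for y z
        unfolding uabs by (rule F(2)[OF i(1) E(1) EF hE[OF that(1)] hE[OF that(2)]])
      show ?thesis
        unfolding branch_at_def
      proof (rule exI[of _ KE], rule exI[of _ "h i"], rule exI[of _ g], rule exI[of _ u], intro conjI allI ballI)
        show "is_interval KE" unfolding KE_def by (rule is_interval_K[OF i(1) E(1) EI])
        show "KE \<subseteq> {0..1}" using KEK K01[OF i(1)] by blast
        show "h i ` KE \<subseteq> E" using hE by blast
        show "f (h i y) = y" if "y \<in> KE" for y using KEK that f_h by blast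
        show "mono_on KE (h i) \<or> mono_on KE (\<lambda>y. - h i y)"
          using h_mono[OF i(1)] KEK by (auto intro: mono_on_subset)
      qed (use op gb um du gd in auto)
    qed
  qed
qed

end

section \<open>Choice of the iterate and of the exponent p\<close>

lemma exists_power_less:
  fixes x y :: real
  assumes "0 \<le> x" "x < 1" "0 < y"
  shows "\<exists>n>0. x ^ n < y"
proof -
  obtain n where "x ^ n < y" using real_arch_pow_inv[OF assms(3,2)] by blast
  moreover have "x ^ Suc n \<le> x ^ n" using assms by (intro power_decreasing) auto
  ultimately show ?thesis by (intro exI[of _ "Suc n"]) auto
qed

context expanding_map
begin

lemma small_on_T_pow: "\<exists>m. small_on \<beta> 192 ((1 / lam) ^ n) m (T ^^ n)"
proof (rule small_on_branched)
  show "branched \<beta> (f ^^ n) (T ^^ n) ((1 / L) ^ n) ((1 / lam) ^ n)"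
    using L lam by (intro branched_funpow[OF branched_T finite_preimage \<beta>]) auto
  show "L1op (T ^^ n)" by (rule L1op_funpow[OF L1op_T])
  show "(1 / L) ^ n \<le> (1 / lam) ^ n"
    using L lam by (intro power_mono divide_left_mono) auto
qed (use \<beta> L in auto)

lemma lam_powr_pow: "((1 / lam) ^ n) powr s = (lam powr (- s)) ^ n"
proof -
  have "((1 / lam) ^ n) powr s = ((1 / lam) powr s) ^ n"
    using lam by (simp add: powr_power mult.commute flip: powr_realpow) (simp add: powr_powr mult.commute)
  also have "(1 / lam) powr s = lam powr (- s)"
    using lam by (simp add: powr_divide powr_minus_divide)
  finally show ?thesis .
qed

lemma kernel_const_pos: "0 < \<eta> \<Longrightarrow> 0 < kernel_const \<eta>"
  using powr_less_mono[of "- \<eta>" 0 "2 :: real"] by (simp add: kernel_const_def)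

lemma bounded_op_T:
  assumes s: "0 < s" and p: "1 \<le> p" and sp: "s < \<beta> / p" and q: "1 \<le> q"
  shows "bounded_op (besov s p q) (besov_norm s p q) T"
proof -
  interpret besov_params s p q using s p q by unfold_locales
  obtain m where "small_on \<beta> 192 (1 / lam) m T" using small_on_T_pow[of 1] by auto
  then show ?thesis
    using s sp lam by (intro bounded_op_besov[OF L1op_T posop_T, of "min s (\<beta> / p - s)"]) auto
qed

lemma ess_radius_T_le:
  assumes s: "0 < s" and p: "1 \<le> p" and q: "1 \<le> q" and \<eta>: "0 < \<eta>" "\<eta> \<le> s" "\<eta> \<le> \<beta> / p - s" and \<rho>: "0 < \<rho>"
    and small: "(2 * (real (card \<Lambda>) + 1) ^ n) powr (1 - 1 / p) * 192 powr (1 / p) * ((lam powr (- s)) ^ n * kernel_const \<eta>) < \<rho> ^ n"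
  shows "ess_radius (besov s p q) (besov_norm s p q) T \<le> ennreal \<rho>"
proof -
  interpret besov_params s p q using s p q by unfold_locales
  obtain m1 where m1: "small_on \<beta> 192 (1 / lam) m1 T" using small_on_T_pow[of 1] by auto
  obtain m where m: "small_on \<beta> 192 ((1 / lam) ^ n) m (T ^^ n)" using small_on_T_pow by blast
  obtain m' where m': "small_on \<beta> 192 (1 / lam) m' T" "small_on \<beta> 192 ((1 / lam) ^ n) m' (T ^^ n)"
  proof (rule that)
    show "small_on \<beta> 192 (1 / lam) (max m1 m) T" "small_on \<beta> 192 ((1 / lam) ^ n) (max m1 m) (T ^^ n)"
      using m1 m unfolding small_on_def by auto
  qed
  show ?thesis
  proof (rule ess_radius_le[OF L1op_T posop_T \<eta> _ _ m'(1) _ _ m'(2) \<rho>])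
    show "(2 * (real (card \<Lambda>) + 1) ^ n) powr (1 - 1 / p) * 192 powr (1 / p) * (((1 / lam) ^ n) powr s * kernel_const \<eta>) < \<rho> ^ n"
      unfolding lam_powr_pow by (rule small)
  qed (use lam in auto)
qed

text \<open>At p = 1 the preimage factor has the exponent 0, so the n-th iterate contributes
  \<open>192 * kernel_const \<eta>\<close> times Y^n with Y = lam^(-s). The constant loses against
  (1 + e / Y)^n for large n, hence every radius above Y is admissible.\<close>

lemma ess_radius_T_1:
  assumes s: "0 < s" "s < \<beta>" and q: "1 \<le> q"
  shows "ess_radius (besov s 1 q) (besov_norm s 1 q) T \<le> ennreal (lam powr (- s))"
proof (rule ennreal_le_epsilon)
  fix e :: real assume e: "0 < e"
  define \<eta> where "\<eta> = min s (\<beta> - s)"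
  have \<eta>: "0 < \<eta>" "\<eta> \<le> s" "\<eta> \<le> \<beta> / 1 - s" using s by (auto simp: \<eta>_def)
  define Y where "Y = lam powr (- s)"
  have Y: "0 < Y" using lam by (simp add: Y_def)
  have "0 \<le> Y / (Y + e)" "Y / (Y + e) < 1" using Y e by auto
  moreover have "0 < 1 / (192 * kernel_const \<eta>)" using kernel_const_pos[OF \<eta>(1)] by simp
  ultimately obtain n where n: "(Y / (Y + e)) ^ n < 1 / (192 * kernel_const \<eta>)" using exists_power_less by blast
  have *: "Y ^ n * (192 * kernel_const \<eta>) < (Y + e) ^ n"
    using n Y e kernel_const_pos[OF \<eta>(1)] by (simp add: power_divide field_simps)
  have "ess_radius (besov s 1 q) (besov_norm s 1 q) T \<le> ennreal (Y + e)"
  proof (rule ess_radius_T_le[OF s(1) order_refl q \<eta>])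
    show "(2 * (real (card \<Lambda>) + 1) ^ n) powr (1 - 1 / 1) * 192 powr (1 / 1) * ((lam powr (- s)) ^ n * kernel_const \<eta>) < (Y + e) ^ n"
      using * by (simp add: Y_def mult_ac add_nonneg_pos)
    show "0 < Y + e" using Y e by simp
  qed
  then show "ess_radius (besov s 1 q) (besov_norm s 1 q) T \<le> ennreal (lam powr (- s)) + ennreal e"
    using Y e by (simp add: Y_def)
qed

text \<open>The order of the choices matters: the iterate n is fixed first, with room to spare at p
  = 1, and only then is p taken so close to 1 that the preimage factor B^(1 - 1/p) is at most 2. The
  lower bound 1 for the spectral radius comes from the preserved integral.\<close>

lemma quasi_compact_T:
  assumes s: "0 < s" "s < \<beta>" and q: "1 \<le> q"
  shows "\<exists>p0>1. \<forall>p\<in>{1..<p0}. \<beta> < 1 / p \<and> quasi_compact (besov s p q) (besov_norm s p q) T"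
proof -
  \<comment> \<open>A rate that serves all p considered, because \<beta>/p - s >= (\<beta> - s) / 2
    for them.\<close>
  define \<eta> where "\<eta> = min s ((\<beta> - s) / 2)"
  have \<eta>: "0 < \<eta>" "\<eta> \<le> s" "\<eta> \<le> (\<beta> - s) / 2"
  proof -
    show "0 < \<eta>" using s by (simp add: \<eta>_def)
    show "\<eta> \<le> s" unfolding \<eta>_def by (rule min.cobounded1)
    show "\<eta> \<le> (\<beta> - s) / 2" unfolding \<eta>_def by (rule min.cobounded2)
  qed
  define Y where "Y = lam powr (- s)"
  have Y: "0 \<le> Y" "Y < 1" using lam s powr_less_mono[of "- s" 0 lam] by (auto simp: Y_def)
  have "0 < 1 / (4 * 192 * kernel_const \<eta>)" using kernel_const_pos[OF \<eta>(1)] by simp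
  \<comment> \<open>The factor 4 pays for the preimage factor 2 and for the final bound 1/2.\<close>
  then obtain n where n: "0 < n" "Y ^ n < 1 / (4 * 192 * kernel_const \<eta>)" using exists_power_less[OF Y] by blast
  then have Yn: "2 * 192 * (Y ^ n * kernel_const \<eta>) < 1 / 2" using kernel_const_pos[OF \<eta>(1)] by (simp add: field_simps)
  define B where "B = 2 * (real (card \<Lambda>) + 1) ^ n"
  have B: "2 \<le> B" unfolding B_def using one_le_power[of "real (card \<Lambda>) + 1" n] by simp
  have lB: "0 < log 2 B" using B by simp
  \<comment> \<open>The three bounds give \<beta> < 1/p, then \<beta>/p >= (\<beta> + s) / 2, and
    finally B^(1 - 1/p) <= B^(p - 1) <= 2.\<close>
  define p0 where "p0 = Min {1 / \<beta>, 2 * \<beta> / (\<beta> + s), 1 + 1 / log 2 B}"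
  have p0: "1 < p0" using \<beta> s lB by (simp add: p0_def)
  \<comment> \<open>The n-th root of 1/2: a radius below 1 is all that the comparison with the
    spectral radius asks for.\<close>
  define \<rho> where "\<rho> = (1 / 2 :: real) powr (1 / real n)"
  have \<rho>: "0 < \<rho>" "\<rho> < 1" "\<rho> ^ n = 1 / 2"
    using n(1) powr_less_mono'[of "1 / 2 :: real" 0 "1 / real n"]
    by (auto simp: \<rho>_def powr_powr simp flip: powr_realpow)
  have "\<beta> < 1 / p \<and> quasi_compact (besov s p q) (besov_norm s p q) T" if "p \<in> {1..<p0}" for p
  proof
    have p: "1 \<le> p" "p < 1 / \<beta>" "p < 2 * \<beta> / (\<beta> + s)" "p < 1 + 1 / log 2 B" using that by (auto simp: p0_def)
    show "\<beta> < 1 / p" using p \<beta> by (simp add: field_simps)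
    have a: "(\<beta> + s) / 2 \<le> \<beta> / p" using p \<beta> s by (simp add: field_simps)
    have "x \<le> t - s" if "(\<beta> + s) / 2 \<le> t" "x \<le> (\<beta> - s) / 2" for x t
      using that by (simp add: field_simps)
    from this[OF a \<eta>(3)] have \<eta>p: "\<eta> \<le> \<beta> / p - s" .
    have "1 - 1 / p \<le> p - 1"
    proof -
      have "0 \<le> (p - 1) * (p - 1) / p" using p(1) by simp
      also have "(p - 1) * (p - 1) / p = (p - 1) - (1 - 1 / p)" using p(1) by (simp add: field_simps)
      finally show ?thesis by simp
    qed
    then have "B powr (1 - 1 / p) \<le> B powr (1 / log 2 B)" using B p(4) by (intro powr_mono) auto
    also have "B powr (1 / log 2 B) = (2 powr log 2 B) powr (1 / log 2 B)" using B by simp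
    also have "\<dots> = 2" using lB by (simp only: powr_powr) simp
    finally have B2: "B powr (1 - 1 / p) \<le> 2" .
    have c192: "(192::real) powr (1 / p) \<le> 192" using powr_mono[of "1 / p" 1 "192 :: real"] p(1) by simp
    have "B powr (1 - 1 / p) * 192 powr (1 / p) * (Y ^ n * kernel_const \<eta>) \<le> 2 * 192 * (Y ^ n * kernel_const \<eta>)"
      using B2 c192 Y kernel_const_pos[OF \<eta>(1)] by (intro mult_right_mono mult_mono) auto
    also have "\<dots> < \<rho> ^ n" using Yn \<rho>(3) by simp
    finally have "ess_radius (besov s p q) (besov_norm s p q) T \<le> ennreal \<rho>"
      unfolding B_def Y_def by (rule ess_radius_T_le[OF s(1) p(1) q \<eta>(1,2) \<eta>p \<rho>(1)])
    also have "ennreal \<rho> < 1" using \<rho> by (simp flip: ennreal_1 add: ennreal_less_iff)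
    also have "1 \<le> spec_radius (besov s p q) (besov_norm s p q) T"
    proof -
      interpret besov_params s p q using s p q by unfold_locales
      show ?thesis by (rule spec_radius_ge_1[OF L1op_T]) (use T_lint in blast)
    qed
    finally have "ess_radius (besov s p q) (besov_norm s p q) T < spec_radius (besov s p q) (besov_norm s p q) T" .
    moreover have "bounded_op (besov s p q) (besov_norm s p q) T"
      using \<eta>p \<eta>(1) by (intro bounded_op_T s(1) p(1) q) simp
    ultimately show "quasi_compact (besov s p q) (besov_norm s p q) T" by (simp add: quasi_compact_def)
  qed
  then show ?thesis using p0 by blast
qed

end

theorem theorem7p1:
  fixes f :: "real \<Rightarrow> real" and I :: "'i \<Rightarrow> real set" and \<Lambda> :: "'i set"
    and \<beta> \<epsilon> s :: real and q :: ereal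
  assumes "finite \<Lambda>"
    and "\<And>i. i \<in> \<Lambda> \<Longrightarrow> is_interval (I i)"
    and "disjoint_family_on I \<Lambda>"
    and "(\<Union>i\<in>\<Lambda>. I i) = {0..1}"
    and "f ` {0..1} \<subseteq> {0..1}"
    and "\<And>i. i \<in> \<Lambda> \<Longrightarrow> continuous_on (I i) f"
    and "\<exists>c C. 0 < c \<and> c \<le> C \<and>
           (\<forall>i\<in>\<Lambda>. \<forall>x\<in>I i. \<forall>y\<in>I i.
              c * \<bar>x - y\<bar> \<le> \<bar>f x - f y\<bar> \<and> \<bar>f x - f y\<bar> \<le> C * \<bar>x - y\<bar>)"
    and "0 < \<beta>" and "0 < \<epsilon>"
    and "\<And>i. i \<in> \<Lambda> \<Longrightarrow> finite_variation_on (\<beta> + \<epsilon>) (deriv f) (diff_points f (I i))"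
    and "1 < (INF x\<in>(\<Union>i\<in>\<Lambda>. diff_points f (I i)). \<bar>deriv f x\<bar>)"
    and "0 < s" and "s < \<beta>" and "\<beta> < 1"
    and "1 \<le> q"
  shows "bounded_op (besov s 1 q) (besov_norm s 1 q) (transfer_op \<Lambda> I f)
    \<and> ess_radius (besov s 1 q) (besov_norm s 1 q) (transfer_op \<Lambda> I f)
        \<le> ennreal ((INF x\<in>(\<Union>i\<in>\<Lambda>. diff_points f (I i)). \<bar>deriv f x\<bar>) powr (- s))
    \<and> (INF x\<in>(\<Union>i\<in>\<Lambda>. diff_points f (I i)). \<bar>deriv f x\<bar>) powr (- s) < 1
    \<and> (\<exists>p0>1. \<forall>p\<in>{1..<p0}. \<beta> < 1 / p \<and>
          quasi_compact (besov s p q) (besov_norm s p q) (transfer_op \<Lambda> I f))"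
proof -
  define lam where "lam = (INF x\<in>(\<Union>i\<in>\<Lambda>. diff_points f (I i)). \<bar>deriv f x\<bar>)"
  obtain c C where c: "0 < c" "c \<le> C" and lip: "\<And>i x y. i \<in> \<Lambda> \<Longrightarrow> x \<in> I i \<Longrightarrow> y \<in> I i \<Longrightarrow>
      c * \<bar>x - y\<bar> \<le> \<bar>f x - f y\<bar> \<and> \<bar>f x - f y\<bar> \<le> C * \<bar>x - y\<bar>"
    using assms(7) by blast
  \<comment> \<open>Moduli are bounded below by 0, so the infimum is a genuine lower bound.\<close>
  have lam_le: "lam \<le> \<bar>deriv f x\<bar>" if "i \<in> \<Lambda>" "x \<in> diff_points f (I i)" for i x
    unfolding lam_def using that by (intro cINF_lower bdd_belowI2[of _ 0]) auto
  have lam: "1 < lam" using assms(11) by (simp only: lam_def)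
  interpret expanding_map f I \<Lambda> \<beta> "\<beta> + \<epsilon>" c C lam
    by unfold_locales (use assms c lip lam_le lam in auto)
  have "lam powr (- s) < 1" using lam assms(12) powr_less_mono[of "- s" 0 lam] by simp
  then show ?thesis
    unfolding lam_def[symmetric]
    using bounded_op_T[of s 1 q] ess_radius_T_1 quasi_compact_T assms by simp
qed

end
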